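(* Let $k$ be an algebraically closed field of characteristic $0$, and let $\pi:\operatorname{Spec}L\to\operatorname{Spec}K$ correspond to a finite Galois extension $L/K$ of fields finitely generated over $k$ whose Galois group $G_\pi$ has prime order $p$. If $N$ is a simple $\mathcal D_K$-module (of finite dimension over $K$), then either (1) $\pi^!(N)$ is simple, or (2) $\pi^!(N)=\bigoplus_{i=1}^pN_i$, where $N_i\not\cong N_j$ when $i\ne j$ (the $N_i$ being simple $\mathcal D_L$-modules).
   Context: $\mathcal D_L$, $\mathcal D_K$ are the rings of $k$-linear differential operators of $L$ and $K$; $\pi^!(N)=L\otimes_KN$ with its natural structure of module over $\mathcal D_L=L\otimes_K\mathcal D_K$. *)

theory Defs
  imports "HOL-Algebra.Algebra" "HOL-Algebra.Algebraic_Closure_Type"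
begin

section \<open>Fields, finite generation, Galois extensions\<close>

text \<open>Fields are types of class \<open>field\<close>; extensions are given by embeddings, that is, ring
  homomorphisms between the associated \<open>HOL-Algebra\<close> rings.\<close>

abbreviation fld :: "'a::field ring" where
  "fld \<equiv> ring_of_type_algebra"

definition field_embedding :: "('a::field \<Rightarrow> 'b::field) \<Rightarrow> bool" where
  "field_embedding i \<longleftrightarrow> i \<in> ring_hom fld fld"

definition fin_gen_field_ext :: "('a::field \<Rightarrow> 'b::field) \<Rightarrow> bool" where
  "fin_gen_field_ext i \<longleftrightarrow> (\<exists>S. finite S \<and> generate_field fld (range i \<union> S) = UNIV)"

definition finite_field_ext :: "('a::field \<Rightarrow> 'b::field) \<Rightarrow> bool" where
  "finite_field_ext j \<longleftrightarrow> ring.finite_dimension fld (range j) UNIV"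

definition galois_group :: "('a::field \<Rightarrow> 'b::field) \<Rightarrow> ('b \<Rightarrow> 'b) set" where
  "galois_group j = {\<sigma>. \<sigma> \<in> ring_iso fld fld \<and> (\<forall>x. \<sigma> (j x) = j x)}"

definition finite_galois_ext :: "('a::field \<Rightarrow> 'b::field) \<Rightarrow> bool" where
  "finite_galois_ext j \<longleftrightarrow>
     finite_field_ext j \<and> {y. \<forall>\<sigma>\<in>galois_group j. \<sigma> y = y} = range j"

section \<open>Left modules over a not necessarily commutative ring\<close>

text \<open>The record \<open>module\<close> and the locale \<open>submodule\<close> of \<open>HOL-Algebra\<close> apply to any ring, but its
  locale \<open>module\<close> assumes a commutative one.\<close>

locale left_module = R?: ring R + M?: abelian_group M
  for R :: "('r, 'u) ring_scheme" (structure) and M :: "('r, 'm, 'v) module_scheme" (structure) +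
  assumes smult_closed:
      "\<lbrakk>a \<in> carrier R; x \<in> carrier M\<rbrakk> \<Longrightarrow> a \<odot>\<^bsub>M\<^esub> x \<in> carrier M"
    and smult_l_distr:
      "\<lbrakk>a \<in> carrier R; b \<in> carrier R; x \<in> carrier M\<rbrakk> \<Longrightarrow>
        (a \<oplus>\<^bsub>R\<^esub> b) \<odot>\<^bsub>M\<^esub> x = a \<odot>\<^bsub>M\<^esub> x \<oplus>\<^bsub>M\<^esub> b \<odot>\<^bsub>M\<^esub> x"
    and smult_r_distr:
      "\<lbrakk>a \<in> carrier R; x \<in> carrier M; y \<in> carrier M\<rbrakk> \<Longrightarrow>
        a \<odot>\<^bsub>M\<^esub> (x \<oplus>\<^bsub>M\<^esub> y) = a \<odot>\<^bsub>M\<^esub> x \<oplus>\<^bsub>M\<^esub> a \<odot>\<^bsub>M\<^esub> y"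
    and smult_assoc:
      "\<lbrakk>a \<in> carrier R; b \<in> carrier R; x \<in> carrier M\<rbrakk> \<Longrightarrow>
        (a \<otimes>\<^bsub>R\<^esub> b) \<odot>\<^bsub>M\<^esub> x = a \<odot>\<^bsub>M\<^esub> (b \<odot>\<^bsub>M\<^esub> x)"
    and smult_one:
      "x \<in> carrier M \<Longrightarrow> \<one>\<^bsub>R\<^esub> \<odot>\<^bsub>M\<^esub> x = x"

definition simple_module :: "('r, 'u) ring_scheme \<Rightarrow> ('r, 'm, 'v) module_scheme \<Rightarrow> bool" where
  "simple_module R M \<longleftrightarrow> left_module R M \<and> carrier M \<noteq> {\<zero>\<^bsub>M\<^esub>} \<and>
     (\<forall>H. submodule H R M \<longrightarrow> H = {\<zero>\<^bsub>M\<^esub>} \<or> H = carrier M)"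

definition module_isomorphic ::
    "('r, 'u) ring_scheme \<Rightarrow> ('r, 'm, 'v) module_scheme \<Rightarrow> ('r, 'n, 'w) module_scheme \<Rightarrow> bool" where
  "module_isomorphic R M N \<longleftrightarrow> (\<exists>f. bij_betw f (carrier M) (carrier N) \<and>
     (\<forall>x\<in>carrier M. \<forall>y\<in>carrier M. f (x \<oplus>\<^bsub>M\<^esub> y) = f x \<oplus>\<^bsub>N\<^esub> f y) \<and>
     (\<forall>a\<in>carrier R. \<forall>x\<in>carrier M. f (a \<odot>\<^bsub>M\<^esub> x) = a \<odot>\<^bsub>N\<^esub> f x))"

definition internal_direct_sum ::
    "('r, 'u) ring_scheme \<Rightarrow> ('r, 'm, 'v) module_scheme \<Rightarrow> 'i set \<Rightarrow> ('i \<Rightarrow> 'm set) \<Rightarrow> bool" where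
  "internal_direct_sum R M I V \<longleftrightarrow> (\<forall>i\<in>I. submodule (V i) R M) \<and>
     (\<forall>x\<in>carrier M. \<exists>!f. f \<in> (\<Pi>\<^sub>E i\<in>I. V i) \<and> x = (\<Oplus>\<^bsub>M\<^esub>i\<in>I. f i))"

section \<open>Rings of differential operators\<close>

text \<open>Grothendieck's definition: \<open>diff_ops_lt i n\<close> consists of the \<open>k\<close>-linear differential operators
  of order less than \<open>n\<close> on the field \<open>'a\<close>, which is a \<open>k\<close>-algebra through \<open>i\<close>; in the recursion,
  \<open>a\<close> stands for multiplication by \<open>a\<close> and the operator shown is the commutator \<open>[P, a]\<close>.\<close>

primrec diff_ops_lt :: "('k::field \<Rightarrow> 'a::field) \<Rightarrow> nat \<Rightarrow> ('a \<Rightarrow> 'a) set" where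
  "diff_ops_lt i 0 = {\<lambda>_. 0}"
| "diff_ops_lt i (Suc n) =
     {P. Vector_Spaces.linear (\<lambda>c x. i c * x) (\<lambda>c x. i c * x) P \<and>
         (\<forall>a. (\<lambda>x. P (a * x) - a * P x) \<in> diff_ops_lt i n)}"

definition diff_op_ring :: "('k::field \<Rightarrow> 'a::field) \<Rightarrow> ('a \<Rightarrow> 'a) ring" where
  "diff_op_ring i =
     \<lparr>carrier = (\<Union>n. diff_ops_lt i n), monoid.mult = (\<circ>), one = id,
      ring.zero = (\<lambda>_. 0), add = (\<lambda>P Q x. P x + Q x)\<rparr>"

abbreviation mult_op :: "'a::field \<Rightarrow> 'a \<Rightarrow> 'a" where
  "mult_op c \<equiv> \<lambda>x. c * x"

text \<open>An element \<open>c\<close> of the field acts on a module over its ring of differential operators through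
  the operator \<open>mult_op c\<close> of order zero.\<close>

definition fin_dim_diff_module :: "('a::field \<Rightarrow> 'a, 'n, 'u) module_scheme \<Rightarrow> bool" where
  "fin_dim_diff_module N \<longleftrightarrow> (\<exists>B. finite B \<and> B \<subseteq> carrier N \<and>
     (\<forall>x\<in>carrier N. \<exists>c. x = (\<Oplus>\<^bsub>N\<^esub>b\<in>B. mult_op (c b) \<odot>\<^bsub>N\<^esub> b)))"

section \<open>The inverse image \<open>L \<otimes>\<^sub>K N\<close>\<close>

text \<open>The tensor product is the free abelian group on the pairs \<open>(l, n)\<close> modulo the subgroup
  generated by the biadditivity and balancing relations; \<open>L\<close> is a \<open>K\<close>-module through \<open>j\<close>.\<close>

abbreviation tensor_free ::
    "('K::field \<Rightarrow> 'K, 'n, 'u) module_scheme \<Rightarrow> ('L \<times> 'n \<Rightarrow>\<^sub>0 int) monoid" where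
  "tensor_free N \<equiv> free_Abelian_group (UNIV \<times> carrier N)"

definition tensor_rel ::
    "('K::field \<Rightarrow> 'L::field) \<Rightarrow> ('K \<Rightarrow> 'K, 'n, 'u) module_scheme \<Rightarrow> ('L \<times> 'n \<Rightarrow>\<^sub>0 int) set" where
  "tensor_rel j N = generate (tensor_free N)
     ({frag_of (a + b, x) - frag_of (a, x) - frag_of (b, x) | a b x. x \<in> carrier N} \<union>
      {frag_of (a, x \<oplus>\<^bsub>N\<^esub> y) - frag_of (a, x) - frag_of (a, y) | a x y.
         x \<in> carrier N \<and> y \<in> carrier N} \<union>
      {frag_of (a * j c, x) - frag_of (a, mult_op c \<odot>\<^bsub>N\<^esub> x) | a c x. x \<in> carrier N})"

definition tensor_group ::
    "('K::field \<Rightarrow> 'L::field) \<Rightarrow> ('K \<Rightarrow> 'K, 'n, 'u) module_scheme \<Rightarrow> ('L \<times> 'n \<Rightarrow>\<^sub>0 int) set monoid" where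
  "tensor_group j N = tensor_free N Mod tensor_rel j N"

definition tensor ::
    "('K::field \<Rightarrow> 'L::field) \<Rightarrow> ('K \<Rightarrow> 'K, 'n, 'u) module_scheme \<Rightarrow> 'L \<Rightarrow> 'n \<Rightarrow> ('L \<times> 'n \<Rightarrow>\<^sub>0 int) set" where
  "tensor j N l x = tensor_rel j N #>\<^bsub>tensor_free N\<^esub> frag_of (l, x)"

text \<open>The isomorphism \<open>L \<otimes>\<^sub>K D\<^sub>K \<rightarrow> D\<^sub>L\<close> sends \<open>a \<otimes> P\<close> to \<open>a R\<close>, where \<open>R\<close> is the differential
  operator on \<open>L\<close> that extends \<open>P\<close> (it is unique, as \<open>L/K\<close> is finite separable). Under it, \<open>Q \<in> D\<^sub>L\<close>
  acts on \<open>L \<otimes>\<^sub>K N\<close> as follows: if \<open>Q l = \<Sum>\<^sub>s a\<^sub>s R\<^sub>s\<close> in \<open>D\<^sub>L\<close>, with \<open>R\<^sub>s\<close> extending \<open>P\<^sub>s \<in> D\<^sub>K\<close>, then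
  \<open>Q (l \<otimes> x) = \<Sum>\<^sub>s a\<^sub>s \<otimes> P\<^sub>s x\<close>. For a derivation \<open>Q\<close> with \<open>Q = \<Sum>\<^sub>s a\<^sub>s \<partial>\<^sub>s\<close> on \<open>K\<close> this is
  the usual formula \<open>Q (l \<otimes> x) = Q l \<otimes> x + \<Sum>\<^sub>s l a\<^sub>s \<otimes> \<partial>\<^sub>s x\<close>.
  The group \<open>tensor_group j N\<close> is written multiplicatively, so \<open>\<Otimes>\<close> below is the sum of tensors.\<close>

definition pullback_action ::
    "('k::field \<Rightarrow> 'K::field) \<Rightarrow> ('K \<Rightarrow> 'L::field) \<Rightarrow> ('K \<Rightarrow> 'K, 'n, 'u) module_scheme \<Rightarrow>
     ('L \<Rightarrow> 'L) \<Rightarrow> ('L \<times> 'n \<Rightarrow>\<^sub>0 int) set \<Rightarrow> ('L \<times> 'n \<Rightarrow>\<^sub>0 int) set" where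
  "pullback_action i j N Q = (THE T.
     T \<in> hom (tensor_group j N) (tensor_group j N) \<and>
     T \<in> extensional (carrier (tensor_group j N)) \<and>
     (\<forall>l. \<forall>x\<in>carrier N. \<forall>m a P R.
        (\<forall>s<m. P s \<in> carrier (diff_op_ring i) \<and> R s \<in> carrier (diff_op_ring (j \<circ> i)) \<and>
               R s \<circ> j = j \<circ> P s) \<and>
        (\<forall>y. Q (l * y) = (\<Sum>s<m. a s * R s y)) \<longrightarrow>
        T (tensor j N l x) =
          (\<Otimes>\<^bsub>tensor_group j N\<^esub>s\<in>{..<m::nat}. tensor j N (a s) (P s \<odot>\<^bsub>N\<^esub> x))))"

text \<open>The record fields \<open>mult\<close> and \<open>one\<close> play no role for modules.\<close>

definition pullback ::
    "('k::field \<Rightarrow> 'K::field) \<Rightarrow> ('K \<Rightarrow> 'L::field) \<Rightarrow> ('K \<Rightarrow> 'K, 'n, 'u) module_scheme \<Rightarrow>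
     ('L \<Rightarrow> 'L, ('L \<times> 'n \<Rightarrow>\<^sub>0 int) set) module" where
  "pullback i j N =
     \<lparr>carrier = carrier (tensor_group j N), monoid.mult = undefined, one = undefined,
      ring.zero = \<one>\<^bsub>tensor_group j N\<^esub>, add = monoid.mult (tensor_group j N),
      module.smult = pullback_action i j N\<rparr>"

end

theory Submission
  imports Defs
begin

text \<open>Let \<open>\<sigma>\<close> generate the Galois group and let \<open>\<tau> = \<sigma> \<otimes> 1\<close>, which acts on \<open>M = L \<otimes>\<^sub>K N\<close> and permutes
  its submodules. As differential operators on \<open>K\<close> extend to \<open>L\<close>, a \<open>\<tau>\<close>-stable submodule of \<open>M\<close> comes
  from a submodule of \<open>N\<close>, hence is \<open>0\<close> or \<open>M\<close>, and an endomorphism of \<open>M\<close> that commutes with \<open>\<tau>\<close> comes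
  from an endomorphism of \<open>N\<close>, hence is a scalar in \<open>k\<close>.

  If \<open>M\<close> is not simple, then the translates of a maximal submodule yield a nontrivial decomposition
  of \<open>M\<close>, so that \<open>M\<close> has a nonscalar endomorphism. Splitting it under conjugation by \<open>\<tau>\<close> gives a
  nonzero \<open>e\<close> with \<open>\<tau> e = \<omega> e \<tau>\<close>, where \<open>\<omega> \<noteq> 1\<close> is a \<open>p\<close>-th root of unity. The kernel of \<open>e\<close> is
  \<open>\<tau>\<close>-stable, so \<open>e\<close> is injective, and \<open>e\<^sup>p\<close> commutes with \<open>\<tau>\<close>; after rescaling, \<open>e\<^sup>p = 1\<close>. The
  eigenspaces of \<open>e\<close> are permuted cyclically by \<open>\<tau>\<close>. They are simple, since the translates of a nonzero
  submodule of one of them span a \<open>\<tau>\<close>-stable submodule, and pairwise nonisomorphic, since every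
  endomorphism of \<open>M\<close> is a combination of powers of \<open>e\<close> and so commutes with \<open>e\<close>.\<close>

text \<open>Grothendieck's operators come without coordinates or a basis of derivations, so they are
  extended from K to L by averaging: the separability idempotent of L over K, given by dual families
  for the trace form, turns an operator of given order relative to K into one of that order on L;
  the error on K has lower order and is corrected by induction. The same families make the action on
  L \<otimes> N well defined and recover a tensor from traces. An endomorphism of N satisfies a
  polynomial relation over K, by finite dimension. That it is a scalar in k needs enough
  derivations: each element outside the algebraically closed k has a derivation over k with value 1
  there. Conjugation by \<tau> has p-th power the identity, so it splits the endomorphisms of M into
  eigencomponents. The component for the eigenvalue 1 is scalar, so a nonscalar endomorphism has
  another one. As p is prime, \<omega> is primitive: \<open>e\<close> has p distinct eigenvalues,
  and each power of \<omega> occurs as the eigenvalue of a power of \<open>e\<close> under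
  conjugation, which leaves no room for other endomorphisms.\<close>

section \<open>Derivations of fields of characteristic zero\<close>

text \<open>The graphs of derivations of subrings, seen as subrings of the dual numbers \<open>a + b\<epsilon>\<close>.\<close>

definition dual_subring :: "('a::field_char_0 \<times> 'a) set \<Rightarrow> bool" where
  "dual_subring g \<longleftrightarrow> (1, 0) \<in> g \<and> (-1, 0) \<in> g \<and>
     (\<forall>a b a' b'. (a, b) \<in> g \<longrightarrow> (a', b') \<in> g \<longrightarrow> (a + a', b + b') \<in> g) \<and>
     (\<forall>a b a' b'. (a, b) \<in> g \<longrightarrow> (a', b') \<in> g \<longrightarrow> (a * a', a * b' + b * a') \<in> g) \<and>
     (\<forall>b. (0, b) \<in> g \<longrightarrow> b = 0)"

lemma dual_subringD:
  assumes "dual_subring g"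
  shows "(1, 0) \<in> g" "(-1, 0) \<in> g" "(0, 0) \<in> g"
    "(a, b) \<in> g \<Longrightarrow> (a', b') \<in> g \<Longrightarrow> (a + a', b + b') \<in> g"
    "(a, b) \<in> g \<Longrightarrow> (a', b') \<in> g \<Longrightarrow> (a * a', a * b' + b * a') \<in> g"
    "(a, b) \<in> g \<Longrightarrow> (- a, - b) \<in> g"
    "(0, b) \<in> g \<Longrightarrow> b = 0"
    "(a, b) \<in> g \<Longrightarrow> (a, b') \<in> g \<Longrightarrow> b = b'"
proof -
  show 1: "(1, 0) \<in> g" "(-1, 0) \<in> g"
    and add: "\<And>a b a' b'. (a, b) \<in> g \<Longrightarrow> (a', b') \<in> g \<Longrightarrow> (a + a', b + b') \<in> g"
    and mul: "\<And>a b a' b'. (a, b) \<in> g \<Longrightarrow> (a', b') \<in> g \<Longrightarrow> (a * a', a * b' + b * a') \<in> g"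
    and z: "\<And>b. (0, b) \<in> g \<Longrightarrow> b = 0"
    using assms unfolding dual_subring_def by blast+
  show "(0, 0) \<in> g" using add[OF 1] by simp
  show neg: "(- a, - b) \<in> g" if "(a, b) \<in> g" for a b using mul[OF 1(2) that] by simp
  show "b = b'" if "(a, b) \<in> g" "(a, b') \<in> g" using z[of "b - b'"] add[OF that(1) neg[OF that(2)]] by simp
qed

lemma dual_subring_sum:
  assumes "dual_subring g" and "\<And>t. t \<in> A \<Longrightarrow> (f t, h t) \<in> g"
  shows "(sum f A, sum h A) \<in> g"
  using assms(2)
  by (induction A rule: infinite_finite_induct) (auto intro: dual_subringD(3,4)[OF assms(1)])

text \<open>A pair (q, r) with coefficients in g is the polynomial q + r\<epsilon> over the dual
  numbers, and the pair in \<open>g'\<close> is its value at x + u\<epsilon>. So \<open>g'\<close>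
  is the subring generated by g and (x, u), and the hypothesis on u says that it is still the graph
  of a function.\<close>

lemma dual_subring_extend:
  assumes g: "dual_subring g"
    and u: "\<And>q r. (\<And>n. (coeff q n, coeff r n) \<in> g) \<Longrightarrow> poly q x = 0 \<Longrightarrow>
      poly r x + poly (pderiv q) x * u = 0"
  obtains g' where "dual_subring g'" "g \<subseteq> g'" "(x, u) \<in> g'"
proof
  define G where "G = {(q, r). \<forall>n. (coeff q n, coeff r n) \<in> g}"
  define g' where "g' = (\<lambda>(q, r). (poly q x, poly r x + poly (pderiv q) x * u)) ` G"
  have const: "([:a:], [:b:]) \<in> G" if "(a, b) \<in> g" for a b
    using that dual_subringD(3)[OF g] by (auto simp: G_def coeff_pCons split: nat.splits)
  show sub: "g \<subseteq> g'"
  proof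
    fix z assume z: "z \<in> g"
    then show "z \<in> g'"
      unfolding g'_def using const[of "fst z" "snd z"] by (intro image_eqI[of _ _ "([:fst z:], [:snd z:])"]) auto
  qed
  have "([:0, 1:], 0) \<in> G"
    using dual_subringD[OF g] by (auto simp: G_def coeff_pCons split: nat.splits)
  then show "(x, u) \<in> g'"
    unfolding g'_def by (intro image_eqI[of _ _ "([:0, 1:], 0)"]) (auto simp: pderiv_pCons)
  have add: "(a + a', b + b') \<in> g'" if "(a, b) \<in> g'" "(a', b') \<in> g'" for a b a' b'
  proof -
    from that obtain q r q' r' where *: "(q, r) \<in> G" "(q', r') \<in> G" "a = poly q x" "a' = poly q' x"
      "b = poly r x + poly (pderiv q) x * u" "b' = poly r' x + poly (pderiv q') x * u"
      unfolding g'_def by auto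
    have "(q + q', r + r') \<in> G" using * dual_subringD(4)[OF g] by (auto simp: G_def)
    then show ?thesis unfolding g'_def
      by (rule image_eqI[rotated]) (auto simp: * pderiv_add algebra_simps)
  qed
  have mul: "(a * a', a * b' + b * a') \<in> g'" if "(a, b) \<in> g'" "(a', b') \<in> g'" for a b a' b'
  proof -
    from that obtain q r q' r' where *: "(q, r) \<in> G" "(q', r') \<in> G" "a = poly q x" "a' = poly q' x"
      "b = poly r x + poly (pderiv q) x * u" "b' = poly r' x + poly (pderiv q') x * u"
      unfolding g'_def by auto
    have "(coeff (q * q') n, coeff (q * r' + r * q') n) \<in> g" for n
      unfolding coeff_add coeff_mult sum.distrib[symmetric]
      by (rule dual_subring_sum[OF g], rule dual_subringD(5)[OF g]) (use * in \<open>auto simp: G_def\<close>)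
    then have "(q * q', q * r' + r * q') \<in> G" by (auto simp: G_def)
    then show ?thesis unfolding g'_def
      by (rule image_eqI[rotated]) (auto simp: * pderiv_mult algebra_simps)
  qed
  have "b = 0" if "(0, b) \<in> g'" for b
    using that u unfolding g'_def G_def by auto
  then show "dual_subring g'"
    unfolding dual_subring_def using add mul sub dual_subringD(1,2)[OF g] by blast
qed

text \<open>\<open>u\<close> is forced by a polynomial \<open>q\<^sub>0\<close> of minimal degree that vanishes at \<open>x\<close>; the other
  vanishing polynomials are reduced to it by pseudo-division.\<close>

lemma dual_subring_slope:
  fixes x :: "'a::field_char_0"
  assumes g: "dual_subring g"
  obtains u where "\<And>q r. (\<And>n. (coeff q n, coeff r n) \<in> g) \<Longrightarrow> poly q x = 0 \<Longrightarrow>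
      poly r x + poly (pderiv q) x * u = 0"
proof -
  define I where "I = {(q, r). (\<forall>n. (coeff q n, coeff r n) \<in> g) \<and> poly q x = 0}"
  have I0: "r = 0" if "(0, r) \<in> I" for r
    using that dual_subringD(7)[OF g] by (auto simp: I_def poly_eq_iff)
  show thesis
  proof (cases "\<exists>q r. (q, r) \<in> I \<and> q \<noteq> 0")
    case False
    then have "q = 0 \<and> r = 0" if "(q, r) \<in> I" for q r using that I0 by blast
    then show thesis by (intro that[of 0]) (auto simp: I_def)
  next
    case True
    then obtain q1 r1 where "(q1, r1) \<in> I" "q1 \<noteq> 0" by blast
    then have "\<exists>z. z \<in> I \<and> fst z \<noteq> 0" by force
    then obtain z where z: "z \<in> I \<and> fst z \<noteq> 0"
      and zmin: "\<And>y. y \<in> I \<and> fst y \<noteq> 0 \<Longrightarrow> degree (fst z) \<le> degree (fst y)"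
      using ex_has_least_nat[of "\<lambda>z. z \<in> I \<and> fst z \<noteq> 0" _ "\<lambda>z. degree (fst z)"] by metis
    obtain q0 r0 where zq: "z = (q0, r0)" by force
    have q0: "(q0, r0) \<in> I" "q0 \<noteq> 0" using z zq by auto
    have min: "degree q0 \<le> degree q" if "(q, r) \<in> I" "q \<noteq> 0" for q r
      using zmin[of "(q, r)"] that zq by auto
    have deg: "degree q0 > 0"
    proof (rule ccontr)
      assume "\<not> ?thesis"
      then obtain a where "q0 = [:a:]" by (metis degree_eq_zeroE gr0I)
      then show False using q0 by (auto simp: I_def)
    qed
    \<comment> \<open>Otherwise the pair of derivatives of \<open>q0\<close> and \<open>r0\<close>
      would be a vanishing pair of smaller degree, nonzero in characteristic 0. Its coefficients
      stay in g because the integers have derivative 0.\<close>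
    have slope: "poly (pderiv q0) x \<noteq> 0"
    proof
      assume 0: "poly (pderiv q0) x = 0"
      have nat: "(of_nat m, 0) \<in> g" for m
      proof (induction m)
        case (Suc m)
        then show ?case using dual_subringD(4)[OF g dual_subringD(1)[OF g] Suc] by simp
      qed (simp add: dual_subringD(3)[OF g])
      have "(coeff (pderiv q0) n, coeff (pderiv r0) n) \<in> g" for n
        using dual_subringD(5)[OF g nat[of "Suc n"], of "coeff q0 (Suc n)" "coeff r0 (Suc n)"] q0
        by (auto simp: I_def coeff_pderiv)
      then have "(pderiv q0, pderiv r0) \<in> I" using 0 by (auto simp: I_def)
      moreover have "pderiv q0 \<noteq> 0" using deg by (auto simp: pderiv_eq_0_iff)
      ultimately have "degree q0 \<le> degree (pderiv q0)" by (rule min)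
      then show False using deg by (simp add: degree_pderiv)
    qed
    define u where "u = - poly r0 x / poly (pderiv q0) x"
    have u0: "poly r0 x + poly (pderiv q0) x * u = 0" using slope by (simp add: u_def)
    have "poly r x + poly (pderiv q) x * u = 0" if "(q, r) \<in> I" for q r
      using that
    proof (induction "degree q" arbitrary: q r rule: less_induct)
      case less
      show ?case
      proof (cases "q = 0")
        case True
        then have "r = 0" using I0 less.prems by blast
        then show ?thesis using True by simp
      next
        case False
        have le: "degree q0 \<le> degree q" using min less.prems False by blast
        define m where "m = degree q - degree q0"
        define a where "a = lead_coeff q0"
        define a' where "a' = coeff r0 (degree q0)"
        define b where "b = lead_coeff q"
        define b' where "b' = coeff r (degree q)"
        \<comment> \<open>The dual number (a + a'\<epsilon>) (q + r\<epsilon>) - (b + b'\<epsilon>)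
          X^m (q0 + r0\<epsilon>) is q2 + r2\<epsilon>; its real part loses the leading term of
          q.\<close>
        define q2 where "q2 = smult a q - monom b m * q0"
        define r2 where "r2 = smult a r + smult a' q - (monom b m * r0 + monom b' m * q0)"
        have G: "(coeff q n, coeff r n) \<in> g" "(coeff q0 n, coeff r0 n) \<in> g" for n
          using less.prems q0 by (auto simp: I_def)
        have ab: "(a, a') \<in> g" "(b, b') \<in> g" using G unfolding a_def b_def a'_def b'_def by auto
        have mon: "(coeff (monom b m * q0) n, coeff (monom b m * r0 + monom b' m * q0) n) \<in> g" for n
          using dual_subringD(5)[OF g ab(2) G(2)[of "n - m"]] dual_subringD(3)[OF g]
          by (auto simp: coeff_monom_mult)
        have "(coeff q2 n, coeff r2 n) \<in> g" for n
          using dual_subringD(4)[OF g dual_subringD(5)[OF g ab(1) G(1)[of n]] dual_subringD(6)[OF g mon[of n]]]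
          by (simp add: q2_def r2_def algebra_simps)
        then have I2: "(q2, r2) \<in> I" using q0 less.prems by (auto simp: I_def q2_def)
        have "degree q2 < degree q \<or> q2 = 0"
        proof -
          have m: "m + degree q0 = degree q" using le m_def by simp
          have "degree (monom b m * q0) \<le> m + degree q0"
            by (rule order_trans[OF degree_mult_le]) (simp add: degree_monom_le)
          then have d: "degree q2 \<le> degree q" unfolding q2_def
            by (intro degree_diff_le) (auto simp: m)
          have "coeff q2 (degree q) = 0"
            using le by (simp add: q2_def coeff_monom_mult a_def b_def m_def)
          then show ?thesis using d by (metis le_neq_implies_less leading_coeff_0_iff)
        qed
        then have "poly r2 x + poly (pderiv q2) x * u = 0"
          using less.hyps[OF _ I2] I2 I0[of r2] by (cases "q2 = 0") auto
        moreover have "poly q0 x = 0" "poly q x = 0" using q0 less.prems by (auto simp: I_def)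
        ultimately have "a * (poly r x + poly (pderiv q) x * u) =
            poly (monom b m) x * (poly r0 x + poly (pderiv q0) x * u)"
          by (simp add: q2_def r2_def pderiv_smult pderiv_diff pderiv_mult algebra_simps)
        then show ?thesis using u0 q0(2) by (simp add: a_def)
      qed
    qed
    then show thesis using that[of u] by (auto simp: I_def)
  qed
qed

text \<open>By Zorn's lemma the graph lies in a maximal one, and a maximal one is defined
  everywhere: \<open>dual_subring_slope\<close> finds an admissible value at any point and
  \<open>dual_subring_extend\<close> adjoins it.\<close>

lemma dual_subring_maximal:
  assumes g: "dual_subring g"
  obtains d where "\<And>x y. d (x + y) = d x + d y" "\<And>x y. d (x * y) = x * d y + d x * y"
    "\<And>a b. (a, b) \<in> g \<Longrightarrow> d a = b"
proof -
  define S where "S = {h. dual_subring h \<and> g \<subseteq> h}"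
  have "\<exists>m\<in>S. \<forall>h\<in>S. m \<subseteq> h \<longrightarrow> h = m"
  proof (rule subset_Zorn_nonempty)
    show "S \<noteq> {}" using g by (auto simp: S_def)
    fix C assume C: "C \<noteq> {}" "subset.chain S C"
    then have CS: "\<And>h. h \<in> C \<Longrightarrow> dual_subring h \<and> g \<subseteq> h" by (auto simp: subset.chain_def S_def)
    have dir: "\<exists>h\<in>C. z \<in> h \<and> z' \<in> h" if "z \<in> \<Union>C" "z' \<in> \<Union>C" for z z'
      using that C(2) by (meson UnionE subset_chain_def subsetD)
    have "dual_subring (\<Union>C)"
      unfolding dual_subring_def
    proof (intro conjI allI impI)
      obtain h where h: "h \<in> C" using C by blast
      show "(1, 0) \<in> \<Union>C" "(-1, 0) \<in> \<Union>C"
        using h CS dual_subringD(1,2) by blast+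
      fix a b a' b' assume "(a, b) \<in> \<Union>C" "(a', b') \<in> \<Union>C"
      then obtain h where "h \<in> C" "(a, b) \<in> h" "(a', b') \<in> h" using dir by blast
      then show "(a + a', b + b') \<in> \<Union>C" "(a * a', a * b' + b * a') \<in> \<Union>C"
        using CS dual_subringD(4,5) by blast+
    next
      fix b assume "(0, b) \<in> \<Union>C"
      then show "b = 0" using CS dual_subringD(7) by blast
    qed
    then show "\<Union>C \<in> S" using C CS by (auto simp: S_def)
  qed
  then obtain h where h: "dual_subring h" "g \<subseteq> h"
    and max: "\<And>h'. dual_subring h' \<Longrightarrow> g \<subseteq> h' \<Longrightarrow> h \<subseteq> h' \<Longrightarrow> h' = h"
    by (auto simp: S_def)
  have "\<exists>b. (x, b) \<in> h" for x
  proof -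
    obtain u where "\<And>q r. (\<And>n. (coeff q n, coeff r n) \<in> h) \<Longrightarrow> poly q x = 0 \<Longrightarrow>
      poly r x + poly (pderiv q) x * u = 0"
      using dual_subring_slope[OF h(1), of x] by blast
    then obtain h' where "dual_subring h'" "h \<subseteq> h'" "(x, u) \<in> h'"
      using dual_subring_extend[OF h(1)] by blast
    then show ?thesis using max h(2) by blast
  qed
  then obtain d where d: "\<And>x. (x, d x) \<in> h" by metis
  have d_eq: "d a = b" if "(a, b) \<in> h" for a b using that d dual_subringD(8)[OF h(1)] by blast
  show thesis
  proof (rule that)
    show "d (x + y) = d x + d y" for x y by (intro d_eq dual_subringD(4)[OF h(1)] d)
    show "d (x * y) = x * d y + d x * y" for x y by (intro d_eq dual_subringD(5)[OF h(1)] d)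
    show "d a = b" if "(a, b) \<in> g" for a b using d_eq that h(2) by blast
  qed
qed

section \<open>Field embeddings and derivations over an algebraically closed field\<close>

lemma field_embeddingD:
  assumes "field_embedding i"
  shows "i (x + y) = i x + i y" "i (x * y) = i x * i y" "i 1 = 1" "i 0 = 0" "i (- x) = - i x"
    "i (x - y) = i x - i y" "i x = 0 \<longleftrightarrow> x = 0" "inj i"
proof -
  show add: "\<And>x y. i (x + y) = i x + i y" and mul: "\<And>x y. i (x * y) = i x * i y" and 1: "i 1 = 1"
    using assms by (auto simp: field_embedding_def ring_hom_def ring_of_type_algebra_def)
  show 0: "i 0 = 0" using add[of 0 0] by (metis add.right_neutral add_left_cancel)
  show neg: "\<And>x. i (- x) = - i x" using add[of "- x" x for x] 0 by (simp add: eq_neg_iff_add_eq_0)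
  show diff: "\<And>x y. i (x - y) = i x - i y" using add[of x "- y" for x y] neg by simp
  have *: "x = 0" if "i x = 0" for x
    by (rule ccontr) (use mul[of x "inverse x"] 1 that in auto)
  then show "i x = 0 \<longleftrightarrow> x = 0" using 0 by auto
  show "inj i" by (rule injI) (use * diff in \<open>metis right_minus_eq\<close>)
qed

lemma field_embedding_sum: "field_embedding i \<Longrightarrow> i (sum f A) = (\<Sum>x\<in>A. i (f x))"
  by (induction A rule: infinite_finite_induct) (auto simp: field_embeddingD)

text \<open>Algebraic closedness gives a root y of q in the small field. Dividing by X - y keeps the
  coefficients in that field, and x is either that root or a root of the quotient, which has smaller
  degree.\<close>

lemma alg_closed_subfield_root:
  fixes i :: "'k::alg_closed_field \<Rightarrow> 'a::field"
  assumes i: "field_embedding i" and q: "q \<noteq> 0" "\<And>n. coeff q n \<in> range i" and x: "poly q x = 0"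
  shows "x \<in> range i"
  using q x
proof (induction "degree q" arbitrary: q)
  case 0
  then obtain a where "q = [:a:]" by (metis degree_eq_zeroE)
  then show ?case using 0 by simp
next
  case (Suc m)
  define q' where "q' n = inv_into UNIV i (coeff q n)" for n
  have q': "i (q' n) = coeff q n" for n unfolding q'_def using Suc.prems(2) by (rule f_inv_into_f)
  have "\<exists>y. (\<Sum>k\<le>Suc m. q' k * y ^ k) = 0"
    using Suc.hyps(2) Suc.prems(1) q'[of "Suc m"] field_embeddingD(4)[OF i]
    by (intro alg_closed) auto
  then obtain y where "(\<Sum>k\<le>Suc m. q' k * y ^ k) = 0" by blast
  then have "i (\<Sum>k\<le>Suc m. q' k * y ^ k) = 0" by (simp add: field_embeddingD(4)[OF i])
  moreover have "i (y ^ k) = i y ^ k" for k by (induction k) (auto simp: field_embeddingD[OF i])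
  ultimately have "poly q (i y) = 0"
    unfolding poly_altdef Suc.hyps(2)[symmetric] field_embedding_sum[OF i] field_embeddingD(2)[OF i] q'
    by simp
  then have "[:- i y, 1:] dvd q" by (simp add: poly_eq_0_iff_dvd)
  then obtain h where h: "q = [:- i y, 1:] * h" by (auto simp: dvd_def)
  have h0: "h \<noteq> 0" using h Suc.prems by auto
  have deg: "degree q = Suc (degree h)"
    unfolding h using degree_mult_eq[of "[:- i y, 1:]" h] h0 by (simp del: mult_pCons_left)
  have "coeff h n \<in> range i" for n
  \<comment> \<open>Downwards from above the degree: \<open>coeff q (Suc n)\<close> expresses
    \<open>coeff h n\<close> through \<open>coeff h (Suc n)\<close>.\<close>
  proof (induction "Suc (degree h) - n" arbitrary: n)
    case 0
    then have "coeff h n = i 0" by (simp add: coeff_eq_0 field_embeddingD(4)[OF i])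
    then show ?case by simp
  next
    case (Suc d)
    have "coeff h (Suc n) \<in> range i" using Suc by (intro Suc.hyps) auto
    then obtain a where a: "coeff h (Suc n) = i a" by blast
    obtain b where b: "coeff q (Suc n) = i b" using q' by metis
    have "coeff q (Suc n) = coeff h n - i y * coeff h (Suc n)" by (simp add: h)
    then have "coeff h n = i (b + y * a)" using a b by (simp add: field_embeddingD[OF i])
    then show ?case by blast
  qed
  moreover have "x = i y \<or> poly h x = 0" using Suc.prems(3) h by auto
  ultimately show ?case using Suc.hyps(1)[of h] Suc.hyps(2) deg h0 by auto
qed

text \<open>As k is algebraically closed, c is transcendental over it: only the zero polynomial over
  k vanishes at c. So any value at c is compatible with the zero derivation of k, in particular the
  value 1, and the result extends to the whole field.\<close>

lemma derivation_exists:
  fixes i :: "'k::alg_closed_field \<Rightarrow> 'a::field_char_0"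
  assumes i: "field_embedding i" and c: "c \<notin> range i"
  obtains d where "\<And>x y. d (x + y) = d x + d y" "\<And>x y. d (x * y) = x * d y + d x * y"
    "\<And>l. d (i l) = 0" "d c = 1"
proof -
  define g where "g = (\<lambda>l. (i l, 0 :: 'a)) ` UNIV"
  have g: "dual_subring g"
    unfolding dual_subring_def
  proof (intro conjI allI impI)
    show "(1, 0) \<in> g" "(-1, 0) \<in> g"
      unfolding g_def by (auto intro: image_eqI[of _ _ 1] image_eqI[of _ _ "-1"] simp: field_embeddingD[OF i])
  qed (auto simp: g_def image_iff simp flip: field_embeddingD(1,2)[OF i])
  have slope: "poly r c + poly (pderiv q) c * 1 = 0"
    if coeffs: "\<And>n. (coeff q n, coeff r n) \<in> g" and "poly q c = 0" for q r
  proof -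
    have "coeff q n \<in> range i" "coeff r n = 0" for n using coeffs[of n] by (auto simp: g_def)
    then have "q = 0" "r = 0" using alg_closed_subfield_root[OF i _ _ that(2)] c by (auto simp: poly_eq_iff)
    then show ?thesis by simp
  qed
  obtain g' where g': "dual_subring g'" "g \<subseteq> g'" "(c, 1) \<in> g'"
    using dual_subring_extend[OF g slope] .
  show thesis

  proof (rule dual_subring_maximal[OF g'(1)])
    fix d :: "'a \<Rightarrow> 'a"
    assume d: "\<And>x y. d (x + y) = d x + d y" "\<And>x y. d (x * y) = x * d y + d x * y"
      "\<And>a b. (a, b) \<in> g' \<Longrightarrow> d a = b"
    have "(i l, 0) \<in> g'" for l using g'(2) by (auto simp: g_def)
    then show thesis using d g'(3) by (intro that[of d]) auto
  qed
qed

section \<open>Differential operators relative to a subfield\<close>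

text \<open>Differential operators of order less than \<open>n\<close> relative to a field that is embedded through \<open>u\<close> and
  \<open>v\<close>; Grothendieck's operators are those for \<open>u = v = id\<close> that are linear over the ground field.\<close>

primrec rel_ops :: "('c \<Rightarrow> 'a::field) \<Rightarrow> ('c \<Rightarrow> 'b::field) \<Rightarrow> nat \<Rightarrow> ('a \<Rightarrow> 'b) set" where
  "rel_ops u v 0 = {\<lambda>_. 0}"
| "rel_ops u v (Suc n) = {P. (\<forall>x y. P (x + y) = P x + P y) \<and>
     (\<forall>c. (\<lambda>x. P (u c * x) - v c * P x) \<in> rel_ops u v n)}"

lemma rel_ops_add_arg: "P \<in> rel_ops u v n \<Longrightarrow> P (x + y) = P x + P y"
  by (cases n) auto

lemma rel_ops_0_arg: "P \<in> rel_ops u v n \<Longrightarrow> P 0 = 0"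
  using rel_ops_add_arg[of P u v n 0 0] by (metis add.right_neutral add_left_cancel)

lemma rel_ops_minus_arg: "P \<in> rel_ops u v n \<Longrightarrow> P (- x) = - P x"
  using rel_ops_add_arg[of P u v n "- x" x] rel_ops_0_arg[of P u v n] by (simp add: eq_neg_iff_add_eq_0)

lemma rel_ops_diff_arg: "P \<in> rel_ops u v n \<Longrightarrow> P (x - y) = P x - P y"
  using rel_ops_add_arg[of P u v n x "- y"] by (simp add: rel_ops_minus_arg)

lemma rel_ops_sum_arg: "P \<in> rel_ops u v n \<Longrightarrow> P (sum f A) = (\<Sum>x\<in>A. P (f x))"
  by (induction A rule: infinite_finite_induct) (auto simp: rel_ops_add_arg rel_ops_0_arg)

lemma rel_ops_SucI:
  assumes "\<And>x y. P (x + y) = P x + P y" "\<And>c. (\<lambda>x. P (u c * x) - v c * P x) \<in> rel_ops u v n"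
  shows "P \<in> rel_ops u v (Suc n)"
  using assms by simp

lemma rel_ops_comm: "P \<in> rel_ops u v (Suc n) \<Longrightarrow> (\<lambda>x. P (u c * x) - v c * P x) \<in> rel_ops u v n"
  by simp

declare rel_ops.simps(2) [simp del]

lemma rel_ops_zero: "(\<lambda>_. 0) \<in> rel_ops u v n"
  by (induction n) (auto simp: rel_ops.simps(2))

lemma rel_ops_Suc: "P \<in> rel_ops u v n \<Longrightarrow> P \<in> rel_ops u v (Suc n)"
proof (induction n arbitrary: P)
  case 0
  then show ?case using rel_ops_zero by auto
next
  case (Suc n)
  show ?case
    by (rule rel_ops_SucI) (rule rel_ops_add_arg[OF Suc.prems] Suc.IH[OF rel_ops_comm[OF Suc.prems]])+
qed

lemma rel_ops_mono: "P \<in> rel_ops u v m \<Longrightarrow> m \<le> n \<Longrightarrow> P \<in> rel_ops u v n"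
  by (induction n) (auto simp: le_Suc_eq intro: rel_ops_Suc)

lemma rel_ops_add:
  "P \<in> rel_ops u v n \<Longrightarrow> Q \<in> rel_ops u v n \<Longrightarrow> (\<lambda>x. P x + Q x) \<in> rel_ops u v n"
proof (induction n arbitrary: P Q)
  case (Suc n)
  show ?case
  proof (rule rel_ops_SucI)
    show "(\<lambda>x. (P (u c * x) + Q (u c * x)) - v c * (P x + Q x)) \<in> rel_ops u v n" for c
      using Suc.IH[OF rel_ops_comm[OF Suc.prems(1), of c] rel_ops_comm[OF Suc.prems(2), of c]]
      by (simp add: algebra_simps)
  qed (simp add: rel_ops_add_arg[OF Suc.prems(1)] rel_ops_add_arg[OF Suc.prems(2)])
qed auto

lemma rel_ops_left_mult: "P \<in> rel_ops u v n \<Longrightarrow> (\<lambda>x. b * P x) \<in> rel_ops u v n"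
proof (induction n arbitrary: P)
  case (Suc n)
  show ?case
  proof (rule rel_ops_SucI)
    show "(\<lambda>x. b * P (u c * x) - v c * (b * P x)) \<in> rel_ops u v n" for c
      using Suc.IH[OF rel_ops_comm[OF Suc.prems, of c]] by (simp add: algebra_simps)
  qed (simp add: rel_ops_add_arg[OF Suc.prems] algebra_simps)
qed auto

lemma rel_ops_right_mult: "P \<in> rel_ops u v n \<Longrightarrow> (\<lambda>x. P (a * x)) \<in> rel_ops u v n"
proof (induction n arbitrary: P)
  case (Suc n)
  show ?case
  proof (rule rel_ops_SucI)
    show "(\<lambda>x. P (a * (u c * x)) - v c * P (a * x)) \<in> rel_ops u v n" for c
      using Suc.IH[OF rel_ops_comm[OF Suc.prems, of c]] by (simp add: algebra_simps)
  qed (simp add: rel_ops_add_arg[OF Suc.prems] algebra_simps)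
qed auto

lemma rel_ops_minus: "P \<in> rel_ops u v n \<Longrightarrow> (\<lambda>x. - P x) \<in> rel_ops u v n"
  using rel_ops_left_mult[of P u v n "-1"] by simp

lemma rel_ops_diff:
  "P \<in> rel_ops u v n \<Longrightarrow> Q \<in> rel_ops u v n \<Longrightarrow> (\<lambda>x. P x - Q x) \<in> rel_ops u v n"
  using rel_ops_add[OF _ rel_ops_minus, of P u v n Q] by simp

lemma rel_ops_sum:
  "(\<And>t. t \<in> A \<Longrightarrow> P t \<in> rel_ops u v n) \<Longrightarrow> (\<lambda>x. \<Sum>t\<in>A. P t x) \<in> rel_ops u v n"
  by (induction A rule: infinite_finite_induct)
    (auto simp: rel_ops_zero intro: rel_ops_add)

text \<open>The commutator of a composite with c is the sum of Q after [P, c] and of [Q, c] after P;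
  in each summand one of the two orders has dropped, so the induction is on their sum.\<close>

lemma rel_ops_comp:
  "P \<in> rel_ops u v m \<Longrightarrow> Q \<in> rel_ops v w n \<Longrightarrow> (\<lambda>x. Q (P x)) \<in> rel_ops u w (m + n)"
proof (induction "m + n" arbitrary: m n P Q rule: less_induct)
  case less
  show ?case
  proof (cases "m = 0 \<or> n = 0")
    case True
    then have "(\<lambda>x. Q (P x)) = (\<lambda>_. 0)"
      using less.prems rel_ops_0_arg[OF less.prems(2)] by auto
    then show ?thesis by (simp only: rel_ops_zero)
  next
    case False
    then obtain m' n' where mn: "m = Suc m'" "n = Suc n'" by (metis not0_implies_Suc)
    have "(\<lambda>x. Q (P (u c * x)) - w c * Q (P x)) \<in> rel_ops u w (Suc (m' + n'))" for c
    proof -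
      have "(\<lambda>x. Q (P (u c * x) - v c * P x)) \<in> rel_ops u w (m' + n)"
        using less.hyps[of m' n "\<lambda>x. P (u c * x) - v c * P x" Q] rel_ops_comm[of P u v m' c] less.prems mn
        by simp
      moreover have "(\<lambda>x. Q (v c * P x) - w c * Q (P x)) \<in> rel_ops u w (m + n')"
        using less.hyps[of m n' P "\<lambda>x. Q (v c * x) - w c * Q x"] rel_ops_comm[of Q v w n' c] less.prems mn
        by simp
      ultimately have "(\<lambda>x. Q (P (u c * x) - v c * P x) + (Q (v c * P x) - w c * Q (P x)))
          \<in> rel_ops u w (Suc (m' + n'))"
        using mn by (intro rel_ops_add) auto
      then show ?thesis by (simp only: rel_ops_diff_arg[OF less.prems(2)] diff_add_eq_diff_diff_swap add_diff_eq diff_add_cancel)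
    qed
    then have "(\<lambda>x. Q (P x)) \<in> rel_ops u w (Suc (Suc (m' + n')))"
      by (rule rel_ops_SucI[rotated]) (simp only: rel_ops_add_arg[OF less.prems(1)] rel_ops_add_arg[OF less.prems(2)])
    then show ?thesis by (simp only: mn add_Suc add_Suc_right)
  qed
qed

lemma rel_ops_base_change: "P \<in> rel_ops u v n \<Longrightarrow> P \<in> rel_ops (u \<circ> w) (v \<circ> w) n"
  by (induction n arbitrary: P) (auto simp: rel_ops.simps(2))

lemma rel_ops_pre:
  assumes f: "\<And>x y. f (x + y) = f x + f y" "\<And>c x. f (u' c * x) = u c * f x"
  shows "P \<in> rel_ops u v n \<Longrightarrow> (\<lambda>x. P (f x)) \<in> rel_ops u' v n"
  by (induction n arbitrary: P) (auto simp: rel_ops.simps(2) f)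

lemma rel_ops_post:
  assumes f: "\<And>x y. f (x + y) = f x + f y" "\<And>c x. f (v c * x) = v' c * f x"
  shows "P \<in> rel_ops u v n \<Longrightarrow> (\<lambda>x. f (P x)) \<in> rel_ops u v' n"
proof (induction n arbitrary: P)
  case 0
  have "f 0 = 0" using f(1)[of 0 0] by (metis add.right_neutral add_left_cancel)
  then show ?case using 0 by simp
next
  case (Suc n)
  have f_diff: "f (x - y) = f x - f y" for x y using f(1)[of "x - y" y] by simp
  show ?case
  proof (rule rel_ops_SucI)
    show "(\<lambda>x. f (P (u c * x)) - v' c * f (P x)) \<in> rel_ops u v' n" for c
      using Suc.IH[OF rel_ops_comm[OF Suc.prems, of c]] by (simp only: f_diff f(2))
  qed (simp only: rel_ops_add_arg[OF Suc.prems] f(1))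
qed

lemma rel_ops_conj:
  assumes f: "\<And>x y. f (x + y) = f x + f y" "\<And>x y. f (x * y) = f x * f y"
    and g: "\<And>x y. g (x + y) = g x + g y" "\<And>x y. g (x * y) = g x * g y" "\<And>x. f (g x) = x"
  shows "P \<in> rel_ops id id n \<Longrightarrow> (\<lambda>x. f (P (g x))) \<in> rel_ops id id n"
proof (induction n arbitrary: P)
  case 0
  have "f 0 = 0" using f(1)[of 0 0] by (metis add.right_neutral add_left_cancel)
  then show ?case using 0 by simp
next
  case (Suc n)
  have f_diff: "f (x - y) = f x - f y" for x y using f(1)[of "x - y" y] by simp
  show ?case
  proof (rule rel_ops_SucI)
    show "(\<lambda>x. f (P (g (id c * x))) - id c * f (P (g x))) \<in> rel_ops id id n" for c
      using Suc.IH[OF rel_ops_comm[OF Suc.prems, of "g c"]] by (simp add: f_diff f(2) g id_def)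
  qed (simp only: rel_ops_add_arg[OF Suc.prems] f(1) g(1))
qed

text \<open>Linearity over k can be taken out of the recursion, since the commutator of a k-linear
  operator with a multiplication is k-linear again.\<close>

lemma diff_ops_lt_eq:
  assumes i: "field_embedding i"
  shows "diff_ops_lt i n = {P \<in> rel_ops id id n. \<forall>l x. P (i l * x) = i l * P x}"
proof (induction n)
  case (Suc n)
  have vs: "vector_space (\<lambda>c x. i c * x)"
    by unfold_locales (auto simp: field_embeddingD[OF i] algebra_simps)
  have lin: "Vector_Spaces.linear (\<lambda>c x. i c * x) (\<lambda>c x. i c * x) P \<longleftrightarrow>
      (\<forall>x y. P (x + y) = P x + P y) \<and> (\<forall>l x. P (i l * x) = i l * P x)" for P
    using vs by (simp add: Vector_Spaces.linear_iff)
  have "P (a * (i l * x)) - a * P (i l * x) = i l * (P (a * x) - a * P x)"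
    if "\<forall>l x. P (i l * x) = i l * P x" for P :: "'b \<Rightarrow> 'b" and a l x
    using that[rule_format, of l "a * x"] that by (simp add: algebra_simps)
  then show ?case
    unfolding diff_ops_lt.simps lin Suc rel_ops.simps(2) by auto
qed auto

lemma carrier_diff_op_ring:
  assumes i: "field_embedding i"
  shows "P \<in> carrier (diff_op_ring i) \<longleftrightarrow>
    (\<exists>n. P \<in> rel_ops id id n) \<and> (\<forall>l x. P (i l * x) = i l * P x)"
  by (auto simp: diff_op_ring_def diff_ops_lt_eq[OF i])

lemma diff_op_ring_simps:
  "\<zero>\<^bsub>diff_op_ring i\<^esub> = (\<lambda>_. 0)" "\<one>\<^bsub>diff_op_ring i\<^esub> = id"
  "P \<oplus>\<^bsub>diff_op_ring i\<^esub> Q = (\<lambda>x. P x + Q x)" "P \<otimes>\<^bsub>diff_op_ring i\<^esub> Q = P \<circ> Q"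
  by (simp_all add: diff_op_ring_def)

lemma diff_op_add_arg:
  "field_embedding i \<Longrightarrow> P \<in> carrier (diff_op_ring i) \<Longrightarrow> P (x + y) = P x + P y"
  using carrier_diff_op_ring rel_ops_add_arg by metis

lemma diff_op_sum_arg:
  "field_embedding i \<Longrightarrow> P \<in> carrier (diff_op_ring i) \<Longrightarrow> P (sum f A) = (\<Sum>x\<in>A. P (f x))"
  using carrier_diff_op_ring rel_ops_sum_arg by metis

lemma mult_op_rel_ops: "mult_op a \<in> rel_ops id id 1"
  by (auto simp: rel_ops.simps(2) algebra_simps)

lemma mult_op_diff_op: "field_embedding i \<Longrightarrow> mult_op a \<in> carrier (diff_op_ring i)"
  unfolding carrier_diff_op_ring using mult_op_rel_ops by (auto simp: algebra_simps)

lemma id_diff_op: "field_embedding i \<Longrightarrow> id \<in> carrier (diff_op_ring i)"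
  using mult_op_diff_op[of i 1] by (simp add: id_def)

lemma zero_diff_op: "field_embedding i \<Longrightarrow> (\<lambda>_. 0) \<in> carrier (diff_op_ring i)"
  using mult_op_diff_op[of i 0] by simp

lemma add_diff_op:
  assumes i: "field_embedding i" and "P \<in> carrier (diff_op_ring i)" "Q \<in> carrier (diff_op_ring i)"
  shows "(\<lambda>x. P x + Q x) \<in> carrier (diff_op_ring i)"
proof -
  obtain m n where "P \<in> rel_ops id id m" "Q \<in> rel_ops id id n"
    using assms(2,3) unfolding carrier_diff_op_ring[OF i] by blast
  then have "(\<lambda>x. P x + Q x) \<in> rel_ops id id (max m n)"
    by (intro rel_ops_add) (erule rel_ops_mono, simp)+
  then show ?thesis using assms(2,3) unfolding carrier_diff_op_ring[OF i] by (auto simp: algebra_simps)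
qed

lemma comp_diff_op:
  assumes i: "field_embedding i" and "P \<in> carrier (diff_op_ring i)" "Q \<in> carrier (diff_op_ring i)"
  shows "P \<circ> Q \<in> carrier (diff_op_ring i)"
proof -
  obtain m n where "P \<in> rel_ops id id m" "Q \<in> rel_ops id id n"
    using assms(2,3) unfolding carrier_diff_op_ring[OF i] by blast
  then have "P \<circ> Q \<in> rel_ops id id (n + m)" unfolding comp_def by (intro rel_ops_comp)
  then show ?thesis using assms(2,3) unfolding carrier_diff_op_ring[OF i] by (auto simp: algebra_simps)
qed

lemma left_mult_diff_op:
  "field_embedding i \<Longrightarrow> P \<in> carrier (diff_op_ring i) \<Longrightarrow> (\<lambda>x. a * P x) \<in> carrier (diff_op_ring i)"
  using comp_diff_op[OF _ mult_op_diff_op, of i P a] by (simp add: comp_def)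

lemma sum_diff_op:
  assumes "field_embedding i" "\<And>t. t \<in> A \<Longrightarrow> P t \<in> carrier (diff_op_ring i)"
  shows "(\<lambda>x. \<Sum>t\<in>A. P t x) \<in> carrier (diff_op_ring i)"
  using assms(2)
  by (induction A rule: infinite_finite_induct) (auto intro: zero_diff_op add_diff_op assms(1))

lemma ring_diff_op_ring:
  assumes i: "field_embedding i"
  shows "ring (diff_op_ring i)"
proof (intro ringI abelian_groupI monoidI, unfold diff_op_ring_simps)
  fix P Q S assume *: "P \<in> carrier (diff_op_ring i)" "Q \<in> carrier (diff_op_ring i)" "S \<in> carrier (diff_op_ring i)"
  show "S \<circ> (\<lambda>x. P x + Q x) = (\<lambda>x. (S \<circ> P) x + (S \<circ> Q) x)"
    using diff_op_add_arg[OF i *(3)] by (auto simp: fun_eq_iff)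
next
  fix P assume P: "P \<in> carrier (diff_op_ring i)"
  have "(\<lambda>x. - 1 * P x) \<in> carrier (diff_op_ring i)" by (rule left_mult_diff_op[OF i P])
  then show "\<exists>Q\<in>carrier (diff_op_ring i). (\<lambda>x. Q x + P x) = (\<lambda>_. 0)"
    by (rule bexI[rotated]) simp
qed (auto intro: add_diff_op[OF i] zero_diff_op[OF i] id_diff_op[OF i] comp_diff_op[OF i] simp: add_ac fun_eq_iff)

section \<open>Differential operators and cyclic Galois extensions\<close>

text \<open>Transfers membership along an equation between values, so that an operator can be
  rewritten pointwise first.\<close>

lemma ext_mem: "(\<And>x. f x = g x) \<Longrightarrow> g \<in> S \<Longrightarrow> f \<in> S"
  by (drule ext) simp

locale cyclic_galois =
  fixes i :: "'k::field \<Rightarrow> 'a::field_char_0" and j :: "'a \<Rightarrow> 'b::field_char_0"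
    and \<sigma> :: "'b \<Rightarrow> 'b" and p :: nat
  assumes emb_i: "field_embedding i" and emb_j: "field_embedding j" and emb_\<sigma>: "field_embedding \<sigma>"
    and \<sigma>_j: "\<sigma> (j c) = j c" and p_pos: "0 < p" and \<sigma>_p: "(\<sigma> ^^ p) y = y"
    and \<sigma>_fixed: "\<sigma> y = y \<Longrightarrow> y \<in> range j"
    and \<sigma>_faithful: "\<lbrakk>0 < s; s < p\<rbrakk> \<Longrightarrow> \<exists>y. (\<sigma> ^^ s) y \<noteq> y"
begin

lemma emb_ji: "field_embedding (j \<circ> i)"
  using emb_i emb_j by (auto simp: field_embedding_def ring_hom_def ring_of_type_algebra_def)

lemma emb_pow: "field_embedding (\<sigma> ^^ r)"
  using emb_\<sigma> by (induction r) (auto simp: field_embedding_def ring_hom_def ring_of_type_algebra_def)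

lemma pow_j: "(\<sigma> ^^ r) (j c) = j c"
  by (induction r) (auto simp: \<sigma>_j)

lemmas j_simps = field_embeddingD[OF emb_j]
lemmas pow_simps = field_embeddingD[OF emb_pow]

lemma pow_inverse: "r \<le> p \<Longrightarrow> (\<sigma> ^^ r) ((\<sigma> ^^ (p - r)) y) = y"
  using \<sigma>_p by (simp flip: funpow_add comp_apply[of "\<sigma> ^^ r"])

lemma pow_inverse': "r \<le> p \<Longrightarrow> (\<sigma> ^^ (p - r)) ((\<sigma> ^^ r) y) = y"
  using \<sigma>_p by (simp flip: funpow_add comp_apply[of "\<sigma> ^^ (p - r)"])

text \<open>The function \<open>r \<mapsto> (\<sigma>\<^sup>r x - \<sigma>\<^sup>s x) / (x - \<sigma>\<^sup>s x)\<close> is \<open>1\<close> at \<open>0\<close> and vanishes at \<open>s\<close>; the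
  product of these functions over \<open>0 < s < p\<close> is the indicator function of \<open>0\<close>.\<close>

lemma dual_system_exists:
  "\<exists>xs. \<forall>r<p. (\<Sum>(a, b)\<leftarrow>xs. a * (\<sigma> ^^ r) b) = (if r = 0 then 1 else 0)"
proof -
  have "\<exists>xs. (\<Sum>(a, b)\<leftarrow>xs. a * b) = 1 \<and> (\<forall>r\<in>S. (\<Sum>(a, b)\<leftarrow>xs. a * (\<sigma> ^^ r) b) = 0)"
    if "finite S" "S \<subseteq> {0<..<p}" for S
    using that
  proof (induction S)
    case empty
    show ?case by (intro exI[of _ "[(1, 1)]"]) auto
  next
    case (insert s S)
    then obtain xs where xs: "(\<Sum>(a, b)\<leftarrow>xs. a * b) = 1"
      "\<And>r. r \<in> S \<Longrightarrow> (\<Sum>(a, b)\<leftarrow>xs. a * (\<sigma> ^^ r) b) = 0" by auto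
    obtain x where x: "(\<sigma> ^^ s) x \<noteq> x" using insert.prems \<sigma>_faithful by auto
    define d where "d = x - (\<sigma> ^^ s) x"
    \<comment> \<open>Read as elements of L \<otimes> L, \<open>ys\<close> is \<open>xs\<close>
      times (1 \<otimes> x - \<sigma>^s x \<otimes> 1) / d; this multiplies the sum at r by the new
      factor.\<close>
    define ys where "ys = map (\<lambda>(a, b). (a / d, b * x)) xs @ map (\<lambda>(a, b). (- a * (\<sigma> ^^ s) x / d, b)) xs"
    have ys: "(\<Sum>(a, b)\<leftarrow>ys. a * (\<sigma> ^^ r) b) =
        (\<Sum>(a, b)\<leftarrow>xs. a * (\<sigma> ^^ r) b) * (((\<sigma> ^^ r) x - (\<sigma> ^^ s) x) / d)" for r
    proof -
      have "(\<Sum>(a, b)\<leftarrow>map (\<lambda>(a, b). (a / d, b * x)) xs. a * (\<sigma> ^^ r) b) =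
          (\<Sum>(a, b)\<leftarrow>xs. a * (\<sigma> ^^ r) b) * ((\<sigma> ^^ r) x / d)"
        by (induction xs) (auto simp: pow_simps distrib_right add_divide_distrib mult.assoc)
      moreover have "(\<Sum>(a, b)\<leftarrow>map (\<lambda>(a, b). (- a * (\<sigma> ^^ s) x / d, b)) xs. a * (\<sigma> ^^ r) b) =
          - (\<Sum>(a, b)\<leftarrow>xs. a * (\<sigma> ^^ r) b) * ((\<sigma> ^^ s) x / d)"
        by (induction xs) (auto simp: distrib_right algebra_simps)
      ultimately show ?thesis
        by (simp add: ys_def diff_divide_distrib algebra_simps)
    qed
    have "d \<noteq> 0" using x by (simp add: d_def)
    then have "(\<Sum>(a, b)\<leftarrow>ys. a * b) = 1" using ys[of 0] xs(1) by (simp add: d_def)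
    moreover have "(\<Sum>(a, b)\<leftarrow>ys. a * (\<sigma> ^^ r) b) = 0" if "r \<in> insert s S" for r
      using that ys[of r] xs(2) by auto
    ultimately show ?case by blast
  qed
  from this[of "{0<..<p}"] obtain xs where "(\<Sum>(a, b)\<leftarrow>xs. a * b) = 1"
    "\<forall>r\<in>{0<..<p}. (\<Sum>(a, b)\<leftarrow>xs. a * (\<sigma> ^^ r) b) = 0" by auto
  then show ?thesis by (intro exI[of _ xs]) auto
qed

text \<open>The separability idempotent of L over K, as a list of pairs. The families
  \<open>\<alpha>\<close> and \<open>\<beta>\<close> read off from it generate L over K and are dual
  under the trace form, but need not be bases.\<close>

definition dual_system :: "('b \<times> 'b) list" where
  "dual_system = (SOME xs. \<forall>r<p. (\<Sum>(a, b)\<leftarrow>xs. a * (\<sigma> ^^ r) b) = (if r = 0 then 1 else 0))"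

definition "I = {..<length dual_system}"
definition "\<alpha> s = fst (dual_system ! s)"
definition "\<beta> s = snd (dual_system ! s)"

lemma finite_I [simp]: "finite I" by (simp add: I_def)

lemma dual: "r < p \<Longrightarrow> (\<Sum>s\<in>I. \<alpha> s * (\<sigma> ^^ r) (\<beta> s)) = (if r = 0 then 1 else 0)"
  using someI_ex[OF dual_system_exists, folded dual_system_def]
  by (simp add: sum_list_sum_nth I_def \<alpha>_def \<beta>_def case_prod_beta atLeast0LessThan)

text \<open>For r > 0 the sum is the image under \<sigma>^r of the sum in \<open>dual\<close> at p -
  r, so the two families may be interchanged.\<close>

lemma dual': "r < p \<Longrightarrow> (\<Sum>s\<in>I. \<beta> s * (\<sigma> ^^ r) (\<alpha> s)) = (if r = 0 then 1 else 0)"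
proof (cases "r = 0")
  case True
  then show ?thesis using dual[of 0] p_pos by (simp add: mult.commute)
next
  case False
  assume "r < p"
  have "(\<Sum>s\<in>I. \<beta> s * (\<sigma> ^^ r) (\<alpha> s)) = (\<Sum>s\<in>I. (\<sigma> ^^ r) (\<alpha> s * (\<sigma> ^^ (p - r)) (\<beta> s)))"
    using \<open>r < p\<close> by (simp add: pow_simps pow_inverse mult.commute)
  also have "\<dots> = (\<sigma> ^^ r) (\<Sum>s\<in>I. \<alpha> s * (\<sigma> ^^ (p - r)) (\<beta> s))"
    by (simp add: field_embedding_sum[OF emb_pow])
  also have "\<dots> = 0" using dual[of "p - r"] False \<open>r < p\<close> by (simp add: pow_simps)
  finally show ?thesis using False by simp
qed

section \<open>The trace and its dual families\<close>

definition tr :: "'b \<Rightarrow> 'a" where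
  "tr y = inv_into UNIV j (\<Sum>r<p. (\<sigma> ^^ r) y)"

lemma j_tr: "j (tr y) = (\<Sum>r<p. (\<sigma> ^^ r) y)"
proof -
  have "\<sigma> (\<Sum>r<p. (\<sigma> ^^ r) y) = (\<Sum>r<p. (\<sigma> ^^ Suc r) y)"
    by (simp add: field_embedding_sum[OF emb_\<sigma>])
  also have "\<dots> = (\<Sum>r<p. (\<sigma> ^^ r) y)"
    using sum.lessThan_Suc_shift[of "\<lambda>r. (\<sigma> ^^ r) y" p] sum.lessThan_Suc[of "\<lambda>r. (\<sigma> ^^ r) y" p]
    by (simp add: \<sigma>_p)
  finally have "(\<Sum>r<p. (\<sigma> ^^ r) y) \<in> range j" by (rule \<sigma>_fixed)
  then show ?thesis unfolding tr_def by (rule f_inv_into_f)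
qed

lemma tr_eqI: "j (tr x) = j y \<Longrightarrow> tr x = y"
  using j_simps(8) by (rule injD)

lemma tr_add: "tr (x + y) = tr x + tr y"
  by (rule tr_eqI) (simp add: j_tr j_simps pow_simps sum.distrib)

lemma tr_j_mult: "tr (j c * x) = c * tr x"
  by (rule tr_eqI) (simp add: j_tr j_simps pow_simps pow_j sum_distrib_left)

lemma tr_mult_j_mult: "tr (b * (j c * x)) = c * tr (b * x)"
  using tr_j_mult[of c "b * x"] by (simp add: mult.left_commute)

lemma tr_0: "tr 0 = 0"
  using tr_j_mult[of 0 0] by (simp add: j_simps)

lemma tr_sum: "tr (sum f A) = (\<Sum>x\<in>A. tr (f x))"
  by (induction A rule: infinite_finite_induct) (auto simp: tr_add tr_0)

lemma tr_1: "tr 1 = of_nat p"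
proof (rule tr_eqI)
  have "j (of_nat n) = of_nat n" for n by (induction n) (auto simp: j_simps)
  then show "j (tr 1) = j (of_nat p)" by (simp add: j_tr pow_simps)
qed

text \<open>With the trace written as a sum over the group, exchanging the sums leaves only the term
  r = 0, by \<open>dual\<close>.\<close>

lemma dual_expansion: "(\<Sum>s\<in>I. \<alpha> s * j (tr (\<beta> s * y))) = y"
proof -
  have "(\<Sum>s\<in>I. \<alpha> s * j (tr (\<beta> s * y))) = (\<Sum>s\<in>I. \<Sum>r<p. \<alpha> s * (\<sigma> ^^ r) (\<beta> s) * (\<sigma> ^^ r) y)"
    by (simp add: j_tr pow_simps sum_distrib_left mult.assoc)
  also have "\<dots> = (\<Sum>r<p. (\<Sum>s\<in>I. \<alpha> s * (\<sigma> ^^ r) (\<beta> s)) * (\<sigma> ^^ r) y)"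
    by (subst sum.swap) (simp add: sum_distrib_right)
  also have "\<dots> = (\<Sum>r<p. if r = 0 then y else 0)"
    by (rule sum.cong) (auto simp: dual)
  finally show ?thesis using p_pos by simp
qed

lemma dual_expansion': "(\<Sum>s\<in>I. \<beta> s * j (tr (\<alpha> s * y))) = y"
proof -
  have "(\<Sum>s\<in>I. \<beta> s * j (tr (\<alpha> s * y))) = (\<Sum>s\<in>I. \<Sum>r<p. \<beta> s * (\<sigma> ^^ r) (\<alpha> s) * (\<sigma> ^^ r) y)"
    by (simp add: j_tr pow_simps sum_distrib_left mult.assoc)
  also have "\<dots> = (\<Sum>r<p. (\<Sum>s\<in>I. \<beta> s * (\<sigma> ^^ r) (\<alpha> s)) * (\<sigma> ^^ r) y)"
    by (subst sum.swap) (simp add: sum_distrib_right)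
  also have "\<dots> = (\<Sum>r<p. if r = 0 then y else 0)"
    by (rule sum.cong) (auto simp: dual')
  finally show ?thesis using p_pos by simp
qed

lemma sum_\<alpha>_\<beta>: "(\<Sum>s\<in>I. \<alpha> s * \<beta> s) = 1"
  using dual[of 0] p_pos by simp

section \<open>Averaging operators relative to K\<close>

text \<open>The separability idempotent acting on operators, \<open>\<alpha>\<close> from the left
  and \<open>\<beta>\<close> from the right. A K-linear P is made L-linear; for higher order
  relative to K the mean must be iterated.\<close>

definition separable_mean :: "('b \<Rightarrow> 'b) \<Rightarrow> 'b \<Rightarrow> 'b" where
  "separable_mean P x = (\<Sum>s\<in>I. \<alpha> s * P (\<beta> s * x))"

abbreviation "base_ops n \<equiv> rel_ops j j n"
abbreviation "ops n \<equiv> rel_ops (id :: 'b \<Rightarrow> 'b) id n"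

lemma separable_mean_diff:
  "separable_mean (\<lambda>y. P y - Q y) x = separable_mean P x - separable_mean Q x"
  by (simp add: separable_mean_def right_diff_distrib sum_subtractf)

lemma separable_mean_pow_Suc:
  "(separable_mean ^^ Suc m) P x = (\<Sum>s\<in>I. \<alpha> s * (separable_mean ^^ m) P (\<beta> s * x))"
  by (simp add: separable_mean_def)

lemma separable_mean_base_ops: "P \<in> base_ops n \<Longrightarrow> separable_mean P \<in> base_ops n"
  unfolding separable_mean_def by (intro rel_ops_sum rel_ops_left_mult rel_ops_right_mult)

text \<open>In \<open>L \<otimes>\<^sub>K L\<close> one has \<open>\<Sum>\<^sub>s (\<alpha>\<^sub>s \<otimes> c\<beta>\<^sub>s - c\<alpha>\<^sub>s \<otimes> \<beta>\<^sub>s) = 0\<close>, whence the loss of one order over \<open>K\<close>.\<close>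

lemma separable_mean_comm:
  assumes P: "P \<in> base_ops (Suc n)"
  shows "separable_mean (\<lambda>x. P (c * x) - c * P x) \<in> base_ops n"
proof -
  \<comment> \<open>By duality one and the same matrix over K describes multiplication by c on the
    family \<open>\<beta>\<close> and, transposed, on the family \<open>\<alpha>\<close>.\<close>
  define C where "C t s = tr (\<alpha> s * (c * \<beta> t))" for t s
  have C1: "c * \<beta> t = (\<Sum>s\<in>I. j (C t s) * \<beta> s)" for t
    using dual_expansion'[of "c * \<beta> t"] by (simp add: C_def mult.commute)
  have C2: "\<alpha> s * c = (\<Sum>t\<in>I. \<alpha> t * j (C t s))" for s
    using dual_expansion[of "\<alpha> s * c"] by (simp add: C_def mult_ac)
  have "separable_mean (\<lambda>x. P (c * x) - c * P x) x =
      (\<Sum>t\<in>I. \<Sum>s\<in>I. \<alpha> t * (P (j (C t s) * (\<beta> s * x)) - j (C t s) * P (\<beta> s * x)))" for x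
  proof -
    have "separable_mean (\<lambda>x. P (c * x) - c * P x) x =
        (\<Sum>t\<in>I. \<alpha> t * P ((c * \<beta> t) * x)) - (\<Sum>s\<in>I. (\<alpha> s * c) * P (\<beta> s * x))"
      by (simp add: separable_mean_def right_diff_distrib sum_subtractf mult.assoc)
    also have "(\<Sum>t\<in>I. \<alpha> t * P ((c * \<beta> t) * x)) = (\<Sum>t\<in>I. \<Sum>s\<in>I. \<alpha> t * P (j (C t s) * (\<beta> s * x)))"
      unfolding C1 by (simp add: sum_distrib_right rel_ops_sum_arg[OF P] sum_distrib_left mult.assoc)
    also have "(\<Sum>s\<in>I. (\<alpha> s * c) * P (\<beta> s * x)) = (\<Sum>t\<in>I. \<Sum>s\<in>I. \<alpha> t * (j (C t s) * P (\<beta> s * x)))"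
      unfolding C2 by (subst sum.swap) (simp add: sum_distrib_right mult.assoc)
    finally show ?thesis by (simp add: right_diff_distrib sum_subtractf)
  qed
  moreover have "(\<lambda>x. \<Sum>t\<in>I. \<Sum>s\<in>I. \<alpha> t * (P (j (C t s) * (\<beta> s * x)) - j (C t s) * P (\<beta> s * x))) \<in> base_ops n"
    by (intro rel_ops_sum rel_ops_left_mult rel_ops_right_mult[OF rel_ops_comm[OF P]])
  ultimately show ?thesis by (rule ext_mem)
qed

text \<open>Taking means commutes with taking commutators with c. One of the n + 1 means lowers the
  order of [P, c] relative to K by one, and the induction hypothesis uses up the others.\<close>

lemma separable_mean_pow_ops:
  "P \<in> base_ops n \<Longrightarrow> (separable_mean ^^ n) P \<in> ops n"
proof (induction n arbitrary: P)
  case (Suc n)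
  have pow: "(separable_mean ^^ m) P \<in> base_ops (Suc n)" for m
    using Suc.prems by (induction m) (auto intro: separable_mean_base_ops)
  have comm: "(separable_mean ^^ m) (\<lambda>x. P (c * x) - c * P x) =
      (\<lambda>x. (separable_mean ^^ m) P (c * x) - c * (separable_mean ^^ m) P x)" for m c
    by (induction m) (auto simp: separable_mean_def fun_eq_iff sum_distrib_left right_diff_distrib sum_subtractf mult_ac)
  show ?case
  proof (rule rel_ops_SucI)
    fix c
    have "(separable_mean ^^ n) (separable_mean (\<lambda>x. P (c * x) - c * P x)) \<in> ops n"
      by (intro Suc.IH separable_mean_comm Suc.prems)
    then show "(\<lambda>x. (separable_mean ^^ Suc n) P (id c * x) - id c * (separable_mean ^^ Suc n) P x) \<in> ops n"
      unfolding id_apply comm[symmetric, of "Suc n"] by (simp only: funpow_Suc_right comp_apply)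
  qed (rule rel_ops_add_arg[OF pow])
qed auto

text \<open>P applied to the coefficients in x = \<Sum> \<alpha> t tr (\<beta> t x). This depends on
  the chosen families and is only a first approximation to an operator on L.\<close>

definition base_ext :: "('a \<Rightarrow> 'a) \<Rightarrow> 'b \<Rightarrow> 'b" where
  "base_ext P x = (\<Sum>t\<in>I. \<alpha> t * j (P (tr (\<beta> t * x))))"

lemma rel_ops_j: "P \<in> rel_ops u id n \<Longrightarrow> (\<lambda>x. j (P x)) \<in> rel_ops u j n"
  by (rule rel_ops_post[where v = id]) (auto simp: j_simps)

lemma rel_ops_tr: "P \<in> rel_ops u j n \<Longrightarrow> (\<lambda>x. tr (P x)) \<in> rel_ops u id n"
  by (rule rel_ops_post[where v = j]) (auto simp: tr_add tr_j_mult)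

lemma rel_ops_pre_tr: "P \<in> rel_ops id v n \<Longrightarrow> (\<lambda>x. P (tr (b * x))) \<in> rel_ops j v n"
  by (rule rel_ops_pre[where u = id]) (auto simp: distrib_left tr_add tr_mult_j_mult)

lemma rel_ops_pre_j: "P \<in> rel_ops j v n \<Longrightarrow> (\<lambda>x. P (j x)) \<in> rel_ops id v n"
  by (rule rel_ops_pre[where u = j]) (auto simp: j_simps)

lemma base_ext_base_ops: "P \<in> rel_ops id id n \<Longrightarrow> base_ext P \<in> base_ops n"
  unfolding base_ext_def by (intro rel_ops_sum rel_ops_left_mult rel_ops_j rel_ops_pre_tr)

text \<open>The traces of \<beta> t \<beta> s x are expanded again, with coefficients
  \<open>C t s r\<close> in K. If P commuted with these, the mean would collapse to
  \<open>base_ext P\<close>, by \<open>sum_\<alpha>_\<beta>\<close>. So the difference consists of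
  commutators of P with elements of K, of lower order.\<close>

lemma separable_mean_base_ext:
  assumes P: "P \<in> rel_ops id id (Suc n)"
  shows "(\<lambda>x. separable_mean (base_ext P) x - base_ext P x) \<in> base_ops n"
proof -
  define C where "C t s r = tr (\<beta> t * (\<beta> s * \<alpha> r))" for t s r
  have C1: "tr (\<beta> t * (\<beta> s * x)) = (\<Sum>r\<in>I. C t s r * tr (\<beta> r * x))" for t s x
  proof -
    have "tr (\<beta> t * (\<beta> s * x)) = tr (\<Sum>r\<in>I. j (tr (\<beta> r * x)) * (\<beta> t * (\<beta> s * \<alpha> r)))"
      by (subst (1) dual_expansion[of x, symmetric]) (simp add: sum_distrib_left mult_ac)
    then show ?thesis by (simp add: tr_sum tr_j_mult C_def mult.commute)
  qed
  have C2: "(\<Sum>t\<in>I. \<alpha> t * j (C t s r)) = \<beta> s * \<alpha> r" for s r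
    unfolding C_def by (rule dual_expansion)
  have "separable_mean (base_ext P) x - base_ext P x =
    (\<Sum>s\<in>I. \<Sum>r\<in>I. \<Sum>t\<in>I. \<alpha> s * (\<alpha> t * j (P (C t s r * tr (\<beta> r * x)) - C t s r * P (tr (\<beta> r * x)))))" for x
  proof -
    have "separable_mean (base_ext P) x =
        (\<Sum>s\<in>I. \<Sum>t\<in>I. \<Sum>r\<in>I. \<alpha> s * (\<alpha> t * j (P (C t s r * tr (\<beta> r * x)))))"
      by (simp add: separable_mean_def base_ext_def C1 rel_ops_sum_arg[OF P] field_embedding_sum[OF emb_j] sum_distrib_left)
    also have "\<dots> = (\<Sum>s\<in>I. \<Sum>r\<in>I. \<Sum>t\<in>I. \<alpha> s * (\<alpha> t * j (P (C t s r * tr (\<beta> r * x)))))"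
      by (rule sum.cong[OF refl]) (rule sum.swap)
    finally have mean: "separable_mean (base_ext P) x =
        (\<Sum>s\<in>I. \<Sum>r\<in>I. \<Sum>t\<in>I. \<alpha> s * (\<alpha> t * j (P (C t s r * tr (\<beta> r * x)))))" .
    have "base_ext P x = (\<Sum>r\<in>I. (\<Sum>s\<in>I. \<alpha> s * \<beta> s) * (\<alpha> r * j (P (tr (\<beta> r * x)))))"
      by (simp add: sum_\<alpha>_\<beta> base_ext_def)
    also have "\<dots> = (\<Sum>s\<in>I. \<Sum>r\<in>I. \<alpha> s * ((\<beta> s * \<alpha> r) * j (P (tr (\<beta> r * x)))))"
      by (subst sum.swap) (simp only: sum_distrib_right mult.assoc)
    also have "\<dots> = (\<Sum>s\<in>I. \<Sum>r\<in>I. \<Sum>t\<in>I. \<alpha> s * (\<alpha> t * j (C t s r * P (tr (\<beta> r * x)))))"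
      unfolding C2[symmetric] by (simp add: sum_distrib_right sum_distrib_left j_simps mult_ac)
    finally show ?thesis using mean by (simp add: j_simps right_diff_distrib sum_subtractf)
  qed
  moreover have "(\<lambda>x. \<Sum>s\<in>I. \<Sum>r\<in>I. \<Sum>t\<in>I. \<alpha> s * (\<alpha> t * j (P (C t s r * tr (\<beta> r * x)) - C t s r * P (tr (\<beta> r * x))))) \<in> base_ops n"
  proof (intro rel_ops_sum rel_ops_left_mult rel_ops_j rel_ops_pre_tr[where P = "\<lambda>y. P (c * y) - c * P y" for c])
    show "(\<lambda>y. P (c * y) - c * P y) \<in> rel_ops id id n" for c using rel_ops_comm[OF P, of c] by simp
  qed
  ultimately show ?thesis by (rule ext_mem)
qed

lemma separable_mean_pow_base_ext:
  assumes P: "P \<in> rel_ops id id (Suc n)"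
  shows "(\<lambda>x. (separable_mean ^^ m) (base_ext P) x - base_ext P x) \<in> base_ops n"
proof (induction m)
  case 0
  show ?case by (simp add: rel_ops_zero)
next
  case (Suc m)
  have "(\<lambda>x. separable_mean (\<lambda>y. (separable_mean ^^ m) (base_ext P) y - base_ext P y) x
      + (separable_mean (base_ext P) x - base_ext P x)) \<in> base_ops n"
    by (intro rel_ops_add separable_mean_base_ops Suc separable_mean_base_ext P)
  then show ?case by (simp add: separable_mean_diff)
qed

text \<open>For y in K the trace of \<beta> t y is tr (\<beta> t) y, and \<Sum> \<alpha> t tr
  (\<beta> t) = 1. So the error consists of commutators of P with the elements tr (\<beta>
  t).\<close>

lemma base_ext_j:
  assumes P: "P \<in> rel_ops id id (Suc n)"
  shows "(\<lambda>y. base_ext P (j y) - j (P y)) \<in> rel_ops id j n"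
proof -
  have "base_ext P (j y) - j (P y) =
      (\<Sum>t\<in>I. \<alpha> t * j (P (tr (\<beta> t) * y) - tr (\<beta> t) * P y))" for y
  proof -
    have "j (P y) = (\<Sum>t\<in>I. \<alpha> t * j (tr (\<beta> t * 1))) * j (P y)" unfolding dual_expansion by simp
    moreover have "tr (\<beta> t * j y) = tr (\<beta> t) * y" for t
      using tr_j_mult[of y "\<beta> t"] by (simp add: mult.commute)
    ultimately show ?thesis
      by (simp add: base_ext_def j_simps right_diff_distrib sum_subtractf sum_distrib_left sum_distrib_right mult_ac)
  qed
  moreover have "(\<lambda>y. \<Sum>t\<in>I. \<alpha> t * j (P (tr (\<beta> t) * y) - tr (\<beta> t) * P y)) \<in> rel_ops id j n"
  proof (intro rel_ops_sum rel_ops_left_mult rel_ops_j)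
    show "(\<lambda>y. P (c * y) - c * P y) \<in> rel_ops id id n" for c using rel_ops_comm[OF P, of c] by simp
  qed
  ultimately show ?thesis by (rule ext_mem)
qed

text \<open>A power of \<open>separable_mean\<close> turns the coefficientwise extension of \<open>P\<close> into a differential operator on
  \<open>L\<close> that agrees with \<open>P\<close> on \<open>K\<close> up to an operator of lower order.\<close>

lemma rel_ops_extend:
  assumes "P \<in> rel_ops id id n" "\<And>l y. P (i l * y) = i l * P y"
  shows "\<exists>R\<in>ops n. (\<forall>l x. R (j (i l) * x) = j (i l) * R x) \<and> (\<forall>y. R (j y) = j (P y))"
  using assms
proof (induction n arbitrary: P)
  case 0
  then show ?case by (auto simp: j_simps)
next
  case (Suc n)
  define R0 where "R0 = (separable_mean ^^ Suc n) (base_ext P)"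
  have R0: "R0 \<in> ops (Suc n)"
    unfolding R0_def by (intro separable_mean_pow_ops base_ext_base_ops Suc.prems)
  have lin_P0: "base_ext P (j (i l) * x) = j (i l) * base_ext P x" for l x
    by (simp only: base_ext_def tr_mult_j_mult Suc.prems(2) j_simps(2)) (simp add: sum_distrib_left mult.left_commute)
  have lin_R0: "(separable_mean ^^ m) (base_ext P) (j (i l) * x) = j (i l) * (separable_mean ^^ m) (base_ext P) x" for m l x
  proof (induction m arbitrary: x)
    case (Suc m)
    have "(separable_mean ^^ m) (base_ext P) (\<beta> s * (j (i l) * x)) = j (i l) * (separable_mean ^^ m) (base_ext P) (\<beta> s * x)" for s
      using Suc[of "\<beta> s * x"] by (simp add: mult_ac)
    then show ?case by (simp add: separable_mean_pow_Suc sum_distrib_left mult.left_commute del: funpow.simps)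
  qed (simp add: lin_P0)
  define Z where "Z y = R0 (j y) - j (P y)" for y
  have "(\<lambda>y. (R0 (j y) - base_ext P (j y)) + (base_ext P (j y) - j (P y))) \<in> rel_ops id j n"
    unfolding R0_def
    by (intro rel_ops_add base_ext_j Suc.prems(1)
        rel_ops_pre_j[OF separable_mean_pow_base_ext[OF Suc.prems(1)]])
  then have Z: "Z \<in> rel_ops id j n" by (simp add: Z_def[abs_def])
  have lin_Z: "Z (i l * y) = j (i l) * Z y" for l y
    using lin_R0[of "Suc n"] by (simp add: Z_def R0_def j_simps Suc.prems(2) right_diff_distrib del: funpow.simps)
  \<comment> \<open>The defect \<open>Z\<close> has lower order but values in L. Its components tr
    (\<beta> t Z) map K to K and extend by the induction hypothesis; \<open>dual_expansion\<close>
    reassembles \<open>Z\<close> from them.\<close>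
  have "\<exists>R\<in>ops n. (\<forall>l x. R (j (i l) * x) = j (i l) * R x) \<and> (\<forall>y. R (j y) = j (tr (\<beta> t * Z y)))" for t
  proof (rule Suc.IH)
    show "(\<lambda>y. tr (\<beta> t * Z y)) \<in> rel_ops id id n"
      by (intro rel_ops_tr rel_ops_left_mult Z)
    show "tr (\<beta> t * Z (i l * y)) = i l * tr (\<beta> t * Z y)" for l y
      by (simp add: lin_Z tr_mult_j_mult)
  qed
  then obtain S where S: "\<And>t. S t \<in> ops n" "\<And>t l x. S t (j (i l) * x) = j (i l) * S t x"
    "\<And>t y. S t (j y) = j (tr (\<beta> t * Z y))" by metis
  define R where "R x = R0 x - (\<Sum>t\<in>I. \<alpha> t * S t x)" for x
  have "R \<in> ops (Suc n)"
    unfolding R_def by (intro rel_ops_diff R0 rel_ops_sum rel_ops_left_mult rel_ops_Suc S)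
  moreover have "R (j (i l) * x) = j (i l) * R x" for l x
    using lin_R0[of "Suc n"] by (simp add: R_def R0_def S right_diff_distrib sum_distrib_left mult.left_commute del: funpow.simps)
  moreover have "R (j y) = j (P y)" for y
    by (simp add: R_def S dual_expansion) (simp add: Z_def)
  ultimately show ?case by blast
qed

section \<open>Extension, conjugation and expansion of differential operators\<close>

abbreviation "DK \<equiv> diff_op_ring i"
abbreviation "DL \<equiv> diff_op_ring (j \<circ> i)"

lemma diff_op_extend:
  assumes "P \<in> carrier DK"
  obtains R where "R \<in> carrier DL" "R \<circ> j = j \<circ> P"
  using assms rel_ops_extend unfolding carrier_diff_op_ring[OF emb_i] carrier_diff_op_ring[OF emb_ji]
  by (fastforce simp: fun_eq_iff)

text \<open>Restricting Q l to K gives an operator relative to K with values in L, and composing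
  with the K-linear trace of a multiple does not raise its order. With b = \<beta> t these are the
  coefficients of Q l with respect to the \<alpha> t.\<close>

lemma tr_diff_op:
  assumes Q: "Q \<in> carrier DL"
  shows "(\<lambda>y. tr (b * Q (l * j y))) \<in> carrier DK"
proof -
  obtain n where n: "Q \<in> ops n" and lin: "\<And>l x. Q (j (i l) * x) = j (i l) * Q x"
    using Q unfolding carrier_diff_op_ring[OF emb_ji] by auto
  have "Q \<in> base_ops n" using rel_ops_base_change[OF n, of j] by simp
  then have "(\<lambda>y. tr (b * Q (l * j y))) \<in> rel_ops id id n"
    by (intro rel_ops_tr rel_ops_left_mult rel_ops_pre_j[where P = "\<lambda>x. Q (l * x)"] rel_ops_right_mult)
  moreover have "tr (b * Q (l * j (i c * y))) = i c * tr (b * Q (l * j y))" for c y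
    using lin[of c "l * j y"] tr_j_mult[of "i c" "b * Q (l * j y)"]
    by (simp add: j_simps mult_ac)
  ultimately show ?thesis unfolding carrier_diff_op_ring[OF emb_i] by blast
qed

lemma conj_diff_op:
  assumes Q: "Q \<in> carrier DL" and "r \<le> p"
  shows "(\<lambda>x. (\<sigma> ^^ r) (Q ((\<sigma> ^^ (p - r)) x))) \<in> carrier DL"
proof -
  obtain n where n: "Q \<in> ops n" and lin: "\<And>l x. Q (j (i l) * x) = j (i l) * Q x"
    using Q unfolding carrier_diff_op_ring[OF emb_ji] by auto
  have "(\<lambda>x. (\<sigma> ^^ r) (Q ((\<sigma> ^^ (p - r)) x))) \<in> ops n"
    by (rule rel_ops_conj) (auto simp: pow_simps pow_inverse assms n)
  then show ?thesis unfolding carrier_diff_op_ring[OF emb_ji] by (auto simp: pow_simps pow_j lin)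
qed

text \<open>\<open>R t\<close> is the sum of the Galois conjugates of the operator \<beta> t Q l.
  The group fixes K, so on K this sum is the trace; in \<Sum> \<alpha> t R t all conjugates but the
  one for r = 0 cancel, by \<open>dual\<close>.\<close>

lemma diff_op_expansion:
  assumes Q: "Q \<in> carrier DL"
  obtains R where "\<And>t. R t \<in> carrier DL" "\<And>t. R t \<circ> j = j \<circ> (\<lambda>y. tr (\<beta> t * Q (l * j y)))"
    "\<And>y. Q (l * y) = (\<Sum>t\<in>I. \<alpha> t * R t y)"
proof -
  define Q' where "Q' t x = \<beta> t * Q (l * x)" for t x
  define R where "R t x = (\<Sum>r<p. (\<sigma> ^^ r) (Q' t ((\<sigma> ^^ (p - r)) x)))" for t x
  have Q': "Q' t \<in> carrier DL" for t
    unfolding Q'_def using left_mult_diff_op[OF emb_ji comp_diff_op[OF emb_ji Q mult_op_diff_op[OF emb_ji]]]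
    by (simp add: comp_def)
  show thesis
  proof
    show "R t \<in> carrier DL" for t
      unfolding R_def by (intro sum_diff_op emb_ji conj_diff_op Q') auto
    show "R t \<circ> j = j \<circ> (\<lambda>y. tr (\<beta> t * Q (l * j y)))" for t
      by (auto simp: R_def j_tr pow_j Q'_def fun_eq_iff)
    show "Q (l * y) = (\<Sum>t\<in>I. \<alpha> t * R t y)" for y
    proof -
      have "(\<Sum>t\<in>I. \<alpha> t * R t y) =
          (\<Sum>t\<in>I. \<Sum>r<p. \<alpha> t * (\<sigma> ^^ r) (\<beta> t) * (\<sigma> ^^ r) (Q (l * (\<sigma> ^^ (p - r)) y)))"
        by (simp add: R_def Q'_def pow_simps sum_distrib_left mult.assoc)
      also have "\<dots> = (\<Sum>r<p. (\<Sum>t\<in>I. \<alpha> t * (\<sigma> ^^ r) (\<beta> t)) * (\<sigma> ^^ r) (Q (l * (\<sigma> ^^ (p - r)) y)))"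
        by (subst sum.swap) (simp add: sum_distrib_right)
      also have "\<dots> = (\<Sum>r<p. if r = 0 then Q (l * y) else 0)"
        by (rule sum.cong) (auto simp: dual \<sigma>_p)
      finally show ?thesis using p_pos by simp
    qed
  qed
qed

end

section \<open>The tensor product\<close>

lemma (in abelian_monoid) finsum_swap:
  assumes "finite A" "finite B" "\<And>a b. a \<in> A \<Longrightarrow> b \<in> B \<Longrightarrow> f a b \<in> carrier G"
  shows "(\<Oplus>a\<in>A. \<Oplus>b\<in>B. f a b) = (\<Oplus>b\<in>B. \<Oplus>a\<in>A. f a b)"
  using assms(1,3)
proof (induction A)
  case empty
  then show ?case by (simp add: finsum_zero)
next
  case (insert a A)
  have "(\<Oplus>b\<in>B. \<Oplus>a\<in>insert a A. f a b) = (\<Oplus>b\<in>B. f a b \<oplus> (\<Oplus>a\<in>A. f a b))"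
    by (rule finsum_cong') (use insert in \<open>auto intro!: finsum_closed a_closed finsum_insert\<close>)
  also have "\<dots> = (\<Oplus>b\<in>B. f a b) \<oplus> (\<Oplus>b\<in>B. \<Oplus>a\<in>A. f a b)"
    by (rule finsum_addf) (use insert in \<open>auto intro!: finsum_closed\<close>)
  finally show ?case using insert by (subst finsum_insert) (auto intro!: finsum_closed)
qed

lemma (in abelian_monoid) finsum_Times:
  assumes "finite A" "finite B" "\<And>a b. a \<in> A \<Longrightarrow> b \<in> B \<Longrightarrow> f (a, b) \<in> carrier G"
  shows "(\<Oplus>z\<in>A \<times> B. f z) = (\<Oplus>a\<in>A. \<Oplus>b\<in>B. f (a, b))"
  using assms(1,3)
proof (induction A)
  case empty
  then show ?case by simp
next
  case (insert a A)
  have "insert a A \<times> B = (Pair a ` B) \<union> (A \<times> B)" by auto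
  then have "(\<Oplus>z\<in>insert a A \<times> B. f z) = (\<Oplus>z\<in>Pair a ` B. f z) \<oplus> (\<Oplus>z\<in>A \<times> B. f z)"
    using insert assms(2) by (simp only:) (rule finsum_Un_disjoint, auto)
  also have "(\<Oplus>z\<in>Pair a ` B. f z) = (\<Oplus>b\<in>B. f (a, b))"
    by (rule finsum_reindex) (use insert in \<open>auto intro: inj_onI\<close>)
  finally show ?case using insert by (subst finsum_insert) (auto intro!: finsum_closed)
qed

text \<open>No scalar ring is mentioned, so that linear maps, the semilinear \<open>sig\<close> and
  maps between modules over different rings are treated alike.\<close>

definition add_hom :: "('a, 'c) ring_scheme \<Rightarrow> ('b, 'd) ring_scheme \<Rightarrow> ('a \<Rightarrow> 'b) \<Rightarrow> bool" where
  "add_hom M N f \<longleftrightarrow> f \<in> carrier M \<rightarrow> carrier N \<and>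
     (\<forall>x\<in>carrier M. \<forall>y\<in>carrier M. f (x \<oplus>\<^bsub>M\<^esub> y) = f x \<oplus>\<^bsub>N\<^esub> f y)"

lemma add_homI:
  "(\<And>x. x \<in> carrier M \<Longrightarrow> f x \<in> carrier N) \<Longrightarrow>
    (\<And>x y. x \<in> carrier M \<Longrightarrow> y \<in> carrier M \<Longrightarrow> f (x \<oplus>\<^bsub>M\<^esub> y) = f x \<oplus>\<^bsub>N\<^esub> f y) \<Longrightarrow> add_hom M N f"
  by (auto simp: add_hom_def)

lemma add_hom_closed: "add_hom M N f \<Longrightarrow> x \<in> carrier M \<Longrightarrow> f x \<in> carrier N"
  by (auto simp: add_hom_def)

lemma add_hom_add:
  "add_hom M N f \<Longrightarrow> x \<in> carrier M \<Longrightarrow> y \<in> carrier M \<Longrightarrow> f (x \<oplus>\<^bsub>M\<^esub> y) = f x \<oplus>\<^bsub>N\<^esub> f y"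
  by (auto simp: add_hom_def)

lemma add_hom_zero:
  assumes "abelian_group M" "abelian_group N" "add_hom M N f"
  shows "f \<zero>\<^bsub>M\<^esub> = \<zero>\<^bsub>N\<^esub>"
proof -
  interpret M: abelian_group M by fact
  interpret N: abelian_group N by fact
  have c: "f \<zero>\<^bsub>M\<^esub> \<in> carrier N" by (rule add_hom_closed[OF assms(3)]) simp
  have "f \<zero>\<^bsub>M\<^esub> \<oplus>\<^bsub>N\<^esub> f \<zero>\<^bsub>M\<^esub> = f \<zero>\<^bsub>M\<^esub> \<oplus>\<^bsub>N\<^esub> \<zero>\<^bsub>N\<^esub>"
    using add_hom_add[OF assms(3), of "\<zero>\<^bsub>M\<^esub>" "\<zero>\<^bsub>M\<^esub>"] c by simp
  then show ?thesis using c N.add.l_cancel N.zero_closed by blast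
qed

lemma add_hom_finsum:
  assumes "abelian_group M" "abelian_group N" "add_hom M N f" "finite A" "\<And>a. a \<in> A \<Longrightarrow> g a \<in> carrier M"
  shows "f (\<Oplus>\<^bsub>M\<^esub>a\<in>A. g a) = (\<Oplus>\<^bsub>N\<^esub>a\<in>A. f (g a))"
proof -
  interpret M: abelian_group M by fact
  interpret N: abelian_group N by fact
  show ?thesis
    using assms(4,5)
  proof (induction A)
    case empty
    show ?case by (simp add: add_hom_zero[OF assms(1-3)])
  next
    case (insert a A)
    have "f (\<Oplus>\<^bsub>M\<^esub>a\<in>insert a A. g a) = f (g a \<oplus>\<^bsub>M\<^esub> (\<Oplus>\<^bsub>M\<^esub>a\<in>A. g a))"
      using insert by (subst M.finsum_insert) auto
    also have "\<dots> = f (g a) \<oplus>\<^bsub>N\<^esub> f (\<Oplus>\<^bsub>M\<^esub>a\<in>A. g a)"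
      using insert by (intro add_hom_add[OF assms(3)] M.finsum_closed) auto
    also have "\<dots> = (\<Oplus>\<^bsub>N\<^esub>a\<in>insert a A. f (g a))"
      using insert by (subst N.finsum_insert) (auto intro!: add_hom_closed[OF assms(3)])
    finally show ?case .
  qed
qed

lemma add_hom_comp: "add_hom M N f \<Longrightarrow> add_hom N S g \<Longrightarrow> add_hom M S (\<lambda>x. g (f x))"
  by (auto simp: add_hom_def Pi_iff)

lemma add_hom_finsum_fun:
  assumes "abelian_group N" "finite A" "\<And>a. a \<in> A \<Longrightarrow> add_hom M N (f a)"
  shows "add_hom M N (\<lambda>x. \<Oplus>\<^bsub>N\<^esub>a\<in>A. f a x)"
proof -
  interpret N: abelian_group N by fact
  have cl: "f a x \<in> carrier N" if "a \<in> A" "x \<in> carrier M" for a x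
    using add_hom_closed[OF assms(3)[OF that(1)] that(2)] .
  show ?thesis
  proof (rule add_homI)
    show "(\<Oplus>\<^bsub>N\<^esub>a\<in>A. f a x) \<in> carrier N" if "x \<in> carrier M" for x
      using that cl by (auto intro!: N.finsum_closed)
    fix x y assume xy: "x \<in> carrier M" "y \<in> carrier M"
    have "(\<Oplus>\<^bsub>N\<^esub>a\<in>A. f a (x \<oplus>\<^bsub>M\<^esub> y)) = (\<Oplus>\<^bsub>N\<^esub>a\<in>A. f a x \<oplus>\<^bsub>N\<^esub> f a y)"
      by (rule N.finsum_cong') (use xy cl add_hom_add[OF assms(3)] in auto)
    also have "\<dots> = (\<Oplus>\<^bsub>N\<^esub>a\<in>A. f a x) \<oplus>\<^bsub>N\<^esub> (\<Oplus>\<^bsub>N\<^esub>a\<in>A. f a y)"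
      by (rule N.finsum_addf) (use xy cl in auto)
    finally show "(\<Oplus>\<^bsub>N\<^esub>a\<in>A. f a (x \<oplus>\<^bsub>M\<^esub> y)) = (\<Oplus>\<^bsub>N\<^esub>a\<in>A. f a x) \<oplus>\<^bsub>N\<^esub> (\<Oplus>\<^bsub>N\<^esub>a\<in>A. f a y)" .
  qed
qed

locale galois_module = cyclic_galois i j \<sigma> p
  for i :: "'k::field \<Rightarrow> 'a::field_char_0" and j :: "'a \<Rightarrow> 'b::field_char_0" and \<sigma> p +
  fixes N :: "('a \<Rightarrow> 'a, 'n) module" (structure)
  assumes N_module: "left_module (diff_op_ring i) N"
begin

lemma N_abelian: "abelian_group N"
  using N_module by (simp add: left_module_def)

sublocale N: abelian_group N by (rule N_abelian)

lemma N_smult: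
  "P \<in> carrier DK \<Longrightarrow> x \<in> carrier N \<Longrightarrow> P \<odot> x \<in> carrier N"
  "P \<in> carrier DK \<Longrightarrow> Q \<in> carrier DK \<Longrightarrow> x \<in> carrier N \<Longrightarrow>
    (\<lambda>y. P y + Q y) \<odot> x = P \<odot> x \<oplus> Q \<odot> x"
  "P \<in> carrier DK \<Longrightarrow> x \<in> carrier N \<Longrightarrow> y \<in> carrier N \<Longrightarrow>
    P \<odot> (x \<oplus> y) = P \<odot> x \<oplus> P \<odot> y"
  "P \<in> carrier DK \<Longrightarrow> Q \<in> carrier DK \<Longrightarrow> x \<in> carrier N \<Longrightarrow> (\<lambda>y. P (Q y)) \<odot> x = P \<odot> (Q \<odot> x)"
  "x \<in> carrier N \<Longrightarrow> (\<lambda>y. y) \<odot> x = x"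
  using left_module.smult_closed[OF N_module] left_module.smult_l_distr[OF N_module]
    left_module.smult_r_distr[OF N_module] left_module.smult_assoc[OF N_module] left_module.smult_one[OF N_module]
  by (simp_all add: diff_op_ring_simps comp_def id_def)

lemma mult_op_DK [simp]: "mult_op c \<in> carrier DK"
  by (rule mult_op_diff_op[OF emb_i])

lemma N_add_hom: "P \<in> carrier DK \<Longrightarrow> add_hom N N (\<lambda>x. P \<odot> x)"
  by (rule add_homI) (auto simp: N_smult)

lemma N_smult_zero: "x \<in> carrier N \<Longrightarrow> (\<lambda>_. 0) \<odot> x = \<zero>"
  using N_smult(2)[OF zero_diff_op[OF emb_i] zero_diff_op[OF emb_i], of x]
    N_smult(1)[OF zero_diff_op[OF emb_i], of x] N.add.r_cancel_one' by simp

lemma N_smult_sum: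
  assumes "finite A" "\<And>s. s \<in> A \<Longrightarrow> P s \<in> carrier DK" "x \<in> carrier N"
  shows "(\<lambda>y. \<Sum>s\<in>A. P s y) \<odot> x = (\<Oplus>s\<in>A. P s \<odot> x)"
  using assms(1,2)
proof (induction A)
  case empty
  show ?case using assms(3) by (simp add: N_smult_zero)
next
  case (insert s A)
  then have "(\<lambda>y. \<Sum>s\<in>insert s A. P s y) \<odot> x = P s \<odot> x \<oplus> (\<lambda>y. \<Sum>s\<in>A. P s y) \<odot> x"
    using N_smult(2)[of "P s" "\<lambda>y. \<Sum>s\<in>A. P s y" x] assms(3) by (simp add: sum_diff_op[OF emb_i])
  then show ?case using insert assms(3) by (subst N.finsum_insert) (auto simp: N_smult)
qed

abbreviation "F \<equiv> tensor_free N :: ('b \<times> 'n \<Rightarrow>\<^sub>0 int) monoid"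
abbreviation "Rel \<equiv> tensor_rel j N"
abbreviation "T \<equiv> tensor_group j N"
abbreviation "M \<equiv> pullback i j N"
abbreviation "tens \<equiv> tensor j N"

abbreviation Gens :: "('b \<times> 'n \<Rightarrow>\<^sub>0 int) set" where
  "Gens \<equiv> {frag_of (a + b, x) - frag_of (a, x) - frag_of (b, x) | a b x. x \<in> carrier N} \<union>
     {frag_of (a, x \<oplus> y) - frag_of (a, x) - frag_of (a, y) | a x y.
     x \<in> carrier N \<and> y \<in> carrier N} \<union>
     {frag_of (a * j c, x) - frag_of (a, mult_op c \<odot> x) | a c x. x \<in> carrier N}"

sublocale F: comm_group F by (rule abelian_free_Abelian_group)

lemma Rel_gens: "Gens \<subseteq> carrier F"
proof -
  have diff: "u - v \<in> carrier F" if "u \<in> carrier F" "v \<in> carrier F" for u v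
    using that keys_diff[of u v] by auto
  show ?thesis
    by (auto simp: N_smult simp del: carrier_free_Abelian_group_iff intro!: diff)
qed

lemma Rel_subgroup: "subgroup Rel F"
  unfolding tensor_rel_def by (rule F.generate_is_subgroup[OF Rel_gens])

lemma Rel_normal: "Rel \<lhd> F"
  using Rel_subgroup by (simp add: F.normal_iff_subgroup)

lemma T_comm_group: "comm_group T"
  unfolding tensor_group_def by (rule F.abelian_FactGroup[OF Rel_subgroup])

sublocale T: comm_group T by (rule T_comm_group)

lemma M_simps: "carrier M = carrier T" "\<zero>\<^bsub>M\<^esub> = \<one>\<^bsub>T\<^esub>" "x \<oplus>\<^bsub>M\<^esub> y = x \<otimes>\<^bsub>T\<^esub> y"
  by (simp_all add: pullback_def)

lemma M_abelian: "abelian_group M"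
proof (rule abelian_groupI, unfold M_simps)
  show "\<exists>y\<in>carrier T. y \<otimes>\<^bsub>T\<^esub> x = \<one>\<^bsub>T\<^esub>" if "x \<in> carrier T" for x
    using that T.l_inv T.inv_closed by blast
qed (simp_all add: T.m_assoc, simp add: T.m_comm)

sublocale M: abelian_group M by (rule M_abelian)

lemma M_finsum: "finsum M f A = finprod T f A"
  by (simp add: finsum_def finprod_def M_simps pullback_def cong: if_cong)

lemma coset_T: "u \<in> carrier F \<Longrightarrow> Rel #>\<^bsub>F\<^esub> u \<in> carrier T"
  by (simp add: tensor_group_def FactGroup_def F.rcosetsI[OF subgroup.subset[OF Rel_subgroup]])

lemma coset_add: "u \<in> carrier F \<Longrightarrow> v \<in> carrier F \<Longrightarrow>
    (Rel #>\<^bsub>F\<^esub> u) \<oplus>\<^bsub>M\<^esub> (Rel #>\<^bsub>F\<^esub> v) = Rel #>\<^bsub>F\<^esub> (u + v)"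
  using normal.rcos_sum[OF Rel_normal, of u v] by (simp add: M_simps tensor_group_def FactGroup_def)

lemma coset_eq:
  assumes "u \<in> carrier F" "v \<in> carrier F" "u - v \<in> Rel"
  shows "Rel #>\<^bsub>F\<^esub> u = Rel #>\<^bsub>F\<^esub> v"
proof -
  have "u \<in> Rel #>\<^bsub>F\<^esub> v" unfolding r_coset_def using assms(3) by force
  then show ?thesis using F.repr_independence[OF _ assms(2) Rel_subgroup] by simp
qed

lemma tens_closed [simp]: "x \<in> carrier N \<Longrightarrow> tens a x \<in> carrier M"
  by (simp add: M_simps tensor_def coset_T)

lemma Rel_gen: "g \<in> Gens \<Longrightarrow> g \<in> Rel"
  unfolding tensor_rel_def by (rule generate.incl)

lemma Rel_add: "u \<in> Rel \<Longrightarrow> v \<in> Rel \<Longrightarrow> u + v \<in> Rel"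
  using subgroup.m_closed[OF Rel_subgroup] by simp

lemma Rel_minus: "u \<in> Rel \<Longrightarrow> - u \<in> Rel"
  using subgroup.m_inv_closed[OF Rel_subgroup] subgroup.mem_carrier[OF Rel_subgroup, of u] by force

lemma frag_sum_F: "x \<in> carrier N \<Longrightarrow> y \<in> carrier N \<Longrightarrow> frag_of (a, x) + frag_of (b, y) \<in> carrier F"
  using keys_add[of "frag_of (a, x) :: _ \<Rightarrow>\<^sub>0 int" "frag_of (b, y)"] by auto

lemma tens_add_left: "x \<in> carrier N \<Longrightarrow> tens (a + b) x = tens a x \<oplus>\<^bsub>M\<^esub> tens b x"
  unfolding tensor_def
  by (subst coset_add, simp, simp, rule coset_eq, simp, simp only: frag_sum_F, rule Rel_gen)
    (auto simp flip: diff_diff_add)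

lemma tens_add_right:
  "x \<in> carrier N \<Longrightarrow> y \<in> carrier N \<Longrightarrow> tens a (x \<oplus> y) = tens a x \<oplus>\<^bsub>M\<^esub> tens a y"
  unfolding tensor_def
  by (subst coset_add, simp, simp, rule coset_eq, simp, simp only: frag_sum_F, rule Rel_gen)
    (auto simp flip: diff_diff_add)

lemma tens_balanced: "x \<in> carrier N \<Longrightarrow> tens (a * j c) x = tens a (mult_op c \<odot> x)"
  unfolding tensor_def by (rule coset_eq, simp, simp add: N_smult, rule Rel_gen) auto

lemma tens_zero_right: "tens a \<zero> = \<zero>\<^bsub>M\<^esub>"
  by (rule add_hom_zero[OF N_abelian M_abelian]) (auto intro!: add_homI simp: tens_add_right)

lemma tens_add_hom: "add_hom N M (tens a)"
  by (auto intro!: add_homI simp: tens_add_right)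

lemma tens_zero_left: "x \<in> carrier N \<Longrightarrow> tens 0 x = \<zero>\<^bsub>M\<^esub>"
  using tens_add_left[of x 0 0] M.add.r_cancel_one'[of "tens 0 x" "tens 0 x"] by simp

lemma tens_sum_left:
  assumes "x \<in> carrier N" "finite A"
  shows "tens (\<Sum>s\<in>A. f s) x = (\<Oplus>\<^bsub>M\<^esub>s\<in>A. tens (f s) x)"
  using assms(2)
proof (induction A)
  case (insert s A)
  then show ?case using assms(1) by (subst M.finsum_insert) (auto simp: tens_add_left)
qed (use assms(1) in \<open>simp add: tens_zero_left\<close>)

lemma M_cases:
  assumes "m \<in> carrier M"
  obtains u where "u \<in> carrier F" "m = Rel #>\<^bsub>F\<^esub> u"
  using assms by (auto simp: M_simps tensor_group_def FactGroup_def RCOSETS_def)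

text \<open>Negation needs no case of its own, as the negative of l \<otimes> x is (-l) \<otimes> x.
  Inside, v and -v are treated together because the induction on the free group runs through
  differences.\<close>

lemma tens_induct [consumes 1, case_names tens add]:
  assumes m: "m \<in> carrier M"
    and tens: "\<And>a x. x \<in> carrier N \<Longrightarrow> Q (tens a x)"
    and add: "\<And>u v. u \<in> carrier M \<Longrightarrow> v \<in> carrier M \<Longrightarrow> Q u \<Longrightarrow> Q v \<Longrightarrow> Q (u \<oplus>\<^bsub>M\<^esub> v)"
  shows "Q m"
proof -
  obtain u where u: "u \<in> carrier F" "m = Rel #>\<^bsub>F\<^esub> u" using M_cases[OF m] .
  have "v \<in> carrier F \<and> Q (Rel #>\<^bsub>F\<^esub> v) \<and> Q (Rel #>\<^bsub>F\<^esub> (- v))" if "Poly_Mapping.keys v \<subseteq> UNIV \<times> carrier N" for v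
    using that
  proof (induction v rule: frag_induction)
    case zero
    have "Rel #>\<^bsub>F\<^esub> 0 = tens 0 \<zero>"
      using coset_add[of 0 0] coset_T[of 0] M.add.r_cancel_one'[of "Rel #>\<^bsub>F\<^esub> 0" "Rel #>\<^bsub>F\<^esub> 0"]
      by (simp add: tens_zero_left M_simps)
    then show ?case using tens[of "\<zero>" 0] by simp
  next
    case (diff x y)
    have xy: "x \<in> carrier F" "y \<in> carrier F" "- x \<in> carrier F" "- y \<in> carrier F"
      using diff by simp_all
    have "x - y \<in> carrier F" using xy keys_diff[of x y] by auto
    moreover have "Rel #>\<^bsub>F\<^esub> (x - y) = (Rel #>\<^bsub>F\<^esub> x) \<oplus>\<^bsub>M\<^esub> (Rel #>\<^bsub>F\<^esub> (- y))"
      using coset_add[OF xy(1,4)] by simp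
    moreover have "Rel #>\<^bsub>F\<^esub> (- (x - y)) = (Rel #>\<^bsub>F\<^esub> (- x)) \<oplus>\<^bsub>M\<^esub> (Rel #>\<^bsub>F\<^esub> y)"
      using coset_add[OF xy(3,2)] by simp
    ultimately show ?case
      using diff add coset_T[OF xy(1)] coset_T[OF xy(2)] coset_T[OF xy(3)] coset_T[OF xy(4)]
      by (simp only: M_simps(1))
  next
    case (one a)
    then obtain l x where a: "a = (l, x)" "x \<in> carrier N" by auto
    have "Rel #>\<^bsub>F\<^esub> (frag_of (- l, x)) = Rel #>\<^bsub>F\<^esub> (- frag_of (l, x))"
    proof (rule coset_eq)
      \<comment> \<open>The second relation, for 0 + 0, cancels the generator
        \<open>frag_of (0, x)\<close> that the first one leaves behind.\<close>
      have "frag_of (- l + l, x) - frag_of (- l, x) - frag_of (l, x) \<in> Rel"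
        "frag_of (0 + 0, x) - frag_of (0, x) - frag_of (0, x) \<in> Rel"
        using a(2) by (blast intro: Rel_gen)+
      then have "- (frag_of (- l + l, x) - frag_of (- l, x) - frag_of (l, x) +
          (frag_of (0 + 0, x) - frag_of (0, x) - frag_of (0, x))) \<in> Rel"
        by (intro Rel_minus Rel_add)
      then show "frag_of (- l, x) - - frag_of (l, x) \<in> Rel" by (simp add: add.commute)
    qed (use a in auto)
    then show ?case using tens[OF a(2), of l] tens[OF a(2), of "- l"] a by (simp add: tensor_def)
  qed
  then show ?thesis using u by simp
qed

text \<open>The source of the action of D_L, of \<open>sig\<close> and of \<open>Tr\<close>.\<close>

lemma tens_universal:
  fixes H :: "('h, 'u) ring_scheme"
  assumes H: "abelian_group H"
    and f: "\<And>a x. x \<in> carrier N \<Longrightarrow> f a x \<in> carrier H"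
    and "\<And>a b x. x \<in> carrier N \<Longrightarrow> f (a + b) x = f a x \<oplus>\<^bsub>H\<^esub> f b x"
    and "\<And>a x y. x \<in> carrier N \<Longrightarrow> y \<in> carrier N \<Longrightarrow> f a (x \<oplus> y) = f a x \<oplus>\<^bsub>H\<^esub> f a y"
    and "\<And>a c x. x \<in> carrier N \<Longrightarrow> f (a * j c) x = f a (mult_op c \<odot> x)"
  obtains h where "add_hom M H h" "\<And>a x. x \<in> carrier N \<Longrightarrow> h (tens a x) = f a x"
proof -
  interpret H: abelian_group H by (rule H)
  have img: "(\<lambda>z. f (fst z) (snd z)) ` (UNIV \<times> carrier N) \<subseteq> carrier (add_monoid H)"
    using f by auto
  obtain h where h: "h \<in> hom F (add_monoid H)"
    "\<And>z. z \<in> UNIV \<times> carrier N \<Longrightarrow> h (frag_of z) = f (fst z) (snd z)"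
    using comm_group.free_Abelian_group_universal[OF H.a_comm_group img] by blast
  interpret h: group_hom F "add_monoid H" h
    using h(1) H.a_group by (simp add: group_hom_def group_hom_axioms_def F.is_group)
  have h_closed: "h u \<in> carrier H" if "u \<in> carrier F" for u
    using h.hom_closed[OF that] by simp
  have h_add: "h (u + v) = h u \<oplus>\<^bsub>H\<^esub> h v" if "u \<in> carrier F" "v \<in> carrier F" for u v
    using h.hom_mult[OF that] by simp
  have h_diff: "h (u - v) = h u \<ominus>\<^bsub>H\<^esub> h v" if "u \<in> carrier F" "v \<in> carrier F" for u v
  proof -
    have uv: "u - v \<in> carrier F" using that keys_diff[of u v] by auto
    then have "h u = h (u - v) \<oplus>\<^bsub>H\<^esub> h v" using h_add[OF uv that(2)] by simp
    then show ?thesis using h_closed[OF uv] h_closed[OF that(2)]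
      by (simp add: a_minus_def H.a_assoc H.r_neg)
  qed
  have ker: "Rel \<subseteq> kernel F (add_monoid H) h"
    unfolding tensor_rel_def
  proof (rule F.generate_subgroup_incl[OF _ h.subgroup_kernel])
    have diff: "u - v \<in> carrier F" if "u \<in> carrier F" "v \<in> carrier F" for u v
      using that keys_diff[of u v] by auto
    have k: "u - v \<in> kernel F (add_monoid H) h" if "u \<in> carrier F" "v \<in> carrier F" "h u = h v" for u v
      using that h_closed[OF that(2)] diff[OF that(1,2)] h_diff[OF that(1,2)]
      by (simp add: kernel_def a_minus_def H.r_neg del: carrier_free_Abelian_group_iff)
    show "Gens \<subseteq> kernel F (add_monoid H) h"
      unfolding diff_diff_add
      by (intro Un_least subsetI; clarsimp simp del: carrier_free_Abelian_group_iff; rule k)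
       (auto simp: h_add h(2) assms(3-5) N_smult frag_sum_F simp del: carrier_free_Abelian_group_iff)
  qed
  obtain g where g: "g \<in> hom (F Mod Rel) (add_monoid H)" "\<And>u. u \<in> carrier F \<Longrightarrow> g (Rel #>\<^bsub>F\<^esub> u) = h u"
    using h.FactGroup_universal_kernel[OF Rel_normal ker] by blast
  show thesis
  proof (rule that[of g])
    show "add_hom M H g"
      using g(1) unfolding add_hom_def M_simps tensor_group_def hom_def by auto
    show "g (tens a x) = f a x" if "x \<in> carrier N" for a x
      using that g(2)[of "frag_of (a, x)"] h(2)[of "(a, x)"] by (simp add: tensor_def)
  qed
qed

lemma add_hom_eqI:
  assumes "add_hom M H f" "add_hom M H g" "\<And>a x. x \<in> carrier N \<Longrightarrow> f (tens a x) = g (tens a x)"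
    and "m \<in> carrier M"
  shows "f m = g m"
  using assms(4) by (induction m rule: tens_induct) (auto simp: assms(3) add_hom_add[OF assms(1)] add_hom_add[OF assms(2)])

section \<open>The inverse image as a module\<close>

text \<open>\<open>Q l = \<Sum>\<^sub>t \<alpha>\<^sub>t R\<^sub>t\<close> in \<open>D\<^sub>L\<close>, where \<open>R\<^sub>t\<close> extends \<open>coef Q l t\<close> from \<open>K\<close> to \<open>L\<close>.\<close>

definition coef :: "('b \<Rightarrow> 'b) \<Rightarrow> 'b \<Rightarrow> nat \<Rightarrow> 'a \<Rightarrow> 'a" where
  "coef Q l t = (\<lambda>y. tr (\<beta> t * Q (l * j y)))"

lemma coef_DK: "Q \<in> carrier DL \<Longrightarrow> coef Q l t \<in> carrier DK"
  unfolding coef_def by (rule tr_diff_op)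

definition act_tens :: "('b \<Rightarrow> 'b) \<Rightarrow> 'b \<Rightarrow> 'n \<Rightarrow> ('b \<times> 'n \<Rightarrow>\<^sub>0 int) set" where
  "act_tens Q l x = (\<Oplus>\<^bsub>M\<^esub>t\<in>I. tens (\<alpha> t) (coef Q l t \<odot> x))"

text \<open>Independence of the expansion. Any expansion of Q l gives \<open>coef Q l t\<close> =
  \<Sum> tr (\<beta> t a s) P s. The traces lie in K and move across the tensor sign, and
  \<open>dual_expansion\<close> collects \<Sum> \<alpha> t tr (\<beta> t a s) into a s. Only the
  values of Q l on K enter.\<close>

lemma act_tens_eq:
  assumes A: "finite A" and P: "\<And>s. s \<in> A \<Longrightarrow> P s \<in> carrier DK"
    and Q: "\<And>y. Q (l * j y) = (\<Sum>s\<in>A. a s * j (P s y))" and x: "x \<in> carrier N"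
  shows "act_tens Q l x = (\<Oplus>\<^bsub>M\<^esub>s\<in>A. tens (a s) (P s \<odot> x))"
proof -
  define C where "C t s = tr (\<beta> t * a s)" for t s
  have cl: "P s \<odot> x \<in> carrier N" if "s \<in> A" for s using that P x by (simp add: N_smult)
  have "coef Q l t \<odot> x = (\<Oplus>s\<in>A. mult_op (C t s) \<odot> (P s \<odot> x))" for t
  proof -
    have "coef Q l t = (\<lambda>y. \<Sum>s\<in>A. C t s * P s y)"
    proof
      fix y
      have "coef Q l t y = (\<Sum>s\<in>A. tr (\<beta> t * (j (P s y) * a s)))"
        unfolding coef_def Q by (simp only: sum_distrib_left tr_sum mult.commute[of "a _"])
      also have "\<dots> = (\<Sum>s\<in>A. P s y * C t s)"
        by (simp only: tr_mult_j_mult C_def)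
      finally show "coef Q l t y = (\<Sum>s\<in>A. C t s * P s y)"
        by (simp add: mult.commute)
    qed
    then have "coef Q l t \<odot> x = (\<Oplus>s\<in>A. (\<lambda>y. C t s * P s y) \<odot> x)"
      using N_smult_sum[OF A, of "\<lambda>s y. C t s * P s y" x] left_mult_diff_op[OF emb_i P] x by simp
    also have "\<dots> = (\<Oplus>s\<in>A. mult_op (C t s) \<odot> (P s \<odot> x))"
      by (rule N.finsum_cong') (auto simp: N_smult(4)[OF mult_op_DK P x] N_smult(1) cl)
    finally show ?thesis .
  qed
  then have "act_tens Q l x = (\<Oplus>\<^bsub>M\<^esub>t\<in>I. tens (\<alpha> t) (\<Oplus>s\<in>A. mult_op (C t s) \<odot> (P s \<odot> x)))"
    by (simp add: act_tens_def)
  also have "\<dots> = (\<Oplus>\<^bsub>M\<^esub>t\<in>I. \<Oplus>\<^bsub>M\<^esub>s\<in>A. tens (\<alpha> t * j (C t s)) (P s \<odot> x))"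
  proof (rule M.finsum_cong')
    fix t assume "t \<in> I"
    have "tens (\<alpha> t) (\<Oplus>s\<in>A. mult_op (C t s) \<odot> (P s \<odot> x)) =
        (\<Oplus>\<^bsub>M\<^esub>s\<in>A. tens (\<alpha> t) (mult_op (C t s) \<odot> (P s \<odot> x)))"
      by (rule add_hom_finsum[OF N_abelian M_abelian tens_add_hom A]) (simp add: N_smult cl)
    also have "\<dots> = (\<Oplus>\<^bsub>M\<^esub>s\<in>A. tens (\<alpha> t * j (C t s)) (P s \<odot> x))"
      by (rule M.finsum_cong') (auto simp: tens_balanced cl N_smult(1))
    finally show "tens (\<alpha> t) (\<Oplus>s\<in>A. mult_op (C t s) \<odot> (P s \<odot> x)) = \<dots>" .
  qed (auto intro!: M.finsum_closed simp: cl)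
  also have "\<dots> = (\<Oplus>\<^bsub>M\<^esub>s\<in>A. \<Oplus>\<^bsub>M\<^esub>t\<in>I. tens (\<alpha> t * j (C t s)) (P s \<odot> x))"
    by (rule M.finsum_swap) (auto simp: A cl)
  also have "\<dots> = (\<Oplus>\<^bsub>M\<^esub>s\<in>A. tens (a s) (P s \<odot> x))"
    by (rule M.finsum_cong') (auto simp: tens_sum_left[symmetric] cl C_def dual_expansion)
  finally show ?thesis .
qed

lemma act_tens_closed: "Q \<in> carrier DL \<Longrightarrow> x \<in> carrier N \<Longrightarrow> act_tens Q l x \<in> carrier M"
  unfolding act_tens_def by (auto intro!: M.finsum_closed simp: N_smult coef_DK)

lemma act_exists:
  assumes Q: "Q \<in> carrier DL"
  obtains h where "add_hom M M h" "\<And>l x. x \<in> carrier N \<Longrightarrow> h (tens l x) = act_tens Q l x"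
proof (rule tens_universal[OF M_abelian act_tens_closed[OF Q]])
  note cl = N_smult(1)[OF coef_DK[OF Q]]
  have Qadd: "Q (u + v) = Q u + Q v" for u v by (rule diff_op_add_arg[OF emb_ji Q])
  fix a b x assume x: "x \<in> carrier N"
  have "coef Q (a + b) t = (\<lambda>y. coef Q a t y + coef Q b t y)" for t
    by (simp add: coef_def Qadd distrib_left distrib_right tr_add)
  then have "coef Q (a + b) t \<odot> x = coef Q a t \<odot> x \<oplus> coef Q b t \<odot> x" for t
    using N_smult(2)[OF coef_DK[OF Q] coef_DK[OF Q] x] by simp
  then have "act_tens Q (a + b) x =
      (\<Oplus>\<^bsub>M\<^esub>t\<in>I. tens (\<alpha> t) (coef Q a t \<odot> x) \<oplus>\<^bsub>M\<^esub> tens (\<alpha> t) (coef Q b t \<odot> x))"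
    by (simp add: act_tens_def tens_add_right cl x)
  then show "act_tens Q (a + b) x = act_tens Q a x \<oplus>\<^bsub>M\<^esub> act_tens Q b x"
    unfolding act_tens_def by (subst M.finsum_addf[symmetric]) (auto simp: cl x)
next
  note cl = N_smult(1)[OF coef_DK[OF Q]]
  fix a x y assume x: "x \<in> carrier N" "y \<in> carrier N"
  have "act_tens Q a (x \<oplus> y) =
      (\<Oplus>\<^bsub>M\<^esub>t\<in>I. tens (\<alpha> t) (coef Q a t \<odot> x) \<oplus>\<^bsub>M\<^esub> tens (\<alpha> t) (coef Q a t \<odot> y))"
    by (simp add: act_tens_def N_smult(3)[OF coef_DK[OF Q]] tens_add_right cl x)
  then show "act_tens Q a (x \<oplus> y) = act_tens Q a x \<oplus>\<^bsub>M\<^esub> act_tens Q a y"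
    unfolding act_tens_def by (subst M.finsum_addf[symmetric]) (auto simp: cl x)
next
  fix a c x assume x: "x \<in> carrier N"
  have "coef Q (a * j c) t = (\<lambda>y. coef Q a t (mult_op c y))" for t
    by (simp add: coef_def j_simps mult.assoc)
  then show "act_tens Q (a * j c) x = act_tens Q a (mult_op c \<odot> x)"
    using N_smult(4)[OF coef_DK[OF Q] mult_op_DK x] by (simp add: act_tens_def)
qed (use that in auto)

text \<open>This discharges the definite description. Existence: by \<open>act_tens_eq\<close> the
  map of \<open>act_exists\<close> has the prescribed value for every expansion. Uniqueness:
  \<open>diff_op_expansion\<close> provides an expansion for each l, which fixes the values on
  tensors, and these generate M.\<close>

lemma pullback_action_char:
  assumes Q: "Q \<in> carrier DL"
  shows "add_hom M M (pullback_action i j N Q)"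
    and "x \<in> carrier N \<Longrightarrow> pullback_action i j N Q (tens l x) = act_tens Q l x"
proof -
  define \<Phi> where "\<Phi> S \<longleftrightarrow> S \<in> hom T T \<and> S \<in> extensional (carrier T) \<and>
     (\<forall>l. \<forall>x\<in>carrier N. \<forall>m a P R.
        (\<forall>s<m. P s \<in> carrier DK \<and> R s \<in> carrier DL \<and> R s \<circ> j = j \<circ> P s) \<and>
        (\<forall>y. Q (l * y) = (\<Sum>s<m. a s * R s y)) \<longrightarrow>
        S (tens l x) = (\<Otimes>\<^bsub>T\<^esub>s\<in>{..<m::nat}. tens (a s) (P s \<odot> x)))" for S
  have hom: "S \<in> hom T T \<longleftrightarrow> add_hom M M S" for S
    by (auto simp: add_hom_def hom_def M_simps)
  obtain h where h: "add_hom M M h" "\<And>l x. x \<in> carrier N \<Longrightarrow> h (tens l x) = act_tens Q l x"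
    using act_exists[OF Q] by blast
  \<comment> \<open>Restriction makes the map extensional, as the description demands; otherwise its
    values off the carrier would be undetermined.\<close>
  define h' where "h' = restrict h (carrier T)"
  have h': "h' m = h m" if "m \<in> carrier M" for m using that by (simp add: h'_def M_simps)
  have 1: "\<Phi> h'" unfolding \<Phi>_def
  proof (intro conjI allI ballI impI)
    show "h' \<in> hom T T"
      using h(1) M.a_closed unfolding hom add_hom_def Pi_iff by (simp add: h')
    fix l x a P R and m :: nat
    assume x: "x \<in> carrier N"
      and *: "(\<forall>s<m. P s \<in> carrier DK \<and> R s \<in> carrier DL \<and> R s \<circ> j = j \<circ> P s) \<and>
        (\<forall>y. Q (l * y) = (\<Sum>s<m. a s * R s y))"
    have R: "R s (j y) = j (P s y)" if "s < m" for s y using * that by (metis comp_apply)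
    have "act_tens Q l x = (\<Oplus>\<^bsub>M\<^esub>s\<in>{..<m}. tens (a s) (P s \<odot> x))"
      by (rule act_tens_eq) (use * R x in auto)
    then show "h' (tens l x) = (\<Otimes>\<^bsub>T\<^esub>s\<in>{..<m}. tens (a s) (P s \<odot> x))"
      using x by (simp add: h' h(2) M_finsum)
  qed (simp add: h'_def)
  have char: "S (tens l x) = act_tens Q l x" if S: "\<Phi> S" and x: "x \<in> carrier N" for S l x
  proof -
    obtain R where R: "\<And>t. R t \<in> carrier DL" "\<And>t. R t \<circ> j = j \<circ> coef Q l t"
      "\<And>y. Q (l * y) = (\<Sum>t\<in>I. \<alpha> t * R t y)"
      using diff_op_expansion[OF Q, of l] unfolding coef_def by blast
    have "S (tens l x) = (\<Otimes>\<^bsub>T\<^esub>t\<in>{..<length dual_system}. tens (\<alpha> t) (coef Q l t \<odot> x))"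
      using S[unfolded \<Phi>_def, THEN conjunct2, THEN conjunct2, rule_format, OF x,
          of "length dual_system" "coef Q l" R l \<alpha>] R coef_DK[OF Q] unfolding I_def by blast
    then show ?thesis by (simp add: act_tens_def M_finsum I_def)
  qed
  have 2: "S = h'" if S: "\<Phi> S" for S
  proof (rule extensionalityI)
    show "S \<in> extensional (carrier T)" "h' \<in> extensional (carrier T)"
      using S 1 by (auto simp: \<Phi>_def)
    have "add_hom M M S" "add_hom M M h'" using S 1 hom by (auto simp: \<Phi>_def)
    then show "S m = h' m" if "m \<in> carrier T" for m
      using that add_hom_eqI[of M S h'] char[OF S] char[OF 1] by (simp add: M_simps)
  qed
  have "pullback_action i j N Q = (THE S. \<Phi> S)" unfolding pullback_action_def \<Phi>_def ..
  also have "\<dots> = h'" by (rule the_equality[of \<Phi>, OF 1 2])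
  finally have eq: "pullback_action i j N Q = h'" .
  show "add_hom M M (pullback_action i j N Q)" using 1 hom unfolding eq by (auto simp: \<Phi>_def)
  show "pullback_action i j N Q (tens l x) = act_tens Q l x" if "x \<in> carrier N"
    unfolding eq by (rule char[OF 1 that])
qed

lemma M_smult: "Q \<odot>\<^bsub>M\<^esub> m = pullback_action i j N Q m"
  by (simp add: pullback_def)

lemma M_smult_add_hom: "Q \<in> carrier DL \<Longrightarrow> add_hom M M (\<lambda>m. Q \<odot>\<^bsub>M\<^esub> m)"
  unfolding M_smult using pullback_action_char(1) by (simp add: eta_contract_eq)

lemma M_smult_tens: "Q \<in> carrier DL \<Longrightarrow> x \<in> carrier N \<Longrightarrow> Q \<odot>\<^bsub>M\<^esub> tens l x = act_tens Q l x"
  unfolding M_smult by (rule pullback_action_char(2))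

lemma M_smult_closed: "Q \<in> carrier DL \<Longrightarrow> m \<in> carrier M \<Longrightarrow> Q \<odot>\<^bsub>M\<^esub> m \<in> carrier M"
  by (rule add_hom_closed[OF M_smult_add_hom])

lemma M_smult_tens_eq:
  assumes "Q \<in> carrier DL" "finite A" "\<And>s. s \<in> A \<Longrightarrow> P s \<in> carrier DK"
    "\<And>y. Q (l * j y) = (\<Sum>s\<in>A. a s * j (P s y))" "x \<in> carrier N"
  shows "Q \<odot>\<^bsub>M\<^esub> tens l x = (\<Oplus>\<^bsub>M\<^esub>s\<in>A. tens (a s) (P s \<odot> x))"
  using assms(1,5) act_tens_eq[OF assms(2-5)] by (simp add: M_smult_tens)

lemma M_smult_tens_eq1:
  assumes "Q \<in> carrier DL" "P \<in> carrier DK" "\<And>y. Q (l * j y) = a * j (P y)" "x \<in> carrier N"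
  shows "Q \<odot>\<^bsub>M\<^esub> tens l x = tens a (P \<odot> x)"
  using M_smult_tens_eq[of Q "{()}" "\<lambda>_. P" l "\<lambda>_. a" x] assms by (simp add: N_smult)

lemma mult_op_DL [simp]: "mult_op c \<in> carrier DL"
  by (rule mult_op_diff_op[OF emb_ji])

lemma id_DK: "(\<lambda>y. y) \<in> carrier DK"
  using id_diff_op[OF emb_i] by (simp add: id_def)

lemma M_mult_op_tens: "x \<in> carrier N \<Longrightarrow> mult_op c \<odot>\<^bsub>M\<^esub> tens l x = tens (c * l) x"
  using M_smult_tens_eq1[OF mult_op_DL id_DK, of c l "c * l" x] by (simp add: N_smult mult.assoc)

lemma DL_expansion:
  assumes "Q \<in> carrier DL"
  shows "Q (l * j y) = (\<Sum>t\<in>I. \<alpha> t * j (coef Q l t y))"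
  by (simp add: coef_def dual_expansion)

lemma M_module: "left_module DL M"
proof (intro left_module.intro left_module_axioms.intro, unfold diff_op_ring_simps)
  show "ring DL" by (rule ring_diff_op_ring[OF emb_ji])
  show "abelian_group M" by (rule M_abelian)
  fix Q S m assume Q: "Q \<in> carrier DL" and m: "m \<in> carrier M"
  show "Q \<odot>\<^bsub>M\<^esub> m \<in> carrier M" by (rule M_smult_closed[OF Q m])
  show "Q \<odot>\<^bsub>M\<^esub> (m \<oplus>\<^bsub>M\<^esub> n) = Q \<odot>\<^bsub>M\<^esub> m \<oplus>\<^bsub>M\<^esub> Q \<odot>\<^bsub>M\<^esub> n" if "n \<in> carrier M" for n
    by (rule add_hom_add[OF M_smult_add_hom[OF Q] m that])
  assume S: "S \<in> carrier DL"
  note QS = add_diff_op[OF emb_ji Q S] comp_diff_op[OF emb_ji Q S]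
  show "(\<lambda>x. Q x + S x) \<odot>\<^bsub>M\<^esub> m = Q \<odot>\<^bsub>M\<^esub> m \<oplus>\<^bsub>M\<^esub> S \<odot>\<^bsub>M\<^esub> m"
  proof (rule add_hom_eqI[OF M_smult_add_hom[OF QS(1)] _ _ m])
    show "add_hom M M (\<lambda>m. Q \<odot>\<^bsub>M\<^esub> m \<oplus>\<^bsub>M\<^esub> S \<odot>\<^bsub>M\<^esub> m)"
      by (rule add_homI) (simp_all add: M_smult_closed[OF Q] M_smult_closed[OF S]
        add_hom_add[OF M_smult_add_hom[OF Q]] add_hom_add[OF M_smult_add_hom[OF S]] M.a_ac)
    fix a x assume x: "x \<in> carrier N"
    note cl = N_smult(1)[OF coef_DK[OF Q] x] N_smult(1)[OF coef_DK[OF S] x]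
    have "coef (\<lambda>x. Q x + S x) a t = (\<lambda>y. coef Q a t y + coef S a t y)" for t
      by (simp add: coef_def distrib_left tr_add)
    then have "coef (\<lambda>x. Q x + S x) a t \<odot> x = coef Q a t \<odot> x \<oplus> coef S a t \<odot> x" for t
      using N_smult(2)[OF coef_DK[OF Q] coef_DK[OF S] x] by simp
    then have "act_tens (\<lambda>x. Q x + S x) a x =
        (\<Oplus>\<^bsub>M\<^esub>t\<in>I. tens (\<alpha> t) (coef Q a t \<odot> x) \<oplus>\<^bsub>M\<^esub> tens (\<alpha> t) (coef S a t \<odot> x))"
      by (simp add: act_tens_def tens_add_right cl x)
    then have "act_tens (\<lambda>x. Q x + S x) a x = act_tens Q a x \<oplus>\<^bsub>M\<^esub> act_tens S a x"
      unfolding act_tens_def by (subst M.finsum_addf[symmetric]) (auto simp: cl x)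
    then show "(\<lambda>x. Q x + S x) \<odot>\<^bsub>M\<^esub> tens a x = Q \<odot>\<^bsub>M\<^esub> tens a x \<oplus>\<^bsub>M\<^esub> S \<odot>\<^bsub>M\<^esub> tens a x"
      by (simp only: M_smult_tens[OF Q x] M_smult_tens[OF S x] M_smult_tens[OF QS(1) x])
  qed
  show "(Q \<circ> S) \<odot>\<^bsub>M\<^esub> m = Q \<odot>\<^bsub>M\<^esub> (S \<odot>\<^bsub>M\<^esub> m)"
  proof (rule add_hom_eqI[OF M_smult_add_hom[OF QS(2)] _ _ m])
    show "add_hom M M (\<lambda>m. Q \<odot>\<^bsub>M\<^esub> (S \<odot>\<^bsub>M\<^esub> m))"
      by (rule add_hom_comp[OF M_smult_add_hom[OF S] M_smult_add_hom[OF Q]])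
    fix a x assume x: "x \<in> carrier N"
    note cl = N_smult(1)[OF coef_DK[OF S] x]
    \<comment> \<open>Expanding S at a and then Q at each \<alpha> t expands the composite over
      pairs of indices; any finite expansion may be used to compute the action.\<close>
    have "(Q \<circ> S) \<odot>\<^bsub>M\<^esub> tens a x = (\<Oplus>\<^bsub>M\<^esub>z\<in>I \<times> I. tens (\<alpha> (snd z))
        ((\<lambda>y. coef Q (\<alpha> (fst z)) (snd z) (coef S a (fst z) y)) \<odot> x))"
    proof (rule M_smult_tens_eq[OF QS(2) _ _ _ x])
      show "(\<lambda>y. coef Q (\<alpha> (fst z)) (snd z) (coef S a (fst z) y)) \<in> carrier DK" for z
        using comp_diff_op[OF emb_i coef_DK[OF Q] coef_DK[OF S]] by (simp add: comp_def)
      show "(Q \<circ> S) (a * j y) = (\<Sum>z\<in>I \<times> I. \<alpha> (snd z) * j (coef Q (\<alpha> (fst z)) (snd z) (coef S a (fst z) y)))" for y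
        by (simp add: DL_expansion[OF S] diff_op_sum_arg[OF emb_ji Q] DL_expansion[OF Q] sum.cartesian_product case_prod_beta)
    qed simp
    also have "\<dots> = (\<Oplus>\<^bsub>M\<^esub>t\<in>I. \<Oplus>\<^bsub>M\<^esub>s\<in>I. tens (\<alpha> s) (coef Q (\<alpha> t) s \<odot> (coef S a t \<odot> x)))"
      by (subst M.finsum_Times) (auto simp: N_smult(4)[OF coef_DK[OF Q] coef_DK[OF S] x] N_smult(1)[OF coef_DK[OF Q]] cl)
    also have "\<dots> = (\<Oplus>\<^bsub>M\<^esub>t\<in>I. Q \<odot>\<^bsub>M\<^esub> tens (\<alpha> t) (coef S a t \<odot> x))"
      by (simp add: M_smult_tens[OF Q] cl act_tens_def)
    also have "\<dots> = Q \<odot>\<^bsub>M\<^esub> (\<Oplus>\<^bsub>M\<^esub>t\<in>I. tens (\<alpha> t) (coef S a t \<odot> x))"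
      by (rule add_hom_finsum[OF M_abelian M_abelian M_smult_add_hom[OF Q], symmetric]) (auto simp: cl)
    finally show "(Q \<circ> S) \<odot>\<^bsub>M\<^esub> tens a x = Q \<odot>\<^bsub>M\<^esub> (S \<odot>\<^bsub>M\<^esub> tens a x)"
      by (simp add: M_smult_tens[OF S x] act_tens_def)
  qed
next
  fix m assume "m \<in> carrier M"
  then show "id \<odot>\<^bsub>M\<^esub> m = m"
  proof (rule add_hom_eqI[OF M_smult_add_hom[OF id_diff_op[OF emb_ji]], rotated 2])
    show "add_hom M M (\<lambda>m. m)" by (rule add_homI) auto
    show "id \<odot>\<^bsub>M\<^esub> tens a x = tens a x" if "x \<in> carrier N" for a x
      using M_mult_op_tens[OF that, of 1 a] by (simp add: id_def)
  qed
qed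

lemma M_comp: "Q \<in> carrier DL \<Longrightarrow> S \<in> carrier DL \<Longrightarrow> m \<in> carrier M \<Longrightarrow>
    Q \<odot>\<^bsub>M\<^esub> (S \<odot>\<^bsub>M\<^esub> m) = (\<lambda>x. Q (S x)) \<odot>\<^bsub>M\<^esub> m"
  using left_module.smult_assoc[OF M_module, of Q S m] by (simp add: diff_op_ring_simps comp_def)

section \<open>The semilinear automorphism and the trace of L \<otimes> N\<close>

definition sig :: "('b \<times> 'n \<Rightarrow>\<^sub>0 int) set \<Rightarrow> ('b \<times> 'n \<Rightarrow>\<^sub>0 int) set" where
  "sig = (SOME h. add_hom M M h \<and> (\<forall>l. \<forall>x\<in>carrier N. h (tens l x) = tens (\<sigma> l) x))"

lemma sig: "add_hom M M sig" "x \<in> carrier N \<Longrightarrow> sig (tens l x) = tens (\<sigma> l) x"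
proof -
  have "\<exists>h. add_hom M M h \<and> (\<forall>l. \<forall>x\<in>carrier N. h (tens l x) = tens (\<sigma> l) x)"
    by (rule tens_universal[OF M_abelian, of "\<lambda>l x. tens (\<sigma> l) x"])
     (auto simp: field_embeddingD[OF emb_\<sigma>] \<sigma>_j tens_add_left tens_add_right tens_balanced)
  from someI_ex[OF this, folded sig_def]
  show "add_hom M M sig" "x \<in> carrier N \<Longrightarrow> sig (tens l x) = tens (\<sigma> l) x" by auto
qed

lemma sig_pow: "add_hom M M (sig ^^ r)" "x \<in> carrier N \<Longrightarrow> (sig ^^ r) (tens l x) = tens ((\<sigma> ^^ r) l) x"
proof -
  show "add_hom M M (sig ^^ r)"
  proof (induction r)
    case (Suc r)
    then show ?case using add_hom_comp[OF Suc sig(1)] by (simp add: comp_def)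
  qed (auto intro: add_homI)
  show "(sig ^^ r) (tens l x) = tens ((\<sigma> ^^ r) l) x" if "x \<in> carrier N"
    by (induction r) (auto simp: sig(2)[OF that])
qed

lemma sig_p: "m \<in> carrier M \<Longrightarrow> (sig ^^ p) m = m"
  by (rule add_hom_eqI[OF sig_pow(1), of "\<lambda>m. m" p m]) (auto intro: add_homI simp: sig_pow(2) \<sigma>_p)

text \<open>Conjugation of operators by \<sigma>, whose inverse is
  \<open>\<sigma> ^^ (p - 1)\<close>.\<close>

definition twist :: "('b \<Rightarrow> 'b) \<Rightarrow> 'b \<Rightarrow> 'b" where
  "twist Q = (\<lambda>x. \<sigma> (Q ((\<sigma> ^^ (p - 1)) x)))"

lemma twist_DL: "Q \<in> carrier DL \<Longrightarrow> twist Q \<in> carrier DL"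
  using conj_diff_op[of Q 1] p_pos by (simp add: twist_def)

text \<open>As \<sigma> fixes K, the conjugate of Q at \<sigma> a involves the same operators on K
  as Q at a, with coefficients \<sigma> (\<alpha> t) for \<alpha> t. This is not the standard
  expansion, but \<open>M_smult_tens_eq\<close> accepts any.\<close>

lemma sig_smult:
  assumes Q: "Q \<in> carrier DL" and m: "m \<in> carrier M"
  shows "sig (Q \<odot>\<^bsub>M\<^esub> m) = twist Q \<odot>\<^bsub>M\<^esub> sig m"
proof (rule add_hom_eqI[OF add_hom_comp[OF M_smult_add_hom[OF Q] sig(1)]
      add_hom_comp[OF sig(1) M_smult_add_hom[OF twist_DL[OF Q]]] _ m])
  fix a x assume x: "x \<in> carrier N"
  note cl = N_smult(1)[OF coef_DK[OF Q] x]
  have "(\<sigma> ^^ (p - 1)) (\<sigma> a) = a" using pow_inverse'[of 1 a] p_pos by simp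
  then have "twist Q (\<sigma> a * j y) = \<sigma> (Q (a * j y))" for y
    by (simp add: twist_def pow_simps pow_j)
  then have "twist Q \<odot>\<^bsub>M\<^esub> tens (\<sigma> a) x = (\<Oplus>\<^bsub>M\<^esub>t\<in>I. tens (\<sigma> (\<alpha> t)) (coef Q a t \<odot> x))"
    by (intro M_smult_tens_eq twist_DL Q x coef_DK)
     (auto simp: DL_expansion[OF Q] field_embedding_sum[OF emb_\<sigma>] field_embeddingD[OF emb_\<sigma>] \<sigma>_j)
  also have "\<dots> = (\<Oplus>\<^bsub>M\<^esub>t\<in>I. sig (tens (\<alpha> t) (coef Q a t \<odot> x)))"
    by (simp add: sig(2) cl)
  also have "\<dots> = sig (\<Oplus>\<^bsub>M\<^esub>t\<in>I. tens (\<alpha> t) (coef Q a t \<odot> x))"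
    by (rule add_hom_finsum[OF M_abelian M_abelian sig(1), symmetric]) (auto simp: cl)
  finally show "sig (Q \<odot>\<^bsub>M\<^esub> tens a x) = twist Q \<odot>\<^bsub>M\<^esub> sig (tens a x)"
    by (simp add: M_smult_tens[OF Q x] act_tens_def sig(2) x)
qed

text \<open>The map tr \<otimes> 1 from L \<otimes> N to K \<otimes> N = N.\<close>

definition Tr :: "('b \<times> 'n \<Rightarrow>\<^sub>0 int) set \<Rightarrow> 'n" where
  "Tr = (SOME h. add_hom M N h \<and> (\<forall>l. \<forall>x\<in>carrier N. h (tens l x) = mult_op (tr l) \<odot> x))"

lemma Tr: "add_hom M N Tr" "x \<in> carrier N \<Longrightarrow> Tr (tens l x) = mult_op (tr l) \<odot> x"
proof -
  have "\<exists>h. add_hom M N h \<and> (\<forall>l. \<forall>x\<in>carrier N. h (tens l x) = mult_op (tr l) \<odot> x)"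
  proof (rule tens_universal[OF N_abelian, of "\<lambda>l x. mult_op (tr l) \<odot> x"])
    fix a b c x assume x: "x \<in> carrier N"
    show "mult_op (tr (a + b)) \<odot> x = mult_op (tr a) \<odot> x \<oplus> mult_op (tr b) \<odot> x"
      using N_smult(2)[OF mult_op_DK mult_op_DK x, of "tr a" "tr b"] by (simp add: tr_add distrib_right)
    have "tr (a * j c) = tr a * c" using tr_j_mult[of c a] by (simp add: mult.commute)
    then show "mult_op (tr (a * j c)) \<odot> x = mult_op (tr a) \<odot> (mult_op c \<odot> x)"
      using N_smult(4)[OF mult_op_DK mult_op_DK x, of "tr a" c] by (simp add: mult.assoc)
  qed (auto simp: N_smult)
  from someI_ex[OF this, folded Tr_def]
  show "add_hom M N Tr" "x \<in> carrier N \<Longrightarrow> Tr (tens l x) = mult_op (tr l) \<odot> x" by auto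
qed

text \<open>This is \<open>dual_expansion\<close> tensored with N. It recovers m from traces of its
  multiples, so that a submodule on which \<open>Tr\<close> vanishes is zero.\<close>

lemma M_expansion:
  assumes m: "m \<in> carrier M"
  shows "m = (\<Oplus>\<^bsub>M\<^esub>s\<in>I. tens (\<alpha> s) (Tr (mult_op (\<beta> s) \<odot>\<^bsub>M\<^esub> m)))"
proof (rule add_hom_eqI[OF _ _ _ m])
  show "add_hom M M (\<lambda>m. m)" by (rule add_homI) auto
  show "add_hom M M (\<lambda>m. \<Oplus>\<^bsub>M\<^esub>s\<in>I. tens (\<alpha> s) (Tr (mult_op (\<beta> s) \<odot>\<^bsub>M\<^esub> m)))"
    by (intro add_hom_finsum_fun M_abelian finite_I)
      (rule add_hom_comp[OF add_hom_comp[OF M_smult_add_hom[OF mult_op_DL] Tr(1)] tens_add_hom])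
  fix a x assume x: "x \<in> carrier N"
  have "(\<Oplus>\<^bsub>M\<^esub>s\<in>I. tens (\<alpha> s) (Tr (mult_op (\<beta> s) \<odot>\<^bsub>M\<^esub> tens a x))) =
      (\<Oplus>\<^bsub>M\<^esub>s\<in>I. tens (\<alpha> s * j (tr (\<beta> s * a))) x)"
    by (simp add: M_mult_op_tens x Tr(2) tens_balanced)
  also have "\<dots> = tens a x"
    by (simp add: tens_sum_left[symmetric] x dual_expansion)
  finally show "tens a x = (\<Oplus>\<^bsub>M\<^esub>s\<in>I. tens (\<alpha> s) (Tr (mult_op (\<beta> s) \<odot>\<^bsub>M\<^esub> tens a x)))" ..
qed

text \<open>The trace as a sum over the group, carried over to L \<otimes> N. It puts 1 \<otimes> Tr
  m into every \<open>sig\<close>-stable submodule that contains m.\<close>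

lemma tens_Tr:
  assumes m: "m \<in> carrier M"
  shows "tens 1 (Tr m) = (\<Oplus>\<^bsub>M\<^esub>r\<in>{..<p}. (sig ^^ r) m)"
proof (rule add_hom_eqI[OF add_hom_comp[OF Tr(1) tens_add_hom] _ _ m])
  show "add_hom M M (\<lambda>m. \<Oplus>\<^bsub>M\<^esub>r\<in>{..<p}. (sig ^^ r) m)"
    using sig_pow(1) by (intro add_hom_finsum_fun M_abelian) (simp_all add: eta_contract_eq)
  fix a x assume x: "x \<in> carrier N"
  have "tens 1 (Tr (tens a x)) = tens (1 * j (tr a)) x"
    by (simp add: Tr(2) x tens_balanced del: mult_1)
  also have "\<dots> = (\<Oplus>\<^bsub>M\<^esub>r\<in>{..<p}. tens ((\<sigma> ^^ r) a) x)"
    by (simp add: j_tr tens_sum_left x)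
  finally show "tens 1 (Tr (tens a x)) = (\<Oplus>\<^bsub>M\<^esub>r\<in>{..<p}. (sig ^^ r) (tens a x))"
    by (simp add: sig_pow(2) x)
qed

lemma M_zero_smult: "m \<in> carrier M \<Longrightarrow> mult_op 0 \<odot>\<^bsub>M\<^esub> m = \<zero>\<^bsub>M\<^esub>"
  using left_module.smult_l_distr[OF M_module mult_op_DL mult_op_DL, of m 0 0]
    M_smult_closed[OF mult_op_DL, of m 0] M.add.r_cancel_one'
  by (simp add: diff_op_ring_simps)

lemma M_finsum_const:
  assumes m: "m \<in> carrier M"
  shows "(\<Oplus>\<^bsub>M\<^esub>r\<in>{..<n}. m) = mult_op (of_nat n) \<odot>\<^bsub>M\<^esub> m"
proof (induction n)
  case 0
  show ?case using M_zero_smult[OF m] by simp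
next
  case (Suc n)
  have "mult_op (of_nat (Suc n)) \<odot>\<^bsub>M\<^esub> m = mult_op 1 \<odot>\<^bsub>M\<^esub> m \<oplus>\<^bsub>M\<^esub> mult_op (of_nat n) \<odot>\<^bsub>M\<^esub> m"
    using left_module.smult_l_distr[OF M_module mult_op_DL mult_op_DL m, of 1 "of_nat n"]
    by (simp add: diff_op_ring_simps distrib_right)
  moreover have "mult_op 1 \<odot>\<^bsub>M\<^esub> m = m"
    using left_module.smult_one[OF M_module m] by (simp add: diff_op_ring_simps id_def)
  ultimately show ?case using Suc m by (simp add: lessThan_Suc M.finsum_insert)
qed

definition inv_p :: 'a where "inv_p = 1 / of_nat p"

text \<open>Galois descent of vectors: if all translates of m coincide, \<open>tens_Tr\<close> reads
  1 \<otimes> Tr m = p m, and p is invertible in characteristic 0.\<close>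

lemma sig_fixed:
  assumes m: "m \<in> carrier M" and fixed: "sig m = m"
  shows "m = tens 1 (mult_op inv_p \<odot> Tr m)"
proof -
  have "j (of_nat n) = of_nat n" for n by (induction n) (auto simp: j_simps)
  then have jp: "j inv_p * of_nat p = 1"
    using p_pos by (metis j_simps(2,3) inv_p_def nonzero_eq_divide_eq of_nat_eq_0_iff less_numeral_extra(3))
  have Trm: "Tr m \<in> carrier N" by (rule add_hom_closed[OF Tr(1) m])
  have "(sig ^^ r) m = m" for r by (induction r) (auto simp: fixed)
  then have "tens 1 (Tr m) = mult_op (of_nat p) \<odot>\<^bsub>M\<^esub> m"
    using tens_Tr[OF m] M_finsum_const[OF m] by simp
  then have "mult_op (j inv_p) \<odot>\<^bsub>M\<^esub> tens 1 (Tr m) = (\<lambda>x. (j inv_p * of_nat p) * x) \<odot>\<^bsub>M\<^esub> m"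
    by (simp add: M_comp m mult.assoc)
  also have "\<dots> = m"
    unfolding jp using left_module.smult_one[OF M_module m] by (simp add: diff_op_ring_simps id_def)
  also have "mult_op (j inv_p) \<odot>\<^bsub>M\<^esub> tens 1 (Tr m) = tens (1 * j inv_p) (Tr m)"
    by (simp add: M_mult_op_tens Trm)
  finally show ?thesis by (simp add: tens_balanced Trm del: mult_1)
qed

lemma Tr_tens_1: "x \<in> carrier N \<Longrightarrow> mult_op inv_p \<odot> Tr (tens 1 x) = x"
  using N_smult(4)[OF mult_op_DK mult_op_DK, of x inv_p "of_nat p"] p_pos
  by (simp add: Tr(2) tr_1 inv_p_def N_smult(5))

lemma tens_1_inj: "x \<in> carrier N \<Longrightarrow> y \<in> carrier N \<Longrightarrow> tens 1 x = tens 1 y \<Longrightarrow> x = y"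
  using Tr_tens_1 by metis

lemma tens_mult: "x \<in> carrier N \<Longrightarrow> tens l x = mult_op l \<odot>\<^bsub>M\<^esub> tens 1 x"
  by (simp add: M_mult_op_tens)

lemma extend_smult:
  assumes "R \<in> carrier DL" "P \<in> carrier DK" "R \<circ> j = j \<circ> P" "x \<in> carrier N"
  shows "R \<odot>\<^bsub>M\<^esub> tens 1 x = tens 1 (P \<odot> x)"
  using assms(3) by (intro M_smult_tens_eq1 assms) (simp add: fun_eq_iff)

end

section \<open>Cyclic descent\<close>

lemma root_of_unity_sum:
  fixes z :: "'k::field_char_0"
  assumes "z ^ p = 1"
  shows "(\<Sum>s<p. z ^ s) = (if z = 1 then of_nat p else 0)"
proof (cases "z = 1")
  case False
  have "(1 - z) * (\<Sum>s<p. z ^ s) = 1 - z ^ p" by (rule one_diff_power_eq[symmetric])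
  then show ?thesis using False assms by simp
qed simp

text \<open>A root of 1 + X + ... + X^(p-1); it is not 1, where this polynomial has the value
  p.\<close>

lemma root_of_unity_exists:
  assumes "1 < p"
  shows "\<exists>z :: 'k::{alg_closed_field, field_char_0}. z ^ p = 1 \<and> z \<noteq> 1"
proof -
  obtain z :: 'k where z: "(\<Sum>s\<le>p - 1. z ^ s) = 0"
    using alg_closed[of "p - 1" "\<lambda>_. 1 :: 'k"] assms by auto
  have sum: "(\<Sum>s<p. z ^ s) = 0" using z assms by (simp add: lessThan_Suc_atMost[symmetric])
  have "1 - z ^ p = (1 - z) * (\<Sum>s<p. z ^ s)" by (rule one_diff_power_eq)
  then have "z ^ p = 1" using sum by simp
  moreover have "z \<noteq> 1" using sum assms by auto
  ultimately show ?thesis by blast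
qed

text \<open>Otherwise r is invertible modulo the prime p, and a multiple of r that is 1 modulo p
  turns \<open>z ^ r = 1\<close> into z = 1.\<close>

lemma root_of_unity_pow_eq_1:
  fixes z :: "'k::field"
  assumes p: "Factorial_Ring.prime (p :: nat)" and z: "z ^ p = 1" "z \<noteq> 1" and r: "z ^ r = 1"
  shows "p dvd r"
proof (rule ccontr)
  assume "\<not> p dvd r"
  then have "coprime r p" using p by (metis prime_imp_coprime coprime_commute)
  then have "gcd r p = 1" by simp
  moreover have "r \<noteq> 0" using \<open>\<not> p dvd r\<close> by (metis dvd_0_right)
  ultimately obtain x y where "r * x = p * y + 1" using bezout_nat[of r p] by auto
  then have "z ^ (r * x) = z ^ (p * y) * z" by simp
  then show False using r z by (simp add: power_mult)
qed

lemma (in left_module) smult_add_hom: "a \<in> carrier R \<Longrightarrow> add_hom M M (\<lambda>x. a \<odot>\<^bsub>M\<^esub> x)"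
  by (rule add_homI) (auto simp: smult_closed smult_r_distr)

lemma (in left_module) zero_smult: "x \<in> carrier M \<Longrightarrow> \<zero> \<odot>\<^bsub>M\<^esub> x = \<zero>\<^bsub>M\<^esub>"
  using smult_l_distr[of "\<zero>" "\<zero>" x] M.add.r_cancel_one'[of "\<zero> \<odot>\<^bsub>M\<^esub> x" "\<zero> \<odot>\<^bsub>M\<^esub> x"]
  by (simp add: smult_closed)

lemma (in left_module) minus_one_smult:
  assumes "x \<in> carrier M"
  shows "(\<ominus> \<one>) \<odot>\<^bsub>M\<^esub> x = \<ominus>\<^bsub>M\<^esub> x"
  using smult_l_distr[of "\<ominus> \<one>" "\<one>" x] assms
  by (intro M.minus_equality[symmetric]) (auto simp: smult_closed smult_one R.l_neg zero_smult)

lemma (in left_module) submodule_iff: "submodule W R M \<longleftrightarrow> W \<subseteq> carrier M \<and> \<zero>\<^bsub>M\<^esub> \<in> W \<and>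
    (\<forall>x\<in>W. \<forall>y\<in>W. x \<oplus>\<^bsub>M\<^esub> y \<in> W) \<and> (\<forall>a\<in>carrier R. \<forall>x\<in>W. a \<odot>\<^bsub>M\<^esub> x \<in> W)"
proof
  assume W: "submodule W R M"
  interpret submodule W R M by fact
  show "W \<subseteq> carrier M \<and> \<zero>\<^bsub>M\<^esub> \<in> W \<and>
    (\<forall>x\<in>W. \<forall>y\<in>W. x \<oplus>\<^bsub>M\<^esub> y \<in> W) \<and> (\<forall>a\<in>carrier R. \<forall>x\<in>W. a \<odot>\<^bsub>M\<^esub> x \<in> W)"
    using subset one_closed m_closed smult_closed by auto
next
  assume W: "W \<subseteq> carrier M \<and> \<zero>\<^bsub>M\<^esub> \<in> W \<and>
    (\<forall>x\<in>W. \<forall>y\<in>W. x \<oplus>\<^bsub>M\<^esub> y \<in> W) \<and> (\<forall>a\<in>carrier R. \<forall>x\<in>W. a \<odot>\<^bsub>M\<^esub> x \<in> W)"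
  have "\<ominus>\<^bsub>M\<^esub> x \<in> W" if "x \<in> W" for x
  proof -
    have "(\<ominus> \<one>) \<odot>\<^bsub>M\<^esub> x \<in> W" using W that by blast
    moreover have "x \<in> carrier M" using W that by blast
    ultimately show ?thesis by (simp add: minus_one_smult)
  qed
  then show "submodule W R M"
    using W by (intro submodule.intro subgroup.intro submodule_axioms.intro) (auto simp: a_inv_def)
qed

lemma (in left_module) submoduleD:
  assumes "submodule W R M"
  shows "W \<subseteq> carrier M" "\<zero>\<^bsub>M\<^esub> \<in> W" "x \<in> W \<Longrightarrow> x \<in> carrier M" "x \<in> W \<Longrightarrow> y \<in> W \<Longrightarrow> x \<oplus>\<^bsub>M\<^esub> y \<in> W"
    "a \<in> carrier R \<Longrightarrow> x \<in> W \<Longrightarrow> a \<odot>\<^bsub>M\<^esub> x \<in> W" "x \<in> W \<Longrightarrow> \<ominus>\<^bsub>M\<^esub> x \<in> W"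
proof -
  show *: "W \<subseteq> carrier M" "\<zero>\<^bsub>M\<^esub> \<in> W" "x \<in> W \<Longrightarrow> x \<in> carrier M" "x \<in> W \<Longrightarrow> y \<in> W \<Longrightarrow> x \<oplus>\<^bsub>M\<^esub> y \<in> W"
    "a \<in> carrier R \<Longrightarrow> x \<in> W \<Longrightarrow> a \<odot>\<^bsub>M\<^esub> x \<in> W"
    using assms unfolding submodule_iff by auto
  show "\<ominus>\<^bsub>M\<^esub> x \<in> W" if "x \<in> W"
  proof -
    have "(\<ominus> \<one>) \<odot>\<^bsub>M\<^esub> x \<in> W" using assms that unfolding submodule_iff by blast
    moreover have "x \<in> carrier M" using assms that unfolding submodule_iff by blast
    ultimately show ?thesis by (simp add: minus_one_smult)
  qed
qed

lemma (in left_module) submodule_finsum: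
  assumes "submodule W R M" "finite A" "\<And>s. s \<in> A \<Longrightarrow> g s \<in> W"
  shows "(\<Oplus>\<^bsub>M\<^esub>s\<in>A. g s) \<in> W"
  using assms(2,3)
proof (induction A)
  case (insert s A)
  then show ?case using submoduleD(3,4)[OF assms(1)] by (subst M.finsum_insert) auto
qed (simp add: submoduleD(2)[OF assms(1)])

text \<open>What the splitting argument uses, free of operators and tensors: \<tau> is semilinear
  through \<open>tw\<close>, k acts through \<open>\<kappa>\<close>, and the descent from M to N is
  condensed into \<open>irreducible\<close> and \<open>schur\<close>. The finite set in
  \<open>fin_gen\<close> lies in no proper submodule.\<close>

locale cyclic_descent =
  fixes D :: "('d, 'u) ring_scheme" and M :: "('d, 'm, 'v) module_scheme" (structure)
    and \<tau> :: "'m \<Rightarrow> 'm" and tw :: "'d \<Rightarrow> 'd"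
    and \<kappa> :: "'k::{alg_closed_field, field_char_0} \<Rightarrow> 'd" and p :: nat
  assumes M_left_module: "left_module D M"
    and prime_p: "Factorial_Ring.prime p"
    and \<tau>_hom: "add_hom M M \<tau>"
    and \<tau>_pow_p: "m \<in> carrier M \<Longrightarrow> (\<tau> ^^ p) m = m"
    and tw_closed: "Q \<in> carrier D \<Longrightarrow> tw Q \<in> carrier D"
    and \<tau>_smult: "Q \<in> carrier D \<Longrightarrow> m \<in> carrier M \<Longrightarrow> \<tau> (Q \<odot> m) = tw Q \<odot> \<tau> m"
    and \<kappa>_closed: "\<kappa> a \<in> carrier D"
    and \<kappa>_add: "m \<in> carrier M \<Longrightarrow> \<kappa> (a + b) \<odot> m = \<kappa> a \<odot> m \<oplus> \<kappa> b \<odot> m"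
    and \<kappa>_mult: "m \<in> carrier M \<Longrightarrow> \<kappa> (a * b) \<odot> m = \<kappa> a \<odot> (\<kappa> b \<odot> m)"
    and \<kappa>_one: "m \<in> carrier M \<Longrightarrow> \<kappa> 1 \<odot> m = m"
    and \<kappa>_smult: "Q \<in> carrier D \<Longrightarrow> m \<in> carrier M \<Longrightarrow> Q \<odot> (\<kappa> a \<odot> m) = \<kappa> a \<odot> (Q \<odot> m)"
    and \<tau>_\<kappa>: "m \<in> carrier M \<Longrightarrow> \<tau> (\<kappa> a \<odot> m) = \<kappa> a \<odot> \<tau> m"
    and nonzero: "carrier M \<noteq> {\<zero>}"
    and irreducible: "submodule W D M \<Longrightarrow> \<tau> ` W \<subseteq> W \<Longrightarrow> W = {\<zero>} \<or> W = carrier M"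
    and schur: "\<lbrakk>add_hom M M f; \<And>Q m. Q \<in> carrier D \<Longrightarrow> m \<in> carrier M \<Longrightarrow> f (Q \<odot> m) = Q \<odot> f m;
      \<And>m. m \<in> carrier M \<Longrightarrow> f (\<tau> m) = \<tau> (f m)\<rbrakk> \<Longrightarrow> \<exists>a. \<forall>m\<in>carrier M. f m = \<kappa> a \<odot> m"
    and fin_gen: "\<exists>B. finite B \<and> B \<subseteq> carrier M \<and> (\<forall>W. submodule W D M \<longrightarrow> B \<subseteq> W \<longrightarrow> W = carrier M)"
begin

sublocale left_module D M by (rule M_left_module)

abbreviation "sc a m \<equiv> \<kappa> a \<odot> m"

lemma M_ab: "abelian_group M" by (rule M.abelian_group_axioms)

lemma p_gt_1: "1 < p" by (rule prime_gt_1_nat[OF prime_p])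

lemma sc_closed [simp]: "m \<in> carrier M \<Longrightarrow> sc a m \<in> carrier M"
  by (simp add: smult_closed \<kappa>_closed)

lemma sc_hom: "add_hom M M (sc a)"
  by (rule smult_add_hom[OF \<kappa>_closed])

lemma smult_zero [simp]: "Q \<in> carrier D \<Longrightarrow> Q \<odot> \<zero> = \<zero>"
  by (rule add_hom_zero[OF M_ab M_ab smult_add_hom])

lemma sc_zero [simp]: "sc a \<zero> = \<zero>"
  by (rule smult_zero[OF \<kappa>_closed])

lemma sc_0 [simp]: "m \<in> carrier M \<Longrightarrow> sc 0 m = \<zero>"
  using \<kappa>_add[of m 0 0] M.add.r_cancel_one'[of "sc 0 m" "sc 0 m"] by simp

lemma sc_eq_zero: "m \<in> carrier M \<Longrightarrow> a \<noteq> 0 \<Longrightarrow> sc a m = \<zero> \<Longrightarrow> m = \<zero>"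
  using \<kappa>_mult[of m "inverse a" a] by (simp add: \<kappa>_one)

lemma sc_sum: "finite A \<Longrightarrow> m \<in> carrier M \<Longrightarrow> sc (\<Sum>s\<in>A. f s) m = (\<Oplus>s\<in>A. sc (f s) m)"
  by (induction A rule: finite_induct) (simp_all add: \<kappa>_add M.finsum_insert)

lemma sc_finsum: "finite A \<Longrightarrow> (\<And>s. s \<in> A \<Longrightarrow> g s \<in> carrier M) \<Longrightarrow>
    sc a (\<Oplus>s\<in>A. g s) = (\<Oplus>s\<in>A. sc a (g s))"
  by (rule add_hom_finsum[OF M_ab M_ab sc_hom])

lemma \<tau>_pow_hom: "add_hom M M (\<tau> ^^ n)"
proof (induction n)
  case (Suc n)
  then show ?case using add_hom_comp[OF Suc \<tau>_hom] by (simp add: comp_def)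
qed (auto intro: add_homI)

lemma \<tau>_pow_closed [simp]: "m \<in> carrier M \<Longrightarrow> (\<tau> ^^ n) m \<in> carrier M"
  by (rule add_hom_closed[OF \<tau>_pow_hom])

lemma \<tau>_closed [simp]: "m \<in> carrier M \<Longrightarrow> \<tau> m \<in> carrier M"
  by (rule add_hom_closed[OF \<tau>_hom])

lemma tw_pow_closed: "Q \<in> carrier D \<Longrightarrow> (tw ^^ n) Q \<in> carrier D"
  by (induction n) (auto simp: tw_closed)

lemma \<tau>_pow_smult:
  "Q \<in> carrier D \<Longrightarrow> m \<in> carrier M \<Longrightarrow> (\<tau> ^^ n) (Q \<odot> m) = (tw ^^ n) Q \<odot> (\<tau> ^^ n) m"
  by (induction n) (auto simp: \<tau>_smult tw_pow_closed)

lemma \<tau>_pow_mult_p: "m \<in> carrier M \<Longrightarrow> (\<tau> ^^ (p * n)) m = m"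
  by (induction n) (auto simp: funpow_add \<tau>_pow_p)

lemma \<tau>_pow_zero: "(\<tau> ^^ n) \<zero> = \<zero>"
  by (rule add_hom_zero[OF M_ab M_ab \<tau>_pow_hom])

text \<open>In exponents of \<tau>, \<open>(p - 1) * n\<close> stands for -n; unlike
  \<open>p - n\<close> it does so for every natural number n.\<close>

lemma \<tau>_pow_cancel: "m \<in> carrier M \<Longrightarrow> (\<tau> ^^ n) ((\<tau> ^^ ((p - 1) * n)) m) = m"
proof -
  have "n + (p - 1) * n = p * n" using p_gt_1 by (simp add: diff_mult_distrib)
  then show "m \<in> carrier M \<Longrightarrow> ?thesis" using \<tau>_pow_mult_p[of m n]
    by (simp del: One_nat_def flip: funpow_add comp_apply[of "\<tau> ^^ n"])
qed

lemma \<tau>_pow_cancel': "m \<in> carrier M \<Longrightarrow> (\<tau> ^^ ((p - 1) * n)) ((\<tau> ^^ n) m) = m"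
proof -
  have "(p - 1) * n + n = p * n" using p_gt_1 by (simp add: diff_mult_distrib)
  then show "m \<in> carrier M \<Longrightarrow> ?thesis" using \<tau>_pow_mult_p[of m n]
    by (simp del: One_nat_def flip: funpow_add comp_apply[of "\<tau> ^^ ((p - 1) * n)"])
qed

lemma submodule_vimage:
  assumes W: "submodule W D M"
  shows "submodule {m \<in> carrier M. (\<tau> ^^ n) m \<in> W} D M"
  unfolding submodule_iff
  by (auto simp: \<tau>_pow_zero add_hom_add[OF \<tau>_pow_hom] \<tau>_pow_smult smult_closed tw_pow_closed
      intro: submoduleD[OF W])

definition lin :: "('m \<Rightarrow> 'm) \<Rightarrow> bool" where
  "lin f \<longleftrightarrow> add_hom M M f \<and> (\<forall>Q\<in>carrier D. \<forall>m\<in>carrier M. f (Q \<odot> m) = Q \<odot> f m)"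

lemma linI:
  "(\<And>m. m \<in> carrier M \<Longrightarrow> f m \<in> carrier M) \<Longrightarrow>
   (\<And>x y. x \<in> carrier M \<Longrightarrow> y \<in> carrier M \<Longrightarrow> f (x \<oplus> y) = f x \<oplus> f y) \<Longrightarrow>
   (\<And>Q m. Q \<in> carrier D \<Longrightarrow> m \<in> carrier M \<Longrightarrow> f (Q \<odot> m) = Q \<odot> f m) \<Longrightarrow> lin f"
  by (auto simp: lin_def add_hom_def)

lemma linD:
  assumes "lin f"
  shows "add_hom M M f" "m \<in> carrier M \<Longrightarrow> f m \<in> carrier M"
    "x \<in> carrier M \<Longrightarrow> y \<in> carrier M \<Longrightarrow> f (x \<oplus> y) = f x \<oplus> f y"
    "Q \<in> carrier D \<Longrightarrow> m \<in> carrier M \<Longrightarrow> f (Q \<odot> m) = Q \<odot> f m"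
    "m \<in> carrier M \<Longrightarrow> f (sc a m) = sc a (f m)" "f \<zero> = \<zero>"
  using assms add_hom_zero[OF M_ab M_ab, of f] by (auto simp: lin_def add_hom_def \<kappa>_closed)

lemma lin_finsum: "lin f \<Longrightarrow> finite A \<Longrightarrow> (\<And>s. s \<in> A \<Longrightarrow> g s \<in> carrier M) \<Longrightarrow>
    f (\<Oplus>s\<in>A. g s) = (\<Oplus>s\<in>A. f (g s))"
  by (rule add_hom_finsum[OF M_ab M_ab linD(1)])

lemma lin_comp: "lin f \<Longrightarrow> lin g \<Longrightarrow> lin (\<lambda>m. f (g m))"
  by (rule linI) (auto simp: linD)

lemma lin_pow: "lin f \<Longrightarrow> lin (f ^^ n)"
proof (induction n)
  case (Suc n)
  then show ?case using lin_comp[OF Suc.prems Suc.IH[OF Suc.prems]] by (simp add: comp_def)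
qed (auto intro: linI)

lemma lin_sc: "lin (sc a)"
  by (rule linI) (auto simp: smult_r_distr \<kappa>_closed \<kappa>_smult)

lemma lin_finsum_fun:
  assumes "finite A" "\<And>s. s \<in> A \<Longrightarrow> lin (f s)"
  shows "lin (\<lambda>m. \<Oplus>s\<in>A. f s m)"
proof -
  have hom: "add_hom M M (\<lambda>m. \<Oplus>s\<in>A. f s m)"
    by (rule add_hom_finsum_fun[OF M_ab assms(1)]) (use assms(2) linD(1) in blast)
  have cl: "f s m \<in> carrier M" if "s \<in> A" "m \<in> carrier M" for s m using assms(2) that linD(2) by blast
  have "(\<Oplus>s\<in>A. f s (Q \<odot> m)) = Q \<odot> (\<Oplus>s\<in>A. f s m)" if "Q \<in> carrier D" "m \<in> carrier M" for Q m
  proof -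
    have "Q \<odot> (\<Oplus>s\<in>A. f s m) = (\<Oplus>s\<in>A. Q \<odot> f s m)"
      by (rule add_hom_finsum[OF M_ab M_ab smult_add_hom[OF that(1)] assms(1)]) (simp add: cl that)
    also have "\<dots> = (\<Oplus>s\<in>A. f s (Q \<odot> m))"
      by (rule M.finsum_cong') (use that assms(2) cl in \<open>auto simp: linD smult_closed\<close>)
    finally show ?thesis ..
  qed
  then show ?thesis using hom by (simp add: lin_def)
qed

lemma lin_kernel: "lin f \<Longrightarrow> submodule {m \<in> carrier M. f m = \<zero>} D M"
  unfolding submodule_iff by (auto simp: linD smult_closed)

lemma lin_eigenspace: "lin f \<Longrightarrow> submodule {m \<in> carrier M. f m = sc a m} D M"
  unfolding submodule_iff by (auto simp: linD smult_closed smult_r_distr \<kappa>_closed \<kappa>_smult)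

text \<open>The discrete Fourier transform of a sequence of period \<open>p\<close>.\<close>

definition dft :: "'k \<Rightarrow> (nat \<Rightarrow> 'm) \<Rightarrow> nat \<Rightarrow> 'm" where
  "dft \<omega> h r = sc (1 / of_nat p) (\<Oplus>s\<in>{..<p}. sc (inverse \<omega> ^ (r * s)) (h s))"

lemma pow_nonzero: "x ^ p \<noteq> 0 \<Longrightarrow> (x :: 'k) \<noteq> 0"
  using p_gt_1 by (auto simp: power_0_left)

lemma p_nonzero: "(of_nat p :: 'k) \<noteq> 0"
  using p_gt_1 by simp

text \<open>Fourier inversion at 0: summing over r first leaves geometric sums that vanish unless s
  = 0. This requires \<omega> to be primitive, which it is because p is prime. The residue 0 is
  represented by r = p.\<close>

lemma dft_sum:
  assumes \<omega>: "\<omega> ^ p = 1" "\<omega> \<noteq> 1" and h: "\<And>s. h s \<in> carrier M"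
  shows "(\<Oplus>r\<in>{1..p}. dft \<omega> h r) = h 0"
proof -
  have w: "(\<Sum>r\<in>{1..p}. inverse \<omega> ^ (r * s)) = (if s = 0 then of_nat p else 0)" if "s < p" for s
  proof -
    define z where "z = inverse \<omega> ^ s"
    have "z ^ p = (inverse \<omega> ^ p) ^ s" by (simp add: z_def flip: power_mult) (simp add: mult.commute)
    then have zp: "z ^ p = 1" using \<omega> by (simp add: power_inverse)
    have "(\<Sum>r\<in>{1..p}. inverse \<omega> ^ (r * s)) = (\<Sum>r\<in>{1..p}. z ^ r)"
      by (simp add: z_def mult.commute flip: power_mult)
    also have "\<dots> = (\<Sum>r<p. z ^ Suc r)"
      by (rule sum.reindex_bij_witness[of _ Suc "\<lambda>r. r - 1"]) auto
    also have "\<dots> = z * (\<Sum>r<p. z ^ r)" by (simp add: sum_distrib_left)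
    also have "\<dots> = (if z = 1 then of_nat p else 0)" using root_of_unity_sum[OF zp] by simp
    also have "z = 1 \<longleftrightarrow> s = 0"
    proof
      assume "z = 1"
      then have "\<omega> ^ s = 1" by (simp add: z_def power_inverse)
      then show "s = 0" using root_of_unity_pow_eq_1[OF prime_p \<omega>] that by (metis dvd_imp_le not_gr0 not_le)
    qed (simp add: z_def)
    finally show ?thesis .
  qed
  have "(\<Oplus>r\<in>{1..p}. dft \<omega> h r) =
      sc (1 / of_nat p) (\<Oplus>r\<in>{1..p}. \<Oplus>s\<in>{..<p}. sc (inverse \<omega> ^ (r * s)) (h s))"
    unfolding dft_def by (rule sc_finsum[symmetric]) (auto intro!: M.finsum_closed simp: h)
  also have "(\<Oplus>r\<in>{1..p}. \<Oplus>s\<in>{..<p}. sc (inverse \<omega> ^ (r * s)) (h s)) =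
      (\<Oplus>s\<in>{..<p}. \<Oplus>r\<in>{1..p}. sc (inverse \<omega> ^ (r * s)) (h s))"
    by (rule M.finsum_swap) (auto simp: h)
  also have "\<dots> = (\<Oplus>s\<in>{..<p}. if 0 = s then sc (of_nat p) (h 0) else \<zero>)"
    by (rule M.finsum_cong') (auto simp: h sc_sum[symmetric] w simp del: One_nat_def)
  also have "\<dots> = sc (of_nat p) (h 0)"
    by (rule M.finsum_singleton) (use p_gt_1 h in auto)
  finally show ?thesis using p_nonzero h by (simp add: \<kappa>_mult[symmetric] \<kappa>_one)
qed

text \<open>Replacing s by s + 1 costs a factor \<open>\<omega> ^ r\<close>, and by periodicity the
  shifted sum wraps around. So the transform at r is an eigenvector of any operation that shifts the
  sequence.\<close>

lemma dft_shift:
  assumes \<omega>: "\<omega> ^ p = 1" and h: "\<And>s. h s \<in> carrier M" "h p = h 0"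
  shows "dft \<omega> (\<lambda>s. h (Suc s)) r = sc (\<omega> ^ r) (dft \<omega> h r)"
proof -
  have \<omega>0: "\<omega> \<noteq> 0" using \<omega> pow_nonzero[of \<omega>] by simp
  define g where "g s = sc (inverse \<omega> ^ (r * s)) (h s)" for s
  have g: "g s \<in> carrier M" for s by (simp add: g_def h)
  have "inverse \<omega> ^ (r * p) = (inverse \<omega> ^ p) ^ r" by (simp add: mult.commute flip: power_mult)
  then have "g p = g 0" using \<omega> by (simp add: g_def h power_inverse)
  have "sc (inverse \<omega> ^ (r * s)) (h (Suc s)) = sc (\<omega> ^ r) (g (Suc s))" for s
  proof -
    have "inverse \<omega> ^ (r * s) = \<omega> ^ r * inverse \<omega> ^ (r * Suc s)"
      using \<omega>0 by (simp add: power_add power_inverse field_simps)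
    then show ?thesis by (simp only: g_def \<kappa>_mult[OF h(1)])
  qed
  then have "dft \<omega> (\<lambda>s. h (Suc s)) r = sc (1 / of_nat p) (\<Oplus>s\<in>{..<p}. sc (\<omega> ^ r) (g (Suc s)))"
    by (simp add: dft_def)
  also have "(\<Oplus>s\<in>{..<p}. sc (\<omega> ^ r) (g (Suc s))) = sc (\<omega> ^ r) (\<Oplus>s\<in>{..<p}. g (Suc s))"
    by (rule sc_finsum[symmetric]) (auto simp: g)
  also have "(\<Oplus>s\<in>{..<p}. g (Suc s)) = (\<Oplus>s\<in>{..<p}. g s)"
  proof -
    obtain q where q: "p = Suc q" using p_gt_1 by (metis less_imp_Suc_add)
    have "(\<Oplus>s\<in>{..<p}. g (Suc s)) = g (Suc q) \<oplus> (\<Oplus>s\<in>{..<q}. g (Suc s))"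
      unfolding q by (simp add: lessThan_Suc M.finsum_insert g)
    also have "(\<Oplus>s\<in>{..<q}. g (Suc s)) = (\<Oplus>s\<in>Suc ` {..<q}. g s)"
      by (rule M.finsum_reindex[symmetric]) (auto simp: g)
    also have "g (Suc q) \<oplus> \<dots> = (\<Oplus>s\<in>insert 0 (Suc ` {..<q}). g s)"
      using \<open>g p = g 0\<close> by (subst M.finsum_insert) (auto simp: g q)
    also have "insert 0 (Suc ` {..<q}) = {..<p}" by (auto simp: q image_iff less_Suc_eq_0_disj)
    finally show ?thesis .
  qed
  also have "sc (1 / of_nat p) (sc (\<omega> ^ r) (\<Oplus>s\<in>{..<p}. g s)) = sc (\<omega> ^ r) (dft \<omega> h r)"
    by (simp add: dft_def g_def[symmetric] \<kappa>_smult[OF \<kappa>_closed] g)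
  finally show ?thesis .
qed

lemma dft_hom:
  assumes f: "add_hom M M f" "\<And>a m. m \<in> carrier M \<Longrightarrow> f (sc a m) = sc a (f m)"
    and h: "\<And>s. h s \<in> carrier M"
  shows "f (dft \<omega> h r) = dft \<omega> (\<lambda>s. f (h s)) r"
proof -
  have "f (\<Oplus>s\<in>{..<p}. sc (inverse \<omega> ^ (r * s)) (h s)) =
      (\<Oplus>s\<in>{..<p}. f (sc (inverse \<omega> ^ (r * s)) (h s)))"
    by (rule add_hom_finsum[OF M_ab M_ab f(1)]) (auto simp: h)
  also have "\<dots> = (\<Oplus>s\<in>{..<p}. sc (inverse \<omega> ^ (r * s)) (f (h s)))"
    by (rule M.finsum_cong') (auto simp: h f(2) add_hom_closed[OF f(1)])
  finally show ?thesis by (simp add: dft_def f(2) h)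
qed

lemma lin_dft: "(\<And>s. lin (h s)) \<Longrightarrow> lin (\<lambda>m. dft \<omega> (\<lambda>s. h s m) r)"
  unfolding dft_def
  by (rule lin_comp[OF lin_sc lin_finsum_fun]) (auto intro!: lin_comp[OF lin_sc])

text \<open>The projection of f to the endomorphisms that conjugation by \<tau> multiplies by
  \<open>\<omega> ^ r\<close>; the power \<open>(p - 1) * s\<close> of \<tau> is the inverse of the
  power s.\<close>

definition component :: "'k \<Rightarrow> ('m \<Rightarrow> 'm) \<Rightarrow> nat \<Rightarrow> 'm \<Rightarrow> 'm" where
  "component \<omega> f r m = dft \<omega> (\<lambda>s. (\<tau> ^^ s) (f ((\<tau> ^^ ((p - 1) * s)) m))) r"

text \<open>The twists of the scalar by \<tau>^s and by its inverse cancel. No relation between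
  powers of \<open>tw\<close> is assumed, so the twisted scalar is drawn back through the same power
  of \<tau>, with f's value written as that power of \<tau> applied to x.\<close>

lemma lin_conj: "lin f \<Longrightarrow> lin (\<lambda>m. (\<tau> ^^ s) (f ((\<tau> ^^ ((p - 1) * s)) m)))"
proof (rule linI)
  assume f: "lin f"
  note closed = linD(2)[OF f]
  show "(\<tau> ^^ s) (f ((\<tau> ^^ ((p - 1) * s)) m)) \<in> carrier M" if "m \<in> carrier M" for m
    using that by (simp add: closed)
  show "(\<tau> ^^ s) (f ((\<tau> ^^ ((p - 1) * s)) (x \<oplus> y))) =
      (\<tau> ^^ s) (f ((\<tau> ^^ ((p - 1) * s)) x)) \<oplus> (\<tau> ^^ s) (f ((\<tau> ^^ ((p - 1) * s)) y))"
    if "x \<in> carrier M" "y \<in> carrier M" for x y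
    using that by (simp add: add_hom_add[OF \<tau>_pow_hom] linD(3)[OF f] closed)
  fix Q m assume Q: "Q \<in> carrier D" and m: "m \<in> carrier M"
  define x where "x = (\<tau> ^^ s) (f ((\<tau> ^^ ((p - 1) * s)) m))"
  have x: "x \<in> carrier M" using m by (simp add: x_def closed)
  have "(\<tau> ^^ s) (f ((\<tau> ^^ ((p - 1) * s)) (Q \<odot> m))) =
      (\<tau> ^^ s) ((tw ^^ ((p - 1) * s)) Q \<odot> f ((\<tau> ^^ ((p - 1) * s)) m))"
    using Q m by (simp add: \<tau>_pow_smult linD(4)[OF f] tw_pow_closed)
  also have "f ((\<tau> ^^ ((p - 1) * s)) m) = (\<tau> ^^ ((p - 1) * s)) x"
    using m by (simp add: x_def \<tau>_pow_cancel' closed del: One_nat_def)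
  also have "(tw ^^ ((p - 1) * s)) Q \<odot> (\<tau> ^^ ((p - 1) * s)) x = (\<tau> ^^ ((p - 1) * s)) (Q \<odot> x)"
    using Q x by (simp add: \<tau>_pow_smult)
  also have "(\<tau> ^^ s) \<dots> = Q \<odot> x"
    using Q x by (simp add: \<tau>_pow_cancel smult_closed del: One_nat_def)
  finally show "(\<tau> ^^ s) (f ((\<tau> ^^ ((p - 1) * s)) (Q \<odot> m))) =
      Q \<odot> (\<tau> ^^ s) (f ((\<tau> ^^ ((p - 1) * s)) m))"
    by (simp add: x_def)
qed

lemma lin_component: "lin f \<Longrightarrow> lin (component \<omega> f r)"
  unfolding component_def[abs_def] by (rule lin_dft) (rule lin_conj)

text \<open>Applying \<tau> to the s-th conjugate of f at m gives the conjugate with index s + 1 at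
  \<tau> m, so \<open>dft_shift\<close> applies.\<close>

lemma component_\<tau>:
  assumes \<omega>: "\<omega> ^ p = 1" and f: "lin f" and m: "m \<in> carrier M"
  shows "\<tau> (component \<omega> f r m) = sc (\<omega> ^ r) (component \<omega> f r (\<tau> m))"
proof -
  define h where "h s = (\<tau> ^^ s) (f ((\<tau> ^^ ((p - 1) * s)) (\<tau> m)))" for s
  have h: "h s \<in> carrier M" for s using m by (simp add: h_def linD(2)[OF f])
  have "\<tau> ((\<tau> ^^ s) (f ((\<tau> ^^ ((p - 1) * s)) m))) = h (Suc s)" for s
  proof -
    have eq: "(p - 1) * Suc s + 1 = (p - 1) * s + p" using p_gt_1 by simp
    have "(\<tau> ^^ ((p - 1) * Suc s)) (\<tau> m) = (\<tau> ^^ ((p - 1) * Suc s)) ((\<tau> ^^ 1) m)"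
      by simp
    also have "\<dots> = (\<tau> ^^ ((p - 1) * Suc s + 1)) m"
      by (simp only: funpow_add comp_apply)
    also have "\<dots> = (\<tau> ^^ ((p - 1) * s)) ((\<tau> ^^ p) m)"
      by (simp only: eq funpow_add comp_apply)
    finally show ?thesis using m by (simp add: h_def \<tau>_pow_p del: One_nat_def mult_Suc_right)
  qed
  then have "\<tau> (component \<omega> f r m) = dft \<omega> (\<lambda>s. h (Suc s)) r"
    unfolding component_def using m linD(2)[OF f] by (subst dft_hom[OF \<tau>_hom]) (auto simp: \<tau>_\<kappa>)
  also have "\<dots> = sc (\<omega> ^ r) (dft \<omega> h r)"
  proof (rule dft_shift[OF \<omega> h])
    have "(\<tau> ^^ ((p - 1) * p)) (\<tau> m) = \<tau> m" using \<tau>_pow_mult_p[of "\<tau> m" "p - 1"] m by (simp add: mult.commute)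
    then show "h p = h 0" using m linD(2)[OF f] by (simp add: h_def \<tau>_pow_p)
  qed
  finally show ?thesis by (simp add: component_def h_def[abs_def] del: One_nat_def)
qed

lemma component_sum:
  assumes \<omega>: "\<omega> ^ p = 1" "\<omega> \<noteq> 1" and f: "lin f" and m: "m \<in> carrier M"
  shows "(\<Oplus>r\<in>{1..p}. component \<omega> f r m) = f m"
  unfolding component_def using m linD(2)[OF f] by (subst dft_sum[OF \<omega>]) auto

definition scalar :: "('m \<Rightarrow> 'm) \<Rightarrow> bool" where
  "scalar f \<longleftrightarrow> (\<exists>a. \<forall>m\<in>carrier M. f m = sc a m)"

lemma lin_commute_scalar:
  "lin f \<Longrightarrow> (\<And>m. m \<in> carrier M \<Longrightarrow> f (\<tau> m) = \<tau> (f m)) \<Longrightarrow> scalar f"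
  unfolding scalar_def by (rule schur) (auto simp: linD)

text \<open>If the components with 1 \<le> r < p all vanished, f would be its component at r = p,
  which commutes with \<tau> and so is scalar. For the other r the eigenvalue
  \<open>\<omega> ^ r\<close> is not 1, as p is prime.\<close>

lemma nonscalar_eigenvector:
  assumes f: "lin f" "\<not> scalar f"
  obtains \<omega> e where "\<omega> ^ p = 1" "\<omega> \<noteq> 1" "lin e" "\<exists>m\<in>carrier M. e m \<noteq> \<zero>"
    "\<And>m. m \<in> carrier M \<Longrightarrow> \<tau> (e m) = sc \<omega> (e (\<tau> m))"
proof -
  obtain \<omega> :: 'k where \<omega>: "\<omega> ^ p = 1" "\<omega> \<noteq> 1" using root_of_unity_exists[OF p_gt_1] by blast
  have "\<exists>r\<in>{1..<p}. \<exists>m\<in>carrier M. component \<omega> f r m \<noteq> \<zero>"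
  proof (rule ccontr)
    assume "\<not> ?thesis"
    then have 0: "component \<omega> f r m = \<zero>" if "1 \<le> r" "r < p" "m \<in> carrier M" for r m using that by auto
    have eq: "f m = component \<omega> f p m" if m: "m \<in> carrier M" for m
    proof -
      have "f m = (\<Oplus>r\<in>{1..p}. component \<omega> f r m)" by (rule component_sum[OF \<omega> f(1) m, symmetric])
      also have "\<dots> = (\<Oplus>r\<in>{1..p}. if p = r then component \<omega> f r m else \<zero>)"
        by (rule M.finsum_cong') (use 0 m linD(2)[OF lin_component[OF f(1)]] in \<open>auto simp: order.order_iff_strict\<close>)
      also have "\<dots> = component \<omega> f p m"
        by (rule M.finsum_singleton) (use p_gt_1 m linD(2)[OF lin_component[OF f(1)]] in auto)
      finally show ?thesis .
    qed
    have "scalar f"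
    proof (rule lin_commute_scalar[OF f(1)])
      fix m assume m: "m \<in> carrier M"
      show "f (\<tau> m) = \<tau> (f m)"
        using component_\<tau>[OF \<omega>(1) f(1) m, of p] m \<omega> linD(2)[OF f(1)] by (simp add: eq[symmetric] \<kappa>_one)
    qed
    then show False using f by simp
  qed
  then obtain r where r: "1 \<le> r" "r < p" "\<exists>m\<in>carrier M. component \<omega> f r m \<noteq> \<zero>"
    by (metis atLeastLessThan_iff)
  show thesis
  proof (rule that[of "\<omega> ^ r" "component \<omega> f r"])
    show "(\<omega> ^ r) ^ p = 1" using \<omega> by (simp add: mult.commute flip: power_mult) (simp add: power_mult)
    show "\<omega> ^ r \<noteq> 1" using root_of_unity_pow_eq_1[OF prime_p \<omega>, of r] r by (metis dvd_imp_le not_le not_one_le_zero not_gr0)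
  qed (use r lin_component[OF f(1)] component_\<tau>[OF \<omega>(1) f(1)] in auto)
qed

lemma eigenvector_normalise:
  assumes \<omega>: "\<omega> ^ p = 1" and e: "lin e" "\<exists>m\<in>carrier M. e m \<noteq> \<zero>"
    and \<tau>e: "\<And>m. m \<in> carrier M \<Longrightarrow> \<tau> (e m) = sc \<omega> (e (\<tau> m))"
  obtains e' where "lin e'" "\<And>m. m \<in> carrier M \<Longrightarrow> (e' ^^ p) m = m"
    "\<And>m. m \<in> carrier M \<Longrightarrow> \<tau> (e' m) = sc \<omega> (e' (\<tau> m))"
proof -
  have \<omega>0: "\<omega> \<noteq> 0" using \<omega> pow_nonzero[of \<omega>] by simp
  define W where "W = {m \<in> carrier M. e m = \<zero>}"
  have W: "submodule W D M" unfolding W_def by (rule lin_kernel[OF e(1)])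
  have "\<tau> ` W \<subseteq> W"
  proof
    fix x assume "x \<in> \<tau> ` W"
    then obtain m where m: "m \<in> carrier M" "e m = \<zero>" "x = \<tau> m" by (auto simp: W_def)
    then have "sc \<omega> (e (\<tau> m)) = \<zero>" using \<tau>e[OF m(1)] \<tau>_pow_zero[of 1] by simp
    then have "e (\<tau> m) = \<zero>" using sc_eq_zero \<omega>0 linD(2)[OF e(1)] m by simp
    then show "x \<in> W" using m by (simp add: W_def)
  qed
  then have W0: "W = {\<zero>}" using irreducible[OF W] e(2) by (auto simp: W_def)
  have e_pow: "(e ^^ s) m \<in> carrier M" if "m \<in> carrier M" for s m using linD(2)[OF lin_pow[OF e(1)] that] .
  have inj: "(e ^^ s) m = \<zero> \<Longrightarrow> m = \<zero>" if "m \<in> carrier M" for s m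
  proof (induction s)
    case (Suc s)
    then have "(e ^^ s) m \<in> W" using that e_pow by (simp add: W_def)
    then show ?case using Suc W0 by auto
  qed simp
  \<comment> \<open>Passing \<tau> through a power of e costs the same power of \<omega>; at s = p
    the cost is 1.\<close>
  have \<tau>e_pow: "\<tau> ((e ^^ s) m) = sc (\<omega> ^ s) ((e ^^ s) (\<tau> m))" if m: "m \<in> carrier M" for s m
  proof (induction s)
    case (Suc s)
    then show ?case using m e_pow
      by (simp add: \<tau>e linD(5)[OF e(1)] \<kappa>_mult linD(2)[OF e(1)])
  qed (simp add: m \<kappa>_one)
  have "scalar (e ^^ p)"
    by (rule lin_commute_scalar[OF lin_pow[OF e(1)]]) (simp add: \<tau>e_pow \<omega> \<kappa>_one e_pow)
  then obtain b where b: "\<And>m. m \<in> carrier M \<Longrightarrow> (e ^^ p) m = sc b m" by (auto simp: scalar_def)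
  obtain m0 where m0: "m0 \<in> carrier M" "m0 \<noteq> \<zero>" using nonzero M.zero_closed by blast
  then have "b \<noteq> 0" using inj[OF m0(1), of p] b[OF m0(1)] by auto
  obtain d where d: "d ^ p = b" using nth_root_exists[of p b] p_gt_1 by auto
  have d0: "d \<noteq> 0" using d \<open>b \<noteq> 0\<close> p_gt_1 by (metis not_one_less_zero power_0_left)
  define e' where "e' m = sc (inverse d) (e m)" for m
  have e': "lin e'" unfolding e'_def by (rule lin_comp[OF lin_sc e(1)])
  have pow: "(e' ^^ s) m = sc (inverse d ^ s) ((e ^^ s) m)" if m: "m \<in> carrier M" for s m
    by (induction s) (simp_all add: e'_def m \<kappa>_one linD(5)[OF e(1)] e_pow \<kappa>_mult linD(2)[OF e(1)])
  show thesis
  proof (rule that[OF e'])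
    fix m assume m: "m \<in> carrier M"
    show "(e' ^^ p) m = m"
      using m \<open>b \<noteq> 0\<close> d by (simp add: pow b power_inverse \<kappa>_mult[symmetric] \<kappa>_one)
    show "\<tau> (e' m) = sc \<omega> (e' (\<tau> m))"
      using m by (simp add: e'_def \<tau>_\<kappa> linD(2)[OF e(1)] \<tau>e \<kappa>_smult[OF \<kappa>_closed])
  qed
qed

lemma projection_exists:
  assumes A: "submodule A D M" and U: "submodule U D M" and int: "A \<inter> U = {\<zero>}"
    and sum: "\<And>m. m \<in> carrier M \<Longrightarrow> \<exists>a\<in>A. \<exists>u\<in>U. m = a \<oplus> u"
  shows "\<exists>f. lin f \<and> (\<forall>a\<in>A. f a = a) \<and> (\<forall>u\<in>U. f u = \<zero>)"
proof -
  note A_cl [simp] = submoduleD(3)[OF A] and U_cl [simp] = submoduleD(3)[OF U]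
  have unique: "a = a'" if "a \<in> A" "a' \<in> A" "u \<in> U" "u' \<in> U" "a \<oplus> u = a' \<oplus> u'" for a a' u u'
  proof -
    have "\<ominus> a' \<oplus> (a \<oplus> u) \<oplus> \<ominus> u = \<ominus> a' \<oplus> a"
      using that(1-4) by (simp add: M.a_assoc M.r_neg)
    moreover have "\<ominus> a' \<oplus> (a' \<oplus> u') \<oplus> \<ominus> u = u' \<oplus> \<ominus> u"
      using that(1-4) by (simp add: M.a_assoc[symmetric] M.l_neg)
    ultimately have eq: "\<ominus> a' \<oplus> a = u' \<oplus> \<ominus> u" using that(5) by simp
    have "\<ominus> a' \<oplus> a \<in> A" by (intro submoduleD(4,6)[OF A] that)
    moreover have "u' \<oplus> \<ominus> u \<in> U" by (intro submoduleD(4,6)[OF U] that)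
    ultimately have "\<ominus> a' \<oplus> a \<in> A \<inter> U" using eq by simp
    then have "\<ominus> a' \<oplus> a = \<zero>" unfolding int by simp
    then have "\<ominus> a = \<ominus> a'" by (rule M.minus_equality) (use that(1,2) in auto)
    then have "\<ominus> (\<ominus> a) = \<ominus> (\<ominus> a')" by simp
    then show ?thesis using that(1,2) by (simp add: M.minus_minus)
  qed
  define f where "f m = (SOME a. a \<in> A \<and> (\<exists>u\<in>U. m = a \<oplus> u))" for m
  have f: "f (a \<oplus> u) = a" if "a \<in> A" "u \<in> U" for a u
  proof -
    have "f (a \<oplus> u) \<in> A \<and> (\<exists>u'\<in>U. a \<oplus> u = f (a \<oplus> u) \<oplus> u')"
      unfolding f_def by (rule someI_ex) (use that in blast)
    then obtain u' where "f (a \<oplus> u) \<in> A" "u' \<in> U" "a \<oplus> u = f (a \<oplus> u) \<oplus> u'" by blast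
    then show ?thesis using unique[OF that(1) _ that(2)] by metis
  qed
  show ?thesis
  proof (intro exI[of _ f] conjI ballI)
    show "lin f"
    proof (rule linI)
      fix m assume "m \<in> carrier M"
      then obtain a u where m: "a \<in> A" "u \<in> U" "m = a \<oplus> u" using sum by blast
      then show "f m \<in> carrier M" by (simp add: f)
      fix Q assume Q: "Q \<in> carrier D"
      have "Q \<odot> m = Q \<odot> a \<oplus> Q \<odot> u" using m Q by (simp add: smult_r_distr)
      then show "f (Q \<odot> m) = Q \<odot> f m"
        using m Q submoduleD(5)[OF A] submoduleD(5)[OF U] by (simp add: f)
    next
      fix x y assume "x \<in> carrier M" "y \<in> carrier M"
      then obtain a u b v where xy: "a \<in> A" "u \<in> U" "x = a \<oplus> u" "b \<in> A" "v \<in> U" "y = b \<oplus> v"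
        using sum by meson
      then have "x \<oplus> y = (a \<oplus> b) \<oplus> (u \<oplus> v)" by (simp add: M.a_ac)
      then show "f (x \<oplus> y) = f x \<oplus> f y"
        using xy submoduleD(4)[OF A] submoduleD(4)[OF U] by (simp add: f)
    qed
    show "f a = a" if "a \<in> A" for a using f[OF that submoduleD(2)[OF U]] that by simp
    show "f u = \<zero>" if "u \<in> U" for u using f[OF submoduleD(2)[OF A] that] that by simp
  qed
qed

text \<open>Zorn's lemma applies because the union of a chain of proper submodules is proper: it
  would otherwise contain the finite set of \<open>fin_gen\<close>, which would then lie in one
  member of the chain.\<close>

lemma maximal_submodule_exists:
  "\<exists>W. submodule W D M \<and> W \<noteq> carrier M \<and>
    (\<forall>U. submodule U D M \<longrightarrow> W \<subseteq> U \<longrightarrow> U = W \<or> U = carrier M)"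
proof -
  define S where "S = {W. submodule W D M \<and> W \<noteq> carrier M}"
  obtain B where B: "finite B" "B \<subseteq> carrier M" "\<And>W. submodule W D M \<Longrightarrow> B \<subseteq> W \<Longrightarrow> W = carrier M" using fin_gen by blast
  have "\<exists>m\<in>S. \<forall>h\<in>S. m \<subseteq> h \<longrightarrow> h = m"
  proof (rule subset_Zorn_nonempty)
    have "{\<zero>} \<in> S" using nonzero by (auto simp: S_def submodule_iff)
    then show "S \<noteq> {}" by blast
    fix C assume C: "C \<noteq> {}" "subset.chain S C"
    then have CS: "\<And>W. W \<in> C \<Longrightarrow> submodule W D M \<and> W \<noteq> carrier M" by (auto simp: subset.chain_def S_def)
    have dir: "\<exists>W\<in>C. x \<in> W \<and> y \<in> W" if "x \<in> \<Union>C" "y \<in> \<Union>C" for x y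
      using that C(2) by (meson UnionE subset_chain_def subsetD)
    have sub: "submodule (\<Union>C) D M"
      unfolding submodule_iff
    proof (intro conjI ballI)
      show "\<Union>C \<subseteq> carrier M" using CS submoduleD(1) by blast
      show "\<zero> \<in> \<Union>C" using C(1) CS submoduleD(2) by blast
      show "x \<oplus> y \<in> \<Union>C" if xy: "x \<in> \<Union>C" "y \<in> \<Union>C" for x y
      proof -
        obtain W where "W \<in> C" "x \<in> W" "y \<in> W" using dir[OF xy] by blast
        then show ?thesis using CS submoduleD(4) by blast
      qed
      show "Q \<odot> x \<in> \<Union>C" if "Q \<in> carrier D" "x \<in> \<Union>C" for Q x
        using that CS submoduleD(5) by blast
    qed
    have "\<Union>C \<noteq> carrier M"
    proof
      assume "\<Union>C = carrier M"
      then obtain W where "W \<in> C" "B \<subseteq> W"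
        using finite_subset_Union_chain[OF B(1) _ C(1,2)] B(2) by metis
      then show False using B(3) CS by blast
    qed
    then show "\<Union>C \<in> S" using sub by (simp add: S_def)
  qed
  then show ?thesis unfolding S_def by blast
qed

text \<open>For a maximal submodule \<open>W\<close>, the intersection of all \<open>\<tau>\<^sup>-\<^sup>s W\<close> is stable under \<open>\<tau>\<close>, hence zero.
  Take \<open>k\<close> minimal such that the first \<open>k + 1\<close> of them intersect in zero: then \<open>M\<close> is the direct sum of
  the intersection of the first \<open>k\<close> and of \<open>\<tau>\<^sup>-\<^sup>k W\<close>.\<close>

lemma nonscalar_exists:
  assumes "\<not> simple_module D M"
  obtains f where "lin f" "\<not> scalar f"
proof -
  obtain W where Wmax: "submodule W D M \<and> W \<noteq> carrier M \<and>
      (\<forall>U. submodule U D M \<longrightarrow> W \<subseteq> U \<longrightarrow> U = W \<or> U = carrier M)"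
    using maximal_submodule_exists by (rule exE)
  note W = Wmax[THEN conjunct1] Wmax[THEN conjunct2, THEN conjunct1]
    and max = Wmax[THEN conjunct2, THEN conjunct2, rule_format]
  define J where "J n = {m \<in> carrier M. \<forall>s<n. (\<tau> ^^ s) m \<in> W}" for n
  have J: "submodule (J n) D M" for n
  proof -
    have JW: "(\<tau> ^^ s) x \<in> W" "x \<in> carrier M" if "x \<in> J n" "s < n" for x s
      using that by (simp_all add: J_def)
    show ?thesis
      unfolding submodule_iff
    proof (intro conjI ballI)
      show "J n \<subseteq> carrier M" by (auto simp: J_def)
      show "\<zero> \<in> J n" using submoduleD(2)[OF W(1)] by (simp add: J_def \<tau>_pow_zero)
      fix x assume x: "x \<in> J n"
      then have xc: "x \<in> carrier M" by (simp add: J_def)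
      show "x \<oplus> y \<in> J n" if y: "y \<in> J n" for y
      proof -
        have yc: "y \<in> carrier M" using y by (simp add: J_def)
        have "(\<tau> ^^ s) (x \<oplus> y) \<in> W" if "s < n" for s
          unfolding add_hom_add[OF \<tau>_pow_hom xc yc]
          by (rule submoduleD(4)[OF W(1) JW(1)[OF x that] JW(1)[OF y that]])
        then show ?thesis using xc yc by (simp add: J_def)
      qed
      show "Q \<odot> x \<in> J n" if Q: "Q \<in> carrier D" for Q
      proof -
        have "(\<tau> ^^ s) (Q \<odot> x) \<in> W" if "s < n" for s
          unfolding \<tau>_pow_smult[OF Q xc]
          by (rule submoduleD(5)[OF W(1) tw_pow_closed[OF Q] JW(1)[OF x that]])
        then show ?thesis using xc Q by (simp add: J_def smult_closed)
      qed
    qed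
  qed
  have "\<tau> ` J p \<subseteq> J p"
  proof
    fix x assume "x \<in> \<tau> ` J p"
    then obtain m where m: "m \<in> carrier M" "\<And>s. s < p \<Longrightarrow> (\<tau> ^^ s) m \<in> W" "x = \<tau> m"
      by (auto simp: J_def)
    have "(\<tau> ^^ s) x \<in> W" if "s < p" for s
    proof (cases "Suc s = p")
      case True
      have "(\<tau> ^^ s) x = (\<tau> ^^ p) m" unfolding True[symmetric] m(3) by (simp only: funpow_Suc_right comp_apply)
      then show ?thesis using m(1) m(2)[of 0] p_gt_1 \<tau>_pow_p by simp
    next
      case False
      have "(\<tau> ^^ s) x = (\<tau> ^^ Suc s) m" unfolding m(3) by (simp only: funpow_Suc_right comp_apply)
      then show ?thesis using m(2)[of "Suc s"] that False by simp
    qed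
    then show "x \<in> J p" using m by (simp add: J_def)
  qed
  moreover have "J p \<noteq> carrier M"
  proof -
    have "J p \<subseteq> W" using p_gt_1 by (force simp: J_def)
    then show ?thesis using W submoduleD(1)[OF W(1)] by blast
  qed
  ultimately have Jp: "J p = {\<zero>}" using irreducible[OF J] by blast
  define n where "n = (LEAST n. J n = {\<zero>})"
  have Jn: "J n = {\<zero>}" unfolding n_def by (rule LeastI[of _ p]) (rule Jp)
  have J0: "J 0 = carrier M" by (simp add: J_def)
  then have "n \<noteq> 0" using Jn nonzero by auto
  then obtain k where k: "n = Suc k" by (cases n) auto
  have Jk: "J k \<noteq> {\<zero>}" using not_less_Least[of k "\<lambda>n. J n = {\<zero>}"] k by (simp add: n_def)
  define U where "U = {m \<in> carrier M. (\<tau> ^^ k) m \<in> W}"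
  have U: "submodule U D M" unfolding U_def by (rule submodule_vimage[OF W(1)])
  have "J k \<inter> U = J (Suc k)" by (auto simp: J_def U_def less_Suc_eq)
  then have int: "J k \<inter> U = {\<zero>}" using Jn k by simp
  define S where "S = {a \<oplus> u | a u. a \<in> J k \<and> u \<in> U}"
  note Jcl = submoduleD(3)[OF J[of k]] and Ucl = submoduleD(3)[OF U]
  have S: "submodule S D M"
    unfolding submodule_iff
  proof (intro conjI ballI)
    note [simp] = Jcl Ucl
    show "S \<subseteq> carrier M" by (auto simp: S_def)
    show "\<zero> \<in> S" unfolding S_def using submoduleD(2)[OF J] submoduleD(2)[OF U] by force
    fix x assume "x \<in> S"
    then obtain a u where x: "a \<in> J k" "u \<in> U" "x = a \<oplus> u" by (auto simp: S_def)
    show "Q \<odot> x \<in> S" if Q: "Q \<in> carrier D" for Q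
    proof -
      have "Q \<odot> x = Q \<odot> a \<oplus> Q \<odot> u" using x Q by (simp add: smult_r_distr)
      then show ?thesis unfolding S_def using x Q submoduleD(5)[OF J] submoduleD(5)[OF U] by blast
    qed
    fix y assume "y \<in> S"
    then obtain b v where y: "b \<in> J k" "v \<in> U" "y = b \<oplus> v" by (auto simp: S_def)
    have "x \<oplus> y = (a \<oplus> b) \<oplus> (u \<oplus> v)" using x y by (simp add: M.a_ac)
    then show "x \<oplus> y \<in> S" unfolding S_def using x y submoduleD(4)[OF J] submoduleD(4)[OF U] by blast
  qed
  \<comment> \<open>The translate \<tau>^k S. It contains W because S contains U, so maximality of W
    leaves two cases: S = U, which would put the nonzero \<open>J k\<close> inside U, and S =
    M.\<close>
  define Z where "Z = {m \<in> carrier M. (\<tau> ^^ ((p - 1) * k)) m \<in> S}"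
  have Z: "submodule Z D M" unfolding Z_def by (rule submodule_vimage[OF S])
  have US: "u \<in> S" if "u \<in> U" for u
    unfolding S_def using that submoduleD(2)[OF J, of k]
    by (intro CollectI exI[of _ "\<zero>"] exI[of _ u]) (simp add: Ucl)
  have "W \<subseteq> Z"
  proof
    fix m assume "m \<in> W"
    then have m: "m \<in> carrier M" "m \<in> W" using submoduleD(3)[OF W(1)] by auto
    then have "(\<tau> ^^ ((p - 1) * k)) m \<in> U" by (simp add: U_def \<tau>_pow_cancel del: One_nat_def)
    then have "(\<tau> ^^ ((p - 1) * k)) m \<in> S" by (rule US)
    then show "m \<in> Z" using m by (simp add: Z_def)
  qed
  then have "Z = W \<or> Z = carrier M" by (rule max[OF Z])
  then have S_all: "S = carrier M"
  proof
    assume 1: "Z = W"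
    have SU: "x \<in> U" if "x \<in> S" for x
    proof -
      have x: "x \<in> carrier M" using submoduleD(3)[OF S that] .
      then have "(\<tau> ^^ k) x \<in> Z" using that by (simp add: Z_def \<tau>_pow_cancel' del: One_nat_def)
      then show ?thesis using 1 x by (simp add: U_def)
    qed
    have "J k \<subseteq> U"
    proof
      fix a assume a: "a \<in> J k"
      have "a \<oplus> \<zero> \<in> S" unfolding S_def using a submoduleD(2)[OF U] by blast
      then show "a \<in> U" using SU a by (simp add: Jcl)
    qed
    then show ?thesis using int Jk by blast
  next
    assume 2: "Z = carrier M"
    have "m \<in> S" if m: "m \<in> carrier M" for m
    proof -
      have "(\<tau> ^^ k) m \<in> Z" using 2 m by simp
      then show ?thesis using m by (simp add: Z_def \<tau>_pow_cancel' del: One_nat_def)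
    qed
    then show ?thesis using submoduleD(1)[OF S] by blast
  qed
  \<comment> \<open>For k = 0 the complement U is W and \<open>J 0\<close> is M. Then W = 0 is
    maximal and M is simple. Otherwise \<open>J k\<close> lies in W and is proper.\<close>
  have "k \<noteq> 0"
  proof
    assume "k = 0"
    then have "W = {\<zero>}" using int J0 submoduleD(1)[OF W(1)] by (auto simp: U_def)
    have "H = {\<zero>} \<or> H = carrier M" if H: "submodule H D M" for H
    proof -
      have "W \<subseteq> H" using \<open>W = {\<zero>}\<close> submoduleD(2)[OF H] by simp
      then have "H = W \<or> H = carrier M" by (rule max[OF H])
      then show ?thesis using \<open>W = {\<zero>}\<close> by simp
    qed
    then have "simple_module D M"
      unfolding simple_module_def using M_left_module nonzero by blast
    then show False using assms by simp
  qed
  then have "J k \<subseteq> W" by (force simp: J_def)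
  then have Jk_ne: "J k \<noteq> carrier M" using W submoduleD(1)[OF W(1)] by blast
  have "\<exists>a\<in>J k. \<exists>u\<in>U. m = a \<oplus> u" if "m \<in> carrier M" for m
  proof -
    have "m \<in> S" using that S_all by simp
    then show ?thesis by (auto simp: S_def)
  qed
  from projection_exists[OF J U int this]
  obtain f where f': "lin f \<and> (\<forall>a\<in>J k. f a = a) \<and> (\<forall>u\<in>U. f u = \<zero>)" by (rule exE)
  note f = f'[THEN conjunct1] f'[THEN conjunct2, THEN conjunct1, rule_format]
    f'[THEN conjunct2, THEN conjunct2, rule_format]
  \<comment> \<open>The projection fixes the nonzero \<open>J k\<close>, so as a scalar it would be
    nonzero. Since it kills U, this would force U = 0 and \<open>J k\<close> = M.\<close>
  have "\<not> scalar f"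
  proof
    assume "scalar f"
    then obtain a where a: "\<And>m. m \<in> carrier M \<Longrightarrow> f m = sc a m" by (auto simp: scalar_def)
    obtain x where x: "x \<in> J k" "x \<noteq> \<zero>" using Jk submoduleD(2)[OF J, of k] by blast
    have "a \<noteq> 0" using a[of x] f(2)[OF x(1)] x Jcl by auto
    then have U0: "u = \<zero>" if "u \<in> U" for u
      using sc_eq_zero[of u a] a[of u] f(3)[OF that] Ucl[OF that] by simp
    have "b \<oplus> u \<in> J k" if "b \<in> J k" "u \<in> U" for b u
      using U0[OF that(2)] that(1) by (simp add: Jcl)
    then have "S \<subseteq> J k" unfolding S_def by blast
    then show False using S_all Jk_ne submoduleD(1)[OF J] by blast
  qed
  then show thesis by (rule that[OF f(1)])
qed

end

section \<open>The eigenspaces of the normalised endomorphism\<close>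

locale cyclic_splitting = cyclic_descent D M \<tau> tw \<kappa> p
  for D :: "('d, 'u) ring_scheme" and M :: "('d, 'm, 'v) module_scheme" (structure) and \<tau> tw
    and \<kappa> :: "'k::{alg_closed_field, field_char_0} \<Rightarrow> 'd" and p +
  fixes \<omega> :: 'k and e :: "'m \<Rightarrow> 'm"
  assumes \<omega>_p: "\<omega> ^ p = 1" and \<omega>_1: "\<omega> \<noteq> 1" and e_lin: "lin e"
    and e_p: "m \<in> carrier M \<Longrightarrow> (e ^^ p) m = m"
    and \<tau>_e: "m \<in> carrier M \<Longrightarrow> \<tau> (e m) = sc \<omega> (e (\<tau> m))"
begin

definition V :: "'k \<Rightarrow> 'm set" where "V z = {m \<in> carrier M. e m = sc z m}"

lemma V_submodule: "submodule (V z) D M"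
  unfolding V_def by (rule lin_eigenspace[OF e_lin])

lemma V_pow: "m \<in> V z \<Longrightarrow> (e ^^ s) m = sc (z ^ s) m"
proof (induction s)
  case (Suc s)
  then show ?case by (simp add: V_def linD(5)[OF e_lin] \<kappa>_mult[symmetric] mult.commute)
qed (simp add: V_def \<kappa>_one)

lemma V_closed: "m \<in> V z \<Longrightarrow> m \<in> carrier M"
  by (simp add: V_def)

lemma e_pow_closed: "m \<in> carrier M \<Longrightarrow> (e ^^ s) m \<in> carrier M"
  by (rule linD(2)[OF lin_pow[OF e_lin]])

lemma \<omega>_nonzero: "\<omega> \<noteq> 0"
  using \<omega>_p pow_nonzero[of \<omega>] by simp

lemma \<tau>_V: "m \<in> V z \<Longrightarrow> \<tau> m \<in> V (z * inverse \<omega>)"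
proof -
  assume m: "m \<in> V z"
  then have mc: "m \<in> carrier M" "e m = sc z m" by (auto simp: V_def)
  have "e (\<tau> m) = sc (inverse \<omega>) (\<tau> (e m))"
    unfolding \<tau>_e[OF mc(1)] using \<omega>_nonzero mc(1) linD(2)[OF e_lin] by (simp add: \<kappa>_mult[symmetric] \<kappa>_one)
  also have "\<dots> = sc (z * inverse \<omega>) (\<tau> m)"
    using mc by (simp add: \<tau>_\<kappa> \<kappa>_mult[symmetric] mult.commute)
  finally show ?thesis using mc by (simp add: V_def)
qed

lemma \<tau>_pow_V: "m \<in> V z \<Longrightarrow> (\<tau> ^^ k) m \<in> V (z * inverse \<omega> ^ k)"
proof (induction k)
  case (Suc k)
  then show ?case using \<tau>_V[OF Suc.IH[OF Suc.prems]] by (simp add: mult_ac)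
qed simp

text \<open>The Fourier transform of the orbit of m under e, hence the projection to the eigenspace
  of e for \<open>\<omega> ^ t\<close>.\<close>

definition proj :: "nat \<Rightarrow> 'm \<Rightarrow> 'm" where
  "proj t m = dft \<omega> (\<lambda>s. (e ^^ s) m) t"

lemma proj_lin: "lin (proj t)"
  unfolding proj_def[abs_def] by (rule lin_dft) (rule lin_pow[OF e_lin])

lemma proj_V: "m \<in> carrier M \<Longrightarrow> proj t m \<in> V (\<omega> ^ t)"
proof -
  assume m: "m \<in> carrier M"
  have "e (proj t m) = dft \<omega> (\<lambda>s. (e ^^ Suc s) m) t"
    unfolding proj_def using m by (subst dft_hom[OF linD(1)[OF e_lin]]) (auto simp: linD(5)[OF e_lin] e_pow_closed)
  also have "\<dots> = sc (\<omega> ^ t) (proj t m)"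
    unfolding proj_def using m e_pow_closed e_p by (intro dft_shift \<omega>_p) auto
  finally show ?thesis using linD(2)[OF proj_lin m] by (simp add: V_def)
qed

lemma proj_sum: "m \<in> carrier M \<Longrightarrow> (\<Oplus>t\<in>{1..p}. proj t m) = m"
  unfolding proj_def using dft_sum[OF \<omega>_p \<omega>_1, of "\<lambda>s. (e ^^ s) m"] e_pow_closed by simp

text \<open>On an eigenvector the transform is a geometric sum in z / \<omega>^t, which vanishes
  unless this quotient is 1.\<close>

lemma proj_on_V:
  assumes m: "m \<in> V z" and z: "z ^ p = 1"
  shows "proj t m = (if z = \<omega> ^ t then m else \<zero>)"
proof -
  have mc: "m \<in> carrier M" using V_closed[OF m] .
  define y where "y = inverse \<omega> ^ t * z"
  have "(inverse \<omega> ^ t) ^ p = (inverse \<omega> ^ p) ^ t" by (simp add: mult.commute flip: power_mult)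
  then have yp: "y ^ p = 1" using \<omega>_p z by (simp add: y_def power_mult_distrib power_inverse)
  have y1: "y = 1 \<longleftrightarrow> z = \<omega> ^ t" using \<omega>_nonzero by (auto simp: y_def power_inverse field_simps)
  have "sc (inverse \<omega> ^ (t * s)) ((e ^^ s) m) = sc (y ^ s) m" for s
    using mc by (simp add: V_pow[OF m] \<kappa>_mult[symmetric] y_def power_mult_distrib power_mult)
  then have "proj t m = sc (1 / of_nat p) (\<Oplus>s\<in>{..<p}. sc (y ^ s) m)"
    by (simp add: proj_def dft_def)
  also have "\<dots> = sc (1 / of_nat p) (sc (\<Sum>s<p. y ^ s) m)"
    using mc by (simp add: sc_sum)
  also have "\<dots> = (if z = \<omega> ^ t then m else \<zero>)"
    using mc p_nonzero by (simp add: root_of_unity_sum[OF yp] y1 \<kappa>_mult[symmetric] \<kappa>_one)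
  finally show ?thesis .
qed

lemma \<omega>_pow_p: "(\<omega> ^ t) ^ p = 1"
  by (metis \<omega>_p mult.commute power_mult power_one)

lemma \<omega>_pow_inj:
  assumes "s \<in> {1..p}" "t \<in> {1..p}" "\<omega> ^ s = \<omega> ^ t"
  shows "s = t"
  using assms
proof (induction s t rule: linorder_wlog)
  case (le s t)
  have "\<omega> ^ t = \<omega> ^ s * \<omega> ^ (t - s)" by (metis le(1) le_add_diff_inverse power_add)
  then have "\<omega> ^ (t - s) = 1" using le \<omega>_nonzero by simp
  then have "p dvd t - s" by (rule root_of_unity_pow_eq_1[OF prime_p \<omega>_p \<omega>_1])
  moreover have "t - s < p" using le by auto
  ultimately show ?case using le by (metis dvd_imp_le diff_is_0_eq' le_antisym not_le zero_less_diff)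
next
  case (sym s t)
  then show ?case by metis
qed

text \<open>Some eigenspace is nonzero because the projections of a nonzero element sum to it, and
  \<tau> moves that eigenspace to every other one.\<close>

lemma V_nonzero:
  assumes t: "t \<in> {1..p}"
  obtains m where "m \<in> V (\<omega> ^ t)" "m \<noteq> \<zero>"
proof -
  obtain m0 where m0: "m0 \<in> carrier M" "m0 \<noteq> \<zero>" using nonzero M.zero_closed by blast
  have "\<exists>s\<in>{1..p}. proj s m0 \<noteq> \<zero>"
  proof (rule ccontr)
    assume "\<not> ?thesis"
    then have "(\<Oplus>s\<in>{1..p}. proj s m0) = (\<Oplus>s\<in>{1..p}. \<zero>)"
      by (intro M.finsum_cong') auto
    then show False using proj_sum[OF m0(1)] m0(2) by (simp add: M.finsum_zero)
  qed
  then obtain s where s: "s \<in> {1..p}" "proj s m0 \<noteq> \<zero>" by blast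
  \<comment> \<open>Each application of \<tau> divides the eigenvalue by \<omega>, so s - t
    applications modulo p are wanted; \<open>p - t\<close> keeps the exponent natural.\<close>
  define k where "k = s + (p - t)"
  have "\<omega> ^ s * inverse \<omega> ^ k = \<omega> ^ t"
  proof -
    have "\<omega> ^ s * inverse \<omega> ^ k * \<omega> ^ (p - t) = 1"
      using \<omega>_nonzero by (simp add: k_def power_add power_inverse field_simps)
    moreover have "\<omega> ^ t * \<omega> ^ (p - t) = 1" using t \<omega>_p by (simp flip: power_add)
    ultimately show ?thesis using \<omega>_nonzero by (metis mult_right_cancel power_not_zero)
  qed
  then have "(\<tau> ^^ k) (proj s m0) \<in> V (\<omega> ^ t)" using \<tau>_pow_V[OF proj_V[OF m0(1)], of k s] by simp
  moreover have "(\<tau> ^^ k) (proj s m0) \<noteq> \<zero>"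
    using \<tau>_pow_cancel'[OF linD(2)[OF proj_lin m0(1)], of k s] \<tau>_pow_zero s(2) by metis
  ultimately show thesis using that by blast
qed

lemma direct_sum: "internal_direct_sum D M {1..p} (\<lambda>t. V (\<omega> ^ t))"
  unfolding internal_direct_sum_def
proof (intro conjI ballI)
  show "submodule (V (\<omega> ^ t)) D M" for t by (rule V_submodule)
  fix m assume m: "m \<in> carrier M"
  show "\<exists>!f. f \<in> (\<Pi>\<^sub>E t\<in>{1..p}. V (\<omega> ^ t)) \<and> m = (\<Oplus>t\<in>{1..p}. f t)"
  proof (rule ex1I[of _ "\<lambda>t\<in>{1..p}. proj t m"])
    have "(\<Oplus>t\<in>{1..p}. (\<lambda>t\<in>{1..p}. proj t m) t) = (\<Oplus>t\<in>{1..p}. proj t m)"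
      by (rule M.finsum_cong') (use linD(2)[OF proj_lin m] in auto)
    then show "(\<lambda>t\<in>{1..p}. proj t m) \<in> (\<Pi>\<^sub>E t\<in>{1..p}. V (\<omega> ^ t)) \<and>
        m = (\<Oplus>t\<in>{1..p}. (\<lambda>t\<in>{1..p}. proj t m) t)"
      using m proj_V by (simp only: proj_sum) auto
  next
    fix f assume f: "f \<in> (\<Pi>\<^sub>E t\<in>{1..p}. V (\<omega> ^ t)) \<and> m = (\<Oplus>t\<in>{1..p}. f t)"
    then have fV: "f s \<in> V (\<omega> ^ s)" if "s \<in> {1..p}" for s using that by blast
    have fc: "f s \<in> carrier M" if "s \<in> {1..p}" for s by (rule V_closed[OF fV[OF that]])
    have "proj t m = f t" if t: "t \<in> {1..p}" for t
    proof -
      have "proj t m = (\<Oplus>s\<in>{1..p}. proj t (f s))"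
        using f fc lin_finsum[OF proj_lin, of "{1..p}" f t] by auto
      also have "\<dots> = (\<Oplus>s\<in>{1..p}. if t = s then f s else \<zero>)"
      proof (rule M.finsum_cong')
        show "proj t (f s) = (if t = s then f s else \<zero>)" if "s \<in> {1..p}" for s
          using proj_on_V[OF fV[OF that] \<omega>_pow_p, of t] \<omega>_pow_inj[OF that t] by auto
      qed (use fc in auto)
      also have "\<dots> = f t"
        by (rule M.finsum_singleton) (use t fc in auto)
      finally show ?thesis .
    qed
    then show "f = (\<lambda>t\<in>{1..p}. proj t m)"
      using f by (intro ext) (auto simp: PiE_def extensional_def)
  qed
qed

text \<open>Instead of summing the translates of H, the proof takes the elements all of whose
  translates have their t-component in H. They form a \<tau>-stable submodule that contains H, hence
  all of M, and on the eigenspace itself the t-component is the identity.\<close>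

lemma V_minimal:
  assumes H: "submodule H D M" "H \<subseteq> V (\<omega> ^ t)" "H \<noteq> {\<zero>}"
  shows "H = V (\<omega> ^ t)"
proof -
  define W where "W = {m \<in> carrier M. \<forall>k. proj t ((\<tau> ^^ k) m) \<in> H}"
  have W: "submodule W D M"
    unfolding submodule_iff W_def
    by (auto simp: \<tau>_pow_zero add_hom_add[OF \<tau>_pow_hom] \<tau>_pow_smult smult_closed tw_pow_closed linD[OF proj_lin]
        intro: submoduleD(2,4,5)[OF H(1)])
  have "\<tau> ` W \<subseteq> W"
  proof
    fix x assume "x \<in> \<tau> ` W"
    then obtain m where m: "m \<in> carrier M" "\<And>k. proj t ((\<tau> ^^ k) m) \<in> H" "x = \<tau> m" by (auto simp: W_def)
    have "(\<tau> ^^ k) x = (\<tau> ^^ Suc k) m" for k unfolding m(3) by (simp only: funpow_Suc_right comp_apply)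
    then show "x \<in> W" unfolding W_def using m(1,3) m(2)[of "Suc _"] by (simp del: funpow.simps)
  qed
  moreover have "H \<subseteq> W"
  proof
    fix h assume h: "h \<in> H"
    then have hV: "h \<in> V (\<omega> ^ t)" "h \<in> carrier M" using H(2) V_closed by auto
    \<comment> \<open>The translate lies in the eigenspace for \<omega>^(t-k). Its t-component is
      zero unless p divides k, and in that case the translate is h itself.\<close>
    have "proj t ((\<tau> ^^ k) h) \<in> H" for k
    proof -
      define z where "z = \<omega> ^ t * inverse \<omega> ^ k"
      have "(inverse \<omega> ^ k) ^ p = (inverse \<omega> ^ p) ^ k" by (simp add: mult.commute flip: power_mult)
      then have zp: "z ^ p = 1" using \<omega>_p by (simp add: z_def power_mult_distrib \<omega>_pow_p power_inverse)
      have *: "proj t ((\<tau> ^^ k) h) = (if z = \<omega> ^ t then (\<tau> ^^ k) h else \<zero>)"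
        using proj_on_V[OF \<tau>_pow_V[OF hV(1), of k, folded z_def] zp] .
      show ?thesis
      proof (cases "z = \<omega> ^ t")
        case True
        then have "\<omega> ^ k = 1" using \<omega>_nonzero by (simp add: z_def power_inverse)
        then obtain q where "k = p * q" using root_of_unity_pow_eq_1[OF prime_p \<omega>_p \<omega>_1] by (auto simp: dvd_def)
        then show ?thesis using * True h hV \<tau>_pow_mult_p by simp
      qed (use * submoduleD(2)[OF H(1)] in simp)
    qed
    then show "h \<in> W" using hV by (simp add: W_def)
  qed
  ultimately have "W = carrier M"
    using irreducible[OF W] H(3) submoduleD(2)[OF H(1)] by blast
  have "m \<in> H" if m: "m \<in> V (\<omega> ^ t)" for m
  proof -
    have "m \<in> W" using \<open>W = carrier M\<close> V_closed[OF m] by simp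
    then have "proj t ((\<tau> ^^ 0) m) \<in> H" unfolding W_def by blast
    then show ?thesis using proj_on_V[OF m \<omega>_pow_p, of t] by simp
  qed
  then show ?thesis using H(2) by blast
qed

lemma submodule_left_module:
  assumes H: "submodule H D M"
  shows "left_module D (M\<lparr>carrier := H\<rparr>)"
proof (intro left_module.intro left_module_axioms.intro abelian_groupI)
  note cl [simp] = submoduleD(3)[OF H]
  show "ring D" by (rule R.ring_axioms)
  show "\<exists>y\<in>carrier (M\<lparr>carrier := H\<rparr>). y \<oplus>\<^bsub>M\<lparr>carrier := H\<rparr>\<^esub> x = \<zero>\<^bsub>M\<lparr>carrier := H\<rparr>\<^esub>"
    if "x \<in> carrier (M\<lparr>carrier := H\<rparr>)" for x
    using that submoduleD(6)[OF H] M.l_neg by (intro bexI[of _ "\<ominus> x"]) auto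
qed (auto simp: submoduleD[OF H] M.a_ac smult_l_distr smult_r_distr smult_assoc smult_one)

lemma V_simple:
  assumes t: "t \<in> {1..p}"
  shows "simple_module D (M\<lparr>carrier := V (\<omega> ^ t)\<rparr>)"
  unfolding simple_module_def
proof (intro conjI allI impI)
  let ?V = "V (\<omega> ^ t)"
  show "left_module D (M\<lparr>carrier := ?V\<rparr>)" by (rule submodule_left_module[OF V_submodule])
  show "carrier (M\<lparr>carrier := ?V\<rparr>) \<noteq> {\<zero>\<^bsub>M\<lparr>carrier := ?V\<rparr>\<^esub>}" using V_nonzero[OF t] by auto
  fix H assume H: "submodule H D (M\<lparr>carrier := ?V\<rparr>)"
  interpret H: submodule H D "M\<lparr>carrier := ?V\<rparr>" by (rule H)
  have HV: "H \<subseteq> ?V" using H.subset by simp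
  have "submodule H D M"
    unfolding submodule_iff using HV V_closed H.one_closed H.m_closed H.smult_closed by auto
  then show "H = {\<zero>\<^bsub>M\<lparr>carrier := ?V\<rparr>\<^esub>} \<or> H = carrier (M\<lparr>carrier := ?V\<rparr>)"
    using V_minimal HV by auto
qed

text \<open>The component of g at r obeys the same commutation rule with \<tau> as
  \<open>e ^^ r\<close>. Composed with \<open>e ^^ (p - r)\<close>, the inverse of
  \<open>e ^^ r\<close>, it commutes with \<tau> and is scalar, so it is a multiple of
  \<open>e ^^ r\<close>.\<close>

lemma lin_commute_e:
  assumes g: "lin g" and m: "m \<in> carrier M"
  shows "g (e m) = e (g m)"
proof -
  have comm: "component \<omega> g r (e m) = e (component \<omega> g r m)" if r: "r \<in> {1..p}" for r
  proof -
    define h where "h = component \<omega> g r"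
    have h: "lin h" unfolding h_def by (rule lin_component[OF g])
    have \<tau>h: "\<tau> (h x) = sc (\<omega> ^ r) (h (\<tau> x))" if "x \<in> carrier M" for x
      unfolding h_def by (rule component_\<tau>[OF \<omega>_p g that])
    have \<tau>e_pow: "\<tau> ((e ^^ s) x) = sc (\<omega> ^ s) ((e ^^ s) (\<tau> x))" if x: "x \<in> carrier M" for s x
    proof (induction s)
      case (Suc s)
      then show ?case using x e_pow_closed linD(2)[OF e_lin]
        by (simp add: \<tau>_e linD(5)[OF e_lin] \<kappa>_mult)
    qed (simp add: x \<kappa>_one)
    have "scalar (\<lambda>x. h ((e ^^ (p - r)) x))"
    proof (rule lin_commute_scalar[OF lin_comp[OF h lin_pow[OF e_lin]]])
      fix x assume x: "x \<in> carrier M"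
      have "\<omega> ^ r * \<omega> ^ (p - r) = 1" using r \<omega>_p by (simp flip: power_add)
      then show "h ((e ^^ (p - r)) (\<tau> x)) = \<tau> (h ((e ^^ (p - r)) x))"
        using x e_pow_closed linD(2)[OF h]
        by (simp add: \<tau>h \<tau>e_pow linD(5)[OF h] \<kappa>_mult[symmetric] \<kappa>_one)
    qed
    then obtain a where a: "\<And>x. x \<in> carrier M \<Longrightarrow> h ((e ^^ (p - r)) x) = sc a x" by (auto simp: scalar_def)
    have h_eq: "h x = sc a ((e ^^ r) x)" if x: "x \<in> carrier M" for x
    proof -
      have "(e ^^ (p - r)) ((e ^^ r) x) = x"
        using r e_p[OF x] by (simp flip: funpow_add comp_apply[of "e ^^ (p - r)"])
      then show ?thesis using a[OF e_pow_closed[OF x, of r]] by simp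
    qed
    have "(e ^^ r) (e m) = e ((e ^^ r) m)" by (simp add: funpow_swap1)
    then show ?thesis
      unfolding h_def[symmetric] using m e_pow_closed linD(2)[OF e_lin] by (simp add: h_eq linD(5)[OF e_lin])
  qed
  have "e (g m) = (\<Oplus>r\<in>{1..p}. e (component \<omega> g r m))"
    unfolding component_sum[OF \<omega>_p \<omega>_1 g m, symmetric]
    by (rule lin_finsum[OF e_lin]) (auto simp: linD(2)[OF lin_component[OF g]] m)
  also have "\<dots> = (\<Oplus>r\<in>{1..p}. component \<omega> g r (e m))"
    by (rule M.finsum_cong') (auto simp: comm linD(2)[OF lin_component[OF g]] linD(2)[OF e_lin] m)
  also have "\<dots> = g (e m)"
    by (rule component_sum[OF \<omega>_p \<omega>_1 g]) (simp add: linD(2)[OF e_lin] m)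
  finally show ?thesis ..
qed

text \<open>Composed with \<open>proj s\<close>, an isomorphism becomes an endomorphism of M and
  therefore commutes with e. Then its value at an eigenvector for \<open>\<omega> ^ s\<close> would
  have both eigenvalues \<open>\<omega> ^ s\<close> and \<open>\<omega> ^ t\<close>.\<close>

lemma V_not_isomorphic:
  assumes s: "s \<in> {1..p}" and t: "t \<in> {1..p}" and "s \<noteq> t"
  shows "\<not> module_isomorphic D (M\<lparr>carrier := V (\<omega> ^ s)\<rparr>) (M\<lparr>carrier := V (\<omega> ^ t)\<rparr>)"
proof
  assume "module_isomorphic D (M\<lparr>carrier := V (\<omega> ^ s)\<rparr>) (M\<lparr>carrier := V (\<omega> ^ t)\<rparr>)"
  then obtain f where f: "bij_betw f (V (\<omega> ^ s)) (V (\<omega> ^ t))"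
    "\<And>x y. x \<in> V (\<omega> ^ s) \<Longrightarrow> y \<in> V (\<omega> ^ s) \<Longrightarrow> f (x \<oplus> y) = f x \<oplus> f y"
    "\<And>Q x. Q \<in> carrier D \<Longrightarrow> x \<in> V (\<omega> ^ s) \<Longrightarrow> f (Q \<odot> x) = Q \<odot> f x"
    by (auto simp: module_isomorphic_def)
  have fV: "f x \<in> V (\<omega> ^ t)" if "x \<in> V (\<omega> ^ s)" for x using f(1) that by (auto simp: bij_betw_def)
  have g: "lin (\<lambda>m. f (proj s m))"
    by (rule linI) (auto simp: linD[OF proj_lin] f proj_V intro: V_closed[OF fV[OF proj_V]])
  obtain v where v: "v \<in> V (\<omega> ^ s)" "v \<noteq> \<zero>" using V_nonzero[OF s] .
  have vc: "v \<in> carrier M" using V_closed[OF v(1)] .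
  have pv: "proj s v = v" using proj_on_V[OF v(1) \<omega>_pow_p, of s] by simp
  have fv: "f v \<in> carrier M" using V_closed[OF fV[OF v(1)]] .
  have "e v = sc (\<omega> ^ s) v" using v(1) by (simp add: V_def)
  then have "f (proj s (e v)) = sc (\<omega> ^ s) (f v)"
    using vc v(1) pv by (simp add: linD(5)[OF proj_lin] f(3)[OF \<kappa>_closed])
  moreover have "e (f (proj s v)) = sc (\<omega> ^ t) (f v)" using fV[OF v(1)] pv by (simp add: V_def)
  ultimately have eq: "sc (\<omega> ^ s) (f v) = sc (\<omega> ^ t) (f v)" using lin_commute_e[OF g vc] by simp
  have "sc (\<omega> ^ s - \<omega> ^ t) (f v) \<oplus> sc (\<omega> ^ t) (f v) = \<zero> \<oplus> sc (\<omega> ^ t) (f v)"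
    using fv eq \<kappa>_add[of "f v" "\<omega> ^ s - \<omega> ^ t" "\<omega> ^ t"] by simp
  then have "sc (\<omega> ^ s - \<omega> ^ t) (f v) = \<zero>" using fv by (simp add: M.add.r_cancel)
  moreover have "\<omega> ^ s - \<omega> ^ t \<noteq> 0" using \<omega>_pow_inj[OF s t] \<open>s \<noteq> t\<close> by auto
  ultimately have "f v = \<zero>" using sc_eq_zero[OF fv] by blast
  moreover have "f \<zero> = \<zero>" using linD(6)[OF g] linD(6)[OF proj_lin] by simp
  ultimately have "v = \<zero>"
    using f(1) v(1) submoduleD(2)[OF V_submodule, of "\<omega> ^ s"] by (metis bij_betw_imp_inj_on inj_onD)
  then show False using v(2) by simp
qed

end

context cyclic_descent
begin

theorem simple_or_split:
  "simple_module D M \<or>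
    (\<exists>V. internal_direct_sum D M {1..p} V \<and>
      (\<forall>s\<in>{1..p}. simple_module D (M\<lparr>carrier := V s\<rparr>)) \<and>
      (\<forall>s\<in>{1..p}. \<forall>t\<in>{1..p}. s \<noteq> t \<longrightarrow>
        \<not> module_isomorphic D (M\<lparr>carrier := V s\<rparr>) (M\<lparr>carrier := V t\<rparr>)))"
proof (cases "simple_module D M")
  case False
  then obtain f where f: "lin f" "\<not> scalar f" using nonscalar_exists by blast
  obtain \<omega> e0 where \<omega>: "\<omega> ^ p = 1" "\<omega> \<noteq> 1" and e0: "lin e0" "\<exists>m\<in>carrier M. e0 m \<noteq> \<zero>"
    "\<And>m. m \<in> carrier M \<Longrightarrow> \<tau> (e0 m) = sc \<omega> (e0 (\<tau> m))"
    using nonscalar_eigenvector[OF f] by blast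
  obtain e where e: "lin e" "\<And>m. m \<in> carrier M \<Longrightarrow> (e ^^ p) m = m"
    "\<And>m. m \<in> carrier M \<Longrightarrow> \<tau> (e m) = sc \<omega> (e (\<tau> m))"
    using eigenvector_normalise[OF \<omega>(1) e0] by blast
  interpret cyclic_splitting D M \<tau> tw \<kappa> p \<omega> e
    by unfold_locales (fact \<omega> e)+
  show ?thesis
    by (intro disjI2 exI[of _ "\<lambda>t. V (\<omega> ^ t)"] conjI ballI impI direct_sum V_simple V_not_isomorphic)
qed simp

end

section \<open>Inverse images of simple modules\<close>

text \<open>Gaussian elimination, with J indexing the equations and I the unknowns. It serves to
  show that sufficiently many powers of an endomorphism are linearly dependent.\<close>

lemma homogeneous_system_solution:
  fixes v :: "'i \<Rightarrow> 'j \<Rightarrow> 'a::field"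
  assumes "finite J" "finite I" "card J < card I"
  shows "\<exists>c. (\<exists>r\<in>I. c r \<noteq> 0) \<and> (\<forall>y\<in>J. (\<Sum>r\<in>I. c r * v r y) = 0)"
  using assms
proof (induction J arbitrary: I v)
  case empty
  then have "I \<noteq> {}" by auto
  then show ?case by (intro exI[of _ "\<lambda>_. 1"]) auto
next
  case (insert y0 J)
  show ?case
  proof (cases "\<forall>r\<in>I. v r y0 = 0")
    case True
    obtain c where "\<exists>r\<in>I. c r \<noteq> 0" "\<forall>y\<in>J. (\<Sum>r\<in>I. c r * v r y) = 0"
      using insert.IH[of I v] insert.prems insert.hyps by auto
    then show ?thesis using True by (intro exI[of _ c]) auto
  next
    case False
    then obtain r0 where r0: "r0 \<in> I" "v r0 y0 \<noteq> 0" by blast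
    define w where "w r y = v r y - v r y0 / v r0 y0 * v r0 y" for r y
    have "card J < card (I - {r0})"
      using insert.prems insert.hyps r0 card_Diff_singleton[OF r0(1)] by simp
    then obtain c where c: "\<exists>r\<in>I - {r0}. c r \<noteq> 0" "\<And>y. y \<in> J \<Longrightarrow> (\<Sum>r\<in>I - {r0}. c r * w r y) = 0"
      using insert.IH[of "I - {r0}" w] insert.prems by auto
    \<comment> \<open>The pivot unknown is determined by the equation \<open>y0\<close>;
      substituting it into the other equations turns the coefficients v into w.\<close>
    define c' where "c' r = (if r = r0 then - (\<Sum>r\<in>I - {r0}. c r * v r y0) / v r0 y0 else c r)" for r
    have eq: "(\<Sum>r\<in>I. c' r * v r y) = (\<Sum>r\<in>I - {r0}. c r * w r y)" for y
    proof -
      have "(\<Sum>r\<in>I. c' r * v r y) = c' r0 * v r0 y + (\<Sum>r\<in>I - {r0}. c' r * v r y)"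
        using insert.prems r0 by (intro sum.remove) auto
      also have "(\<Sum>r\<in>I - {r0}. c' r * v r y) = (\<Sum>r\<in>I - {r0}. c r * v r y)"
        by (rule sum.cong) (auto simp: c'_def)
      also have "c' r0 * v r0 y = - (\<Sum>r\<in>I - {r0}. c r * (v r y0 / v r0 y0 * v r0 y))"
        by (simp add: c'_def sum_distrib_left sum_divide_distrib mult_ac)
      finally show ?thesis by (simp add: w_def right_diff_distrib sum_subtractf)
    qed
    have "w r y0 = 0" for r using r0 by (simp add: w_def)
    then have "\<forall>y\<in>insert y0 J. (\<Sum>r\<in>I. c' r * v r y) = 0" using eq c(2) by simp
    moreover have "\<exists>r\<in>I. c' r \<noteq> 0" using c(1) by (auto simp: c'_def)
    ultimately show ?thesis by blast
  qed
qed

text \<open>The commutator of d with multiplication by c is multiplication by d c, which has order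
  less than 1.\<close>

lemma derivation_diff_op:
  assumes i: "field_embedding i"
    and d: "\<And>x y. d (x + y) = d x + d y" "\<And>x y. d (x * y) = x * d y + d x * y" "\<And>l. d (i l) = 0"
  shows "d \<in> carrier (diff_op_ring i)"
proof -
  have "(\<lambda>x. d c * x) \<in> rel_ops id id 1" for c by (rule mult_op_rel_ops)
  then have "d \<in> rel_ops id id (Suc 1)"
    by (intro rel_ops_SucI) (simp_all add: d(1,2) id_def)
  then show ?thesis unfolding carrier_diff_op_ring[OF i] using d(2,3) by auto
qed

locale simple_galois_module = galois_module i j \<sigma> p N
  for i :: "'k::{alg_closed_field, field_char_0} \<Rightarrow> 'a::field_char_0" and j :: "'a \<Rightarrow> 'b::field_char_0"
    and \<sigma> p and N :: "('a \<Rightarrow> 'a, 'n) module" (structure) +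
  assumes N_simple: "simple_module (diff_op_ring i) N" and N_fin: "fin_dim_diff_module N"
    and p_prime: "Factorial_Ring.prime p"
begin

section \<open>Endomorphisms of N are scalars in k\<close>

abbreviation "sm c x \<equiv> mult_op c \<odot> x"

definition N_end :: "('n \<Rightarrow> 'n) \<Rightarrow> bool" where
  "N_end f \<longleftrightarrow> add_hom N N f \<and> (\<forall>P\<in>carrier DK. \<forall>x\<in>carrier N. f (P \<odot> x) = P \<odot> f x)"

lemma N_endD:
  assumes "N_end f"
  shows "add_hom N N f" "x \<in> carrier N \<Longrightarrow> f x \<in> carrier N"
    "P \<in> carrier DK \<Longrightarrow> x \<in> carrier N \<Longrightarrow> f (P \<odot> x) = P \<odot> f x"
  using assms by (auto simp: N_end_def add_hom_def)

lemma N_end_pow: "N_end f \<Longrightarrow> N_end (f ^^ r)"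
proof (induction r)
  case 0
  show ?case by (auto simp: N_end_def intro: add_homI)
next
  case (Suc r)
  then have r: "N_end (f ^^ r)" by blast
  have "add_hom N N (\<lambda>x. f ((f ^^ r) x))" by (rule add_hom_comp[OF N_endD(1)[OF r] N_endD(1)[OF Suc.prems]])
  then show ?case
    unfolding N_end_def
    by (auto simp: comp_def N_endD(2,3)[OF r] N_endD(3)[OF Suc.prems])
qed

lemma sm_simps:
  "x \<in> carrier N \<Longrightarrow> sm c x \<in> carrier N"
  "x \<in> carrier N \<Longrightarrow> sm (c + d) x = sm c x \<oplus> sm d x"
  "x \<in> carrier N \<Longrightarrow> sm (c * d) x = sm c (sm d x)"
  "x \<in> carrier N \<Longrightarrow> sm 1 x = x"
  "x \<in> carrier N \<Longrightarrow> sm 0 x = \<zero>"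
  using N_smult(2)[OF mult_op_DK mult_op_DK, of x c d] N_smult(4)[OF mult_op_DK mult_op_DK, of x c d]
  by (simp_all add: N_smult(1,5) N_smult_zero distrib_right mult.assoc)

lemma sm_commute: "x \<in> carrier N \<Longrightarrow> sm c (sm d x) = sm d (sm c x)"
proof -
  have "(\<lambda>y. c * (d * y)) = (\<lambda>y. d * (c * y))" by (simp add: mult.left_commute)
  then show "x \<in> carrier N \<Longrightarrow> ?thesis"
    using N_smult(4)[OF mult_op_DK mult_op_DK, of x c d] N_smult(4)[OF mult_op_DK mult_op_DK, of x d c] by simp
qed

lemma sm_add_hom: "add_hom N N (sm c)"
  by (rule N_add_hom[OF mult_op_DK])

lemma sm_finsum: "finite A \<Longrightarrow> (\<And>s. s \<in> A \<Longrightarrow> g s \<in> carrier N) \<Longrightarrow>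
    sm c (\<Oplus>s\<in>A. g s) = (\<Oplus>s\<in>A. sm c (g s))"
  by (rule add_hom_finsum[OF N_abelian N_abelian sm_add_hom])

lemma sm_sum: "finite A \<Longrightarrow> x \<in> carrier N \<Longrightarrow> sm (\<Sum>s\<in>A. c s) x = (\<Oplus>s\<in>A. sm (c s) x)"
  by (induction A rule: finite_induct) (simp_all add: sm_simps N.finsum_insert)

lemma sm_zero: "sm c \<zero> = \<zero>"
  by (rule add_hom_zero[OF N_abelian N_abelian sm_add_hom])

text \<open>The coefficients lie in K, and multiplication by them is in general not D_K-linear; that
  coefficients in k can be had comes from \<open>rel_derivation\<close>.\<close>

definition rel :: "('n \<Rightarrow> 'n) \<Rightarrow> nat \<Rightarrow> (nat \<Rightarrow> 'a) \<Rightarrow> bool" where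
  "rel f n c \<longleftrightarrow> (\<forall>x\<in>carrier N. (\<Oplus>r\<in>{..n}. sm (c r) ((f ^^ r) x)) = \<zero>)"

text \<open>With respect to a finite spanning set B, powers of f have matrices with
  \<open>card (B \<times> B)\<close> entries, and one more power than that makes them dependent over
  K. As B need not be a basis, the matrices are merely chosen; a relation between them suffices,
  because it kills B and \<open>E\<close> is K-linear.\<close>

lemma rel_exists:
  assumes f: "N_end f"
  obtains n c where "rel f n c" "\<exists>r\<le>n. c r \<noteq> 0"
proof -
  obtain B where B: "finite B" "B \<subseteq> carrier N"
    and span: "\<And>x. x \<in> carrier N \<Longrightarrow> \<exists>c. x = (\<Oplus>b\<in>B. sm (c b) b)"
    using N_fin by (auto simp: fin_dim_diff_module_def)
  note cl = N_endD(2)[OF N_end_pow[OF f]]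
  have "\<forall>r b. \<exists>c. b \<in> B \<longrightarrow> (f ^^ r) b = (\<Oplus>b'\<in>B. sm (c b') b')"
    using span cl B(2) by blast
  then obtain A where A: "\<And>r b. b \<in> B \<Longrightarrow> (f ^^ r) b = (\<Oplus>b'\<in>B. sm (A r b b') b')" by metis
  define n where "n = card (B \<times> B)"
  have "card (B \<times> B) < card {..n}" by (simp add: n_def)
  then obtain c where c: "\<exists>r\<in>{..n}. c r \<noteq> 0"
    "\<forall>y\<in>B \<times> B. (\<Sum>r\<in>{..n}. c r * (case y of (b, b') \<Rightarrow> A r b b')) = 0"
    using homogeneous_system_solution[of "B \<times> B" "{..n}" "\<lambda>r y. case y of (b, b') \<Rightarrow> A r b b'"] B(1)
    by auto
  define E where "E x = (\<Oplus>r\<in>{..n}. sm (c r) ((f ^^ r) x))" for x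
  have E_hom: "add_hom N N E"
    unfolding E_def[abs_def]
    by (intro add_hom_finsum_fun N_abelian) (auto intro: add_hom_comp[OF N_endD(1)[OF N_end_pow[OF f]] sm_add_hom])
  have E_sm: "E (sm a x) = sm a (E x)" if x: "x \<in> carrier N" for a x
  proof -
    have "sm (c r) ((f ^^ r) (sm a x)) = sm a (sm (c r) ((f ^^ r) x))" for r
      unfolding N_endD(3)[OF N_end_pow[OF f] mult_op_DK x] by (rule sm_commute[OF cl[OF x]])
    then show ?thesis using x cl by (simp add: E_def sm_finsum sm_simps)
  qed
  have E_B: "E b = \<zero>" if b: "b \<in> B" for b
  proof -
    have Bc: "b' \<in> B \<Longrightarrow> b' \<in> carrier N" for b' using B(2) by blast
    have "E b = (\<Oplus>r\<in>{..n}. \<Oplus>b'\<in>B. sm (c r * A r b b') b')"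
      unfolding E_def
    proof (rule N.finsum_cong')
      fix r
      have "sm (c r) ((f ^^ r) b) = (\<Oplus>b'\<in>B. sm (c r) (sm (A r b b') b'))"
        unfolding A[OF b] by (rule sm_finsum) (auto simp: B sm_simps Bc)
      also have "\<dots> = (\<Oplus>b'\<in>B. sm (c r * A r b b') b')"
        by (rule N.finsum_cong') (auto simp: sm_simps Bc)
      finally show "sm (c r) ((f ^^ r) b) = (\<Oplus>b'\<in>B. sm (c r * A r b b') b')" .
    qed (auto intro!: N.finsum_closed simp: sm_simps Bc)
    also have "\<dots> = (\<Oplus>b'\<in>B. \<Oplus>r\<in>{..n}. sm (c r * A r b b') b')"
      by (rule N.finsum_swap) (auto simp: B sm_simps Bc)
    also have "\<dots> = (\<Oplus>b'\<in>B. \<zero>)"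
    proof (rule N.finsum_cong')
      fix b' assume b': "b' \<in> B"
      have "(\<Oplus>r\<in>{..n}. sm (c r * A r b b') b') = sm (\<Sum>r\<in>{..n}. c r * A r b b') b'"
        using Bc[OF b'] by (simp add: sm_sum)
      also have "(\<Sum>r\<in>{..n}. c r * A r b b') = 0" using c(2) b b' by auto
      finally show "(\<Oplus>r\<in>{..n}. sm (c r * A r b b') b') = \<zero>" using N_smult_zero[OF Bc[OF b']] by simp
    qed auto
    finally show ?thesis by (simp add: N.finsum_zero)
  qed
  have "E x = \<zero>" if x: "x \<in> carrier N" for x
  proof -
    obtain a where a: "x = (\<Oplus>b\<in>B. sm (a b) b)" using span[OF x] by blast
    have Bc: "b \<in> B \<Longrightarrow> b \<in> carrier N" for b using B(2) by blast
    have "E x = (\<Oplus>b\<in>B. E (sm (a b) b))"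
      unfolding a by (rule add_hom_finsum[OF N_abelian N_abelian E_hom B(1)]) (simp add: sm_simps Bc)
    also have "\<dots> = (\<Oplus>b\<in>B. \<zero>)"
      by (rule N.finsum_cong') (auto simp: E_sm Bc E_B sm_zero)
    finally show ?thesis by (simp add: N.finsum_zero)
  qed
  then have "rel f n c" by (simp add: rel_def E_def)
  then show thesis using that c(1) by auto
qed

lemma rel_truncate:
  assumes f: "N_end f" and "rel f n c" and "r0 \<le> n" and "\<And>r. r0 < r \<Longrightarrow> r \<le> n \<Longrightarrow> c r = 0"
  shows "rel f r0 c"
  unfolding rel_def
proof
  fix x assume x: "x \<in> carrier N"
  note cl = N_endD(2)[OF N_end_pow[OF f] x]
  have "{..n} = {..r0} \<union> {r0<..n}" using assms(3) by auto
  then have "(\<Oplus>r\<in>{..n}. sm (c r) ((f ^^ r) x)) =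
      (\<Oplus>r\<in>{..r0}. sm (c r) ((f ^^ r) x)) \<oplus> (\<Oplus>r\<in>{r0<..n}. sm (c r) ((f ^^ r) x))"
    by (simp only:) (rule N.finsum_Un_disjoint, auto simp: sm_simps cl)
  also have "(\<Oplus>r\<in>{r0<..n}. sm (c r) ((f ^^ r) x)) = (\<Oplus>r\<in>{r0<..n}. \<zero>)"
    by (rule N.finsum_cong') (auto simp: assms(4) N_smult_zero cl)
  also have "(\<Oplus>r\<in>{..r0}. sm (c r) ((f ^^ r) x)) \<oplus> (\<Oplus>r\<in>{r0<..n}. \<zero>) =
      (\<Oplus>r\<in>{..r0}. sm (c r) ((f ^^ r) x))"
    using cl by (simp add: N.finsum_zero sm_simps N.finsum_closed)
  finally show "(\<Oplus>r\<in>{..r0}. sm (c r) ((f ^^ r) x)) = \<zero>"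
    using assms(2) x by (simp add: rel_def)
qed

lemma rel_scale:
  assumes f: "N_end f" and "rel f n c"
  shows "rel f n (\<lambda>r. a * c r)"
  unfolding rel_def
proof
  fix x assume x: "x \<in> carrier N"
  note cl = N_endD(2)[OF N_end_pow[OF f] x]
  have "(\<Oplus>r\<in>{..n}. sm (a * c r) ((f ^^ r) x)) = sm a (\<Oplus>r\<in>{..n}. sm (c r) ((f ^^ r) x))"
    by (subst sm_finsum) (auto simp: sm_simps cl)
  then show "(\<Oplus>r\<in>{..n}. sm (a * c r) ((f ^^ r) x)) = \<zero>"
    using assms(2) x by (simp add: rel_def sm_zero)
qed

lemma rel_monic:
  assumes f: "N_end f" and "rel f n c" and "\<exists>r\<le>n. c r \<noteq> 0"
  obtains m b where "m \<le> n" "rel f m b" "b m = 1" "c m \<noteq> 0"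
proof -
  define m where "m = (GREATEST r. r \<le> n \<and> c r \<noteq> 0)"
  have m: "m \<le> n \<and> c m \<noteq> 0"
    unfolding m_def using assms(3) by (rule GreatestI_ex_nat[where b = n]) simp
  have "c r = 0" if "m < r" "r \<le> n" for r
    using Greatest_le_nat[of "\<lambda>r. r \<le> n \<and> c r \<noteq> 0" r n] that by (auto simp: m_def[symmetric])
  then have "rel f m c" using rel_truncate[OF f assms(2)] m by blast
  then have "rel f m (\<lambda>r. inverse (c m) * c r)" by (rule rel_scale[OF f])
  then show thesis using m by (intro that[of m "\<lambda>r. inverse (c m) * c r"]) auto
qed

text \<open>Apply d to the relation at x. By the Leibniz rule, and since d commutes with f, the
  result is the original relation at d x, which is zero, plus the relation with differentiated
  coefficients.\<close>

lemma rel_derivation: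
  assumes f: "N_end f" and c: "rel f n c"
    and d: "\<And>x y. d (x + y) = d x + d y" "\<And>x y. d (x * y) = x * d y + d x * y" "\<And>l. d (i l) = 0"
  shows "rel f n (\<lambda>r. d (c r))"
  unfolding rel_def
proof
  fix x assume x: "x \<in> carrier N"
  note cl = N_endD(2)[OF N_end_pow[OF f]]
  have D: "d \<in> carrier DK" by (rule derivation_diff_op[OF emb_i d])
  have dx: "d \<odot> x \<in> carrier N" by (rule N_smult(1)[OF D x])
  have trm: "d \<odot> sm a y = sm a (d \<odot> y) \<oplus> sm (d a) y" if y: "y \<in> carrier N" for a y
  proof -
    have "d \<odot> sm a y = (\<lambda>z. a * d z + d a * z) \<odot> y"
      using N_smult(4)[OF D mult_op_DK y, of a] by (simp add: d(2))
    then show ?thesis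
      using N_smult(2)[OF left_mult_diff_op[OF emb_i D] mult_op_DK y, of a "d a"] N_smult(4)[OF mult_op_DK D y, of a] by simp
  qed
  have "\<zero> = d \<odot> (\<Oplus>r\<in>{..n}. sm (c r) ((f ^^ r) x))"
    using c x add_hom_zero[OF N_abelian N_abelian N_add_hom[OF D]] by (simp add: rel_def)
  also have "\<dots> = (\<Oplus>r\<in>{..n}. d \<odot> sm (c r) ((f ^^ r) x))"
    by (rule add_hom_finsum[OF N_abelian N_abelian N_add_hom[OF D]]) (auto simp: sm_simps cl x)
  also have "\<dots> = (\<Oplus>r\<in>{..n}. sm (c r) ((f ^^ r) (d \<odot> x)) \<oplus> sm (d (c r)) ((f ^^ r) x))"
    by (rule N.finsum_cong') (auto simp: trm cl x sm_simps dx N_endD(3)[OF N_end_pow[OF f] D x, symmetric])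
  also have "\<dots> = (\<Oplus>r\<in>{..n}. sm (c r) ((f ^^ r) (d \<odot> x))) \<oplus> (\<Oplus>r\<in>{..n}. sm (d (c r)) ((f ^^ r) x))"
    by (rule N.finsum_addf) (auto simp: sm_simps cl x dx)
  also have "(\<Oplus>r\<in>{..n}. sm (c r) ((f ^^ r) (d \<odot> x))) = \<zero>"
    using c dx by (simp add: rel_def)
  finally show "(\<Oplus>r\<in>{..n}. sm (d (c r)) ((f ^^ r) x)) = \<zero>"
    using N.l_zero[OF N.finsum_closed] cl x by (simp add: sm_simps)
qed

text \<open>The coefficients of a minimal monic relation \<open>\<Sum>\<^sub>r c\<^sub>r f\<^sup>r = 0\<close> over \<open>K\<close> are annihilated by all
  derivations, hence lie in \<open>k\<close>; a root in \<open>k\<close> of the corresponding polynomial is an eigenvalue of \<open>f\<close>.\<close>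

lemma N_schur:
  assumes f: "N_end f"
  obtains a where "\<And>x. x \<in> carrier N \<Longrightarrow> f x = sm (i a) x"
proof -
  note cl = N_endD(2)[OF N_end_pow[OF f]]
  have ex: "\<exists>n c. rel f n c \<and> c n = 1"
    using rel_exists[OF f] rel_monic[OF f] by metis
  define n where "n = (LEAST n. \<exists>c. rel f n c \<and> c n = 1)"
  have "\<exists>c. rel f n c \<and> c n = 1" unfolding n_def by (rule LeastI_ex[OF ex])
  then obtain c where c: "rel f n c" "c n = 1" by blast
  have min: "n \<le> m" if "rel f m b" "b m = 1" for m b
    unfolding n_def by (rule Least_le) (use that in blast)
  have const: "c r \<in> range i" if "r \<le> n" for r
  proof (rule ccontr)
    assume "c r \<notin> range i"
    then obtain d where d: "\<And>x y. d (x + y) = d x + d y" "\<And>x y. d (x * y) = x * d y + d x * y"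
      "\<And>l. d (i l) = 0" "d (c r) = 1"
      using derivation_exists[OF emb_i] by metis
    have rel: "rel f n (\<lambda>r. d (c r))" by (rule rel_derivation[OF f c(1) d(1-3)])
    have "\<exists>r\<le>n. d (c r) \<noteq> 0" using that d(4) by (intro exI[of _ r]) simp
    then obtain m b where m: "m \<le> n" "rel f m b" "b m = 1" "d (c m) \<noteq> 0" using rel_monic[OF f rel] by blast
    \<comment> \<open>By minimality the differentiated relation must have a nonzero coefficient at
      n, but there the coefficient is d 1 = 0.\<close>
    then have "m = n" using min[OF m(2,3)] by simp
    then have "d (c m) = d (i 1)" using c(2) by (simp add: field_embeddingD[OF emb_i])
    then show False using m(4) d(3) by simp
  qed
  have N_nz: "carrier N \<noteq> {\<zero>}" using N_simple by (simp add: simple_module_def)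
  have "n \<noteq> 0"
  proof
    assume "n = 0"
    then have "x = \<zero>" if "x \<in> carrier N" for x using c that by (simp add: rel_def sm_simps)
    then show False using N_nz N.zero_closed by blast
  qed
  then obtain m where m: "n = Suc m" by (cases n) auto
  have "\<exists>q. c r = i q" if "r \<le> n" for r using const[OF that] by auto
  then obtain q where q: "\<And>r. r \<le> n \<Longrightarrow> c r = i (q r)" by metis
  have "i (q n) = i 1" using q[of n] c(2) by (simp add: field_embeddingD[OF emb_i])
  then have qn: "q n = 1" using field_embeddingD(8)[OF emb_i] by (simp add: inj_eq)
  obtain l where l: "(\<Sum>r\<le>n. q r * l ^ r) = 0"
    using alg_closed[of n q] qn \<open>n \<noteq> 0\<close> by auto
  define Q where "Q = (\<Sum>r\<le>n. monom (q r) r)"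
  have coeff_Q: "coeff Q r = (if r \<le> n then q r else 0)" for r
    by (simp add: Q_def coeff_sum)
  have "poly Q l = 0" using l by (simp add: Q_def poly_sum poly_monom)
  then obtain h where h: "Q = [:- l, 1:] * h" using poly_eq_0_iff_dvd[of Q l] by (auto simp: dvd_def)
  have degQ: "degree Q = n"
    by (rule antisym[OF degree_le le_degree]) (auto simp: coeff_Q qn)
  then have "Q \<noteq> 0" using \<open>n \<noteq> 0\<close> by auto
  then have h0: "h \<noteq> 0" using h by auto
  have degh: "degree h = m"
    using degree_mult_eq[of "[:- l, 1:]" h] h0 degQ m unfolding h by (simp del: mult_pCons_left)
  have q0: "q 0 = - l * coeff h 0" using coeff_Q[of 0] by (simp add: h)
  have qS: "q (Suc r) = coeff h r - l * coeff h (Suc r)" if "r \<le> m" for r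
    using coeff_Q[of "Suc r"] that m by (simp add: h)
  have hm: "coeff h m = 1" using qS[of m] qn m degh by (simp add: coeff_eq_0)
  \<comment> \<open>This is h(f) x, where the relation polynomial is (X - l) h; hence f - l kills
    it.\<close>
  define y where "y x = (\<Oplus>r\<in>{..m}. sm (i (coeff h r)) ((f ^^ r) x))" for x
  have y_cl: "y x \<in> carrier N" if "x \<in> carrier N" for x
    unfolding y_def using that cl by (auto intro!: N.finsum_closed simp: sm_simps)
  have fy: "f (y x) = sm (i l) (y x)" if x: "x \<in> carrier N" for x
  proof -
    note clx = cl[OF x]
    have "f (y x) = (\<Oplus>r\<in>{..m}. f (sm (i (coeff h r)) ((f ^^ r) x)))"
      unfolding y_def by (rule add_hom_finsum[OF N_abelian N_abelian N_endD(1)[OF f]]) (auto simp: sm_simps clx)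
    also have "\<dots> = (\<Oplus>r\<in>{..m}. sm (i (coeff h r)) ((f ^^ Suc r) x))"
      by (rule N.finsum_cong') (auto simp: sm_simps clx N_endD(2,3)[OF f])
    finally have fyx: "f (y x) = (\<Oplus>r\<in>{..m}. sm (i (coeff h r)) ((f ^^ Suc r) x))" .
    have lyx: "sm (i (- l)) (y x) = (\<Oplus>r\<in>{..n}. sm (i (- l * coeff h r)) ((f ^^ r) x))"
    proof -
      have "sm (i (- l)) (y x) = (\<Oplus>r\<in>{..m}. sm (i (- l)) (sm (i (coeff h r)) ((f ^^ r) x)))"
        unfolding y_def by (rule sm_finsum) (auto simp: sm_simps clx)
      also have "\<dots> = (\<Oplus>r\<in>{..m}. sm (i (- l * coeff h r)) ((f ^^ r) x))"
        by (rule N.finsum_cong') (auto simp: sm_simps clx field_embeddingD(2)[OF emb_i] simp del: mult_minus_left)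
      also have "\<dots> = (\<Oplus>r\<in>{..n}. sm (i (- l * coeff h r)) ((f ^^ r) x))"
      proof -
        have "coeff h n = 0" using degh m by (simp add: coeff_eq_0)
        then show ?thesis unfolding m atMost_Suc
          by (subst N.finsum_insert) (auto simp: sm_simps clx m field_embeddingD[OF emb_i]  N_endD(2)[OF f] intro!: N.finsum_closed)
      qed
      finally show ?thesis .
    qed
    have "(\<Oplus>r\<in>{..n}. sm (c r) ((f ^^ r) x)) = f (y x) \<oplus> sm (i (- l)) (y x)"
    proof -
      \<comment> \<open>The sum for f (y x), shifted by one place and padded with zero at r = 0, for
        comparison with the relation term by term.\<close>
      define g where "g r = (case r of 0 \<Rightarrow> \<zero> | Suc r \<Rightarrow> sm (i (coeff h r)) ((f ^^ Suc r) x))" for r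
      have g_cl: "g r \<in> carrier N" for r unfolding g_def using clx[of "Suc _"] by (auto split: nat.split simp: sm_simps simp del: funpow.simps)
      have gsum: "(\<Oplus>r\<in>{..n}. g r) = f (y x)"
      proof -
        have "{..n} = insert 0 (Suc ` {..m})" unfolding m by (simp add: atMost_Suc_eq_insert_0)
        then have "(\<Oplus>r\<in>{..n}. g r) = g 0 \<oplus> (\<Oplus>r\<in>Suc ` {..m}. g r)"
          by (simp only:) (rule N.finsum_insert, auto simp: g_cl)
        also have "(\<Oplus>r\<in>Suc ` {..m}. g r) = (\<Oplus>r\<in>{..m}. g (Suc r))"
          by (rule N.finsum_reindex) (auto simp: g_cl)
        also have "\<dots> = f (y x)" unfolding fyx by (simp add: g_def)
        finally show ?thesis using y_cl[OF x] N_endD(2)[OF f] by (simp add: g_def)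
      qed
      have "sm (c r) ((f ^^ r) x) = g r \<oplus> sm (i (- l * coeff h r)) ((f ^^ r) x)" if "r \<le> n" for r
      proof (cases r)
        case 0
        then show ?thesis using x q[of 0] q0 by (simp add: g_def sm_simps)
      next
        case (Suc s)
        have "c r = i (coeff h s) + i (- l * coeff h r)"
          using q[OF that] qS[of s] that m Suc by (simp add: field_embeddingD[OF emb_i])
        then show ?thesis using clx[of r] by (simp add: g_def Suc sm_simps del: funpow.simps mult_minus_left)
      qed
      then have "(\<Oplus>r\<in>{..n}. sm (c r) ((f ^^ r) x)) =
          (\<Oplus>r\<in>{..n}. g r \<oplus> sm (i (- l * coeff h r)) ((f ^^ r) x))"
        using g_cl clx by (intro N.finsum_cong') (auto simp: sm_simps simp del: mult_minus_left)
      also have "\<dots> = (\<Oplus>r\<in>{..n}. g r) \<oplus> (\<Oplus>r\<in>{..n}. sm (i (- l * coeff h r)) ((f ^^ r) x))"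
        by (rule N.finsum_addf) (auto simp: g_cl sm_simps clx)
      finally show ?thesis unfolding gsum lyx[symmetric] .
    qed
    then have zero: "f (y x) \<oplus> sm (i (- l)) (y x) = \<zero>" using c(1) x by (simp add: rel_def)
    have "sm (i l) (y x) \<oplus> sm (i (- l)) (y x) = sm (i l + i (- l)) (y x)"
      using sm_simps(2)[OF y_cl[OF x]] by simp
    also have "\<dots> = \<zero>" using sm_simps(5)[OF y_cl[OF x]] by (simp add: field_embeddingD[OF emb_i])
    finally have "f (y x) \<oplus> sm (i (- l)) (y x) = sm (i l) (y x) \<oplus> sm (i (- l)) (y x)" using zero by simp
    then show ?thesis using N.add.r_cancel N_endD(2)[OF f y_cl[OF x]] sm_simps(1)[OF y_cl[OF x]] by blast
  qed
  \<comment> \<open>As h is monic of degree below n, minimality forbids h(f) = 0, and some value of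
    \<open>y\<close> is an eigenvector.\<close>
  have "\<not> rel f m (\<lambda>r. i (coeff h r))"
    using min[of m "\<lambda>r. i (coeff h r)"] hm m by (auto simp: field_embeddingD[OF emb_i])
  then obtain x0 where x0: "x0 \<in> carrier N" "y x0 \<noteq> \<zero>" by (auto simp: rel_def y_def)
  \<comment> \<open>The eigenspace is D_K-stable because l comes from k, with which all operators
    commute; simplicity of N then makes it everything.\<close>
  define H where "H = {x \<in> carrier N. f x = sm (i l) x}"
  have il: "P \<odot> sm (i l) x = sm (i l) (P \<odot> x)" if P: "P \<in> carrier DK" and x: "x \<in> carrier N" for P x
  proof -
    have "(\<lambda>y. P (i l * y)) = (\<lambda>y. i l * P y)" using P unfolding carrier_diff_op_ring[OF emb_i] by auto
    then show ?thesis using N_smult(4)[OF P mult_op_DK x, of "i l"] N_smult(4)[OF mult_op_DK P x, of "i l"] by simp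
  qed
  have "submodule H DK N"
    unfolding left_module.submodule_iff[OF N_module] H_def
    using add_hom_zero[OF N_abelian N_abelian N_endD(1)[OF f]]
    by (auto simp: sm_zero add_hom_add[OF N_endD(1)[OF f]] add_hom_add[OF sm_add_hom] N_smult(1) N_endD(3)[OF f] il)
  then have "H = {\<zero>} \<or> H = carrier N" using N_simple by (auto simp: simple_module_def)
  moreover have "y x0 \<in> H" using x0 y_cl fy by (simp add: H_def)
  ultimately have "H = carrier N" using x0 by auto
  then show thesis by (intro that[of l]) (auto simp: H_def)
qed

section \<open>Descent of submodules and endomorphisms to N\<close>

lemma submodule_eq_pullback:
  assumes W: "submodule W DL M" and 1: "\<And>x. x \<in> carrier N \<Longrightarrow> tens 1 x \<in> W"
  shows "W = carrier M"
proof -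
  note Wc = left_module.submoduleD[OF M_module W]
  have "m \<in> W" if "m \<in> carrier M" for m
    using that
  proof (induction m rule: tens_induct)
    case (tens a x)
    then show ?case using Wc(5)[OF mult_op_DL 1[OF tens], of a] tens_mult[OF tens, of a] by simp
  qed (rule Wc(4))
  then show ?thesis using Wc(1) by blast
qed

text \<open>The x with 1 \<otimes> x in W form a D_K-submodule of N, since operators on K extend to
  L. If it is zero, stability under \<open>sig\<close> puts 1 \<otimes> Tr m into W, so
  \<open>Tr\<close> vanishes on W and \<open>M_expansion\<close> gives W = 0. If it is N, then W
  contains generators of M.\<close>

lemma irreducible_pullback:
  assumes W: "submodule W DL M" and stable: "sig ` W \<subseteq> W"
  shows "W = {\<zero>\<^bsub>M\<^esub>} \<or> W = carrier M"
proof -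
  interpret M: left_module DL M by (rule M_module)
  note Wc = M.submoduleD[OF W]
  define U where "U = {x \<in> carrier N. tens 1 x \<in> W}"
  have "submodule U DK N"
    unfolding left_module.submodule_iff[OF N_module]
  proof (intro conjI ballI)
    show "U \<subseteq> carrier N" by (auto simp: U_def)
    show "\<zero> \<in> U" using Wc(2) by (simp add: U_def tens_zero_right)
    show "x \<oplus> y \<in> U" if "x \<in> U" "y \<in> U" for x y
      using that Wc(4) by (simp add: U_def tens_add_right)
    show "P \<odot> x \<in> U" if P: "P \<in> carrier DK" and x: "x \<in> U" for P x
    proof -
      obtain R where R: "R \<in> carrier DL" "R \<circ> j = j \<circ> P" using diff_op_extend[OF P] .
      have "R \<odot>\<^bsub>M\<^esub> tens 1 x = tens 1 (P \<odot> x)" using extend_smult[OF R(1) P R(2)] x by (simp add: U_def)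
      then show ?thesis using Wc(5)[OF R(1), of "tens 1 x"] x P by (simp add: U_def N_smult)
    qed
  qed
  then have "U = {\<zero>} \<or> U = carrier N" using N_simple by (auto simp: simple_module_def)
  then show ?thesis
  proof
    assume U0: "U = {\<zero>}"
    have Tr0: "Tr m = \<zero>" if m: "m \<in> W" for m
    proof -
      have "(sig ^^ r) m \<in> W" for r using m stable by (induction r) auto
      then have "tens 1 (Tr m) \<in> W"
        unfolding tens_Tr[OF Wc(3)[OF m]] by (intro M.submodule_finsum[OF W]) auto
      then have "Tr m \<in> U" using add_hom_closed[OF Tr(1) Wc(3)[OF m]] by (simp add: U_def)
      then show ?thesis using U0 by simp
    qed
    have "m = \<zero>\<^bsub>M\<^esub>" if m: "m \<in> W" for m
    proof -
      have "m = (\<Oplus>\<^bsub>M\<^esub>s\<in>I. tens (\<alpha> s) (Tr (mult_op (\<beta> s) \<odot>\<^bsub>M\<^esub> m)))" by (rule M_expansion[OF Wc(3)[OF m]])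
      also have "\<dots> = (\<Oplus>\<^bsub>M\<^esub>s\<in>I. \<zero>\<^bsub>M\<^esub>)" using Tr0[OF Wc(5)[OF mult_op_DL m]] by (simp add: tens_zero_right)
      finally show ?thesis by (simp add: M.finsum_zero)
    qed
    then show ?thesis using Wc(2) by blast
  next
    assume "U = carrier N"
    then have 1: "tens 1 x \<in> W" if "x \<in> carrier N" for x using that by (auto simp: U_def)
    then show ?thesis using submodule_eq_pullback[OF W] by blast
  qed
qed

text \<open>Since f commutes with \<open>sig\<close>, it maps 1 \<otimes> x to a fixed vector, that
  is, to some 1 \<otimes> g x. Extending operators from K to L shows that g is D_K-linear, hence a
  scalar in k, and f is determined by its values on the 1 \<otimes> x.\<close>

lemma schur_pullback:
  assumes f: "add_hom M M f" "\<And>Q m. Q \<in> carrier DL \<Longrightarrow> m \<in> carrier M \<Longrightarrow> f (Q \<odot>\<^bsub>M\<^esub> m) = Q \<odot>\<^bsub>M\<^esub> f m"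
    and comm: "\<And>m. m \<in> carrier M \<Longrightarrow> f (sig m) = sig (f m)"
  shows "\<exists>a. \<forall>m\<in>carrier M. f m = mult_op (j (i a)) \<odot>\<^bsub>M\<^esub> m"
proof -
  define g where "g x = sm inv_p (Tr (f (tens 1 x)))" for x
  have g_hom: "add_hom N N g"
    unfolding g_def[abs_def]
    by (rule add_hom_comp[OF add_hom_comp[OF add_hom_comp[OF tens_add_hom f(1)] Tr(1)] sm_add_hom])
  note g_cl = add_hom_closed[OF g_hom]
  have fg: "f (tens 1 x) = tens 1 (g x)" if x: "x \<in> carrier N" for x
  proof -
    have "sig (f (tens 1 x)) = f (tens 1 x)"
      using x by (simp add: comm[symmetric] sig(2) field_embeddingD[OF emb_\<sigma>])
    then show ?thesis unfolding g_def using x by (intro sig_fixed add_hom_closed[OF f(1)]) auto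
  qed
  have "N_end g"
    unfolding N_end_def
  proof (intro conjI ballI g_hom)
    fix P x assume P: "P \<in> carrier DK" and x: "x \<in> carrier N"
    obtain R where R: "R \<in> carrier DL" "R \<circ> j = j \<circ> P" using diff_op_extend[OF P] .
    have "tens 1 (g (P \<odot> x)) = f (R \<odot>\<^bsub>M\<^esub> tens 1 x)"
      using fg[OF N_smult(1)[OF P x]] extend_smult[OF R(1) P R(2) x] by simp
    also have "\<dots> = tens 1 (P \<odot> g x)"
      using f(2)[OF R(1)] x fg[OF x] extend_smult[OF R(1) P R(2) g_cl[OF x]] by simp
    finally show "g (P \<odot> x) = P \<odot> g x"
      by (intro tens_1_inj g_cl N_smult P x)
  qed
  then obtain a where a: "\<And>x. x \<in> carrier N \<Longrightarrow> g x = sm (i a) x" using N_schur by blast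
  have "f m = mult_op (j (i a)) \<odot>\<^bsub>M\<^esub> m" if m: "m \<in> carrier M" for m
  proof (rule add_hom_eqI[OF f(1) M_smult_add_hom[OF mult_op_DL] _ m])
    fix l x assume x: "x \<in> carrier N"
    have "f (tens l x) = mult_op l \<odot>\<^bsub>M\<^esub> tens 1 (sm (i a) x)"
      using x by (simp add: tens_mult[of x l] f(2) fg a)
    also have "\<dots> = tens (l * j (i a)) x"
      using x by (simp add: M_mult_op_tens N_smult tens_balanced)
    finally show "f (tens l x) = mult_op (j (i a)) \<odot>\<^bsub>M\<^esub> tens l x"
      using x by (simp add: M_mult_op_tens mult.commute[of l])
  qed
  then show ?thesis by blast
qed

lemma fin_gen_pullback:
  "\<exists>B. finite B \<and> B \<subseteq> carrier M \<and> (\<forall>W. submodule W DL M \<longrightarrow> B \<subseteq> W \<longrightarrow> W = carrier M)"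
proof -
  interpret M: left_module DL M by (rule M_module)
  obtain B where B: "finite B" "B \<subseteq> carrier N"
    and span: "\<And>x. x \<in> carrier N \<Longrightarrow> \<exists>c. x = (\<Oplus>b\<in>B. sm (c b) b)"
    using N_fin by (auto simp: fin_dim_diff_module_def)
  have Bc: "b \<in> carrier N" if "b \<in> B" for b using B(2) that by blast
  have "W = carrier M" if W: "submodule W DL M" "tens 1 ` B \<subseteq> W" for W
  proof -
    note Wc = M.submoduleD[OF W(1)]
    have 1: "tens 1 x \<in> W" if x: "x \<in> carrier N" for x
    proof -
      obtain c where c: "x = (\<Oplus>b\<in>B. sm (c b) b)" using span[OF x] by blast
      have "tens 1 x = (\<Oplus>\<^bsub>M\<^esub>b\<in>B. tens 1 (sm (c b) b))"
        unfolding c by (rule add_hom_finsum[OF N_abelian M_abelian tens_add_hom B(1)]) (simp add: Bc N_smult)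
      moreover have "tens 1 (sm (c b) b) \<in> W" if b: "b \<in> B" for b
      proof -
        have "tens 1 (sm (c b) b) = mult_op (j (c b)) \<odot>\<^bsub>M\<^esub> tens 1 b"
          using tens_balanced[OF Bc[OF b], of 1 "c b"] by (simp add: M_mult_op_tens Bc[OF b])
        then show ?thesis using Wc(5)[OF mult_op_DL] W(2) b by auto
      qed
      ultimately show ?thesis using M.submodule_finsum[OF W(1) B(1)] by simp
    qed
    then show ?thesis using submodule_eq_pullback[OF W(1)] by blast
  qed
  then show ?thesis using B Bc by (intro exI[of _ "tens 1 ` B"]) auto
qed

lemma M_nonzero: "carrier M \<noteq> {\<zero>\<^bsub>M\<^esub>}"
proof
  assume M0: "carrier M = {\<zero>\<^bsub>M\<^esub>}"
  have "x = \<zero>" if x: "x \<in> carrier N" for x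
  proof (rule tens_1_inj[OF x N.zero_closed])
    have "tens 1 x \<in> {\<zero>\<^bsub>M\<^esub>}" using tens_closed[OF x] unfolding M0 .
    then show "tens 1 x = tens 1 \<zero>" by (simp add: tens_zero_right)
  qed
  then have "carrier N = {\<zero>}" using N.zero_closed by blast
  then show False using N_simple by (simp add: simple_module_def)
qed

lemma descent: "cyclic_descent DL M sig twist (\<lambda>a. mult_op (j (i a))) p"
proof (rule cyclic_descent.intro)
  show "left_module DL M" by (rule M_module)
  show "Factorial_Ring.prime p" by (rule p_prime)
  show "add_hom M M sig" by (rule sig(1))
  show "(sig ^^ p) m = m" if "m \<in> carrier M" for m by (rule sig_p[OF that])
  show "twist Q \<in> carrier DL" if "Q \<in> carrier DL" for Q by (rule twist_DL[OF that])
  show "sig (Q \<odot>\<^bsub>M\<^esub> m) = twist Q \<odot>\<^bsub>M\<^esub> sig m" if "Q \<in> carrier DL" "m \<in> carrier M" for Q m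
    by (rule sig_smult[OF that])
  show "mult_op (j (i a)) \<in> carrier DL" for a by simp
  fix a b m assume m: "m \<in> carrier M"
  show "mult_op (j (i (a + b))) \<odot>\<^bsub>M\<^esub> m = mult_op (j (i a)) \<odot>\<^bsub>M\<^esub> m \<oplus>\<^bsub>M\<^esub> mult_op (j (i b)) \<odot>\<^bsub>M\<^esub> m"
    using left_module.smult_l_distr[OF M_module mult_op_DL mult_op_DL m]
    by (simp add: field_embeddingD[OF emb_i] j_simps diff_op_ring_simps distrib_right)
  show "mult_op (j (i (a * b))) \<odot>\<^bsub>M\<^esub> m = mult_op (j (i a)) \<odot>\<^bsub>M\<^esub> (mult_op (j (i b)) \<odot>\<^bsub>M\<^esub> m)"
    using m by (simp add: M_comp field_embeddingD[OF emb_i] j_simps mult.assoc)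
  show "mult_op (j (i 1)) \<odot>\<^bsub>M\<^esub> m = m"
    using left_module.smult_one[OF M_module m] by (simp add: field_embeddingD[OF emb_i] j_simps diff_op_ring_simps id_def)
  show "Q \<odot>\<^bsub>M\<^esub> (mult_op (j (i a)) \<odot>\<^bsub>M\<^esub> m) = mult_op (j (i a)) \<odot>\<^bsub>M\<^esub> (Q \<odot>\<^bsub>M\<^esub> m)" if Q: "Q \<in> carrier DL" for Q
  proof -
    have "(\<lambda>y. Q (j (i a) * y)) = (\<lambda>y. j (i a) * Q y)" using Q unfolding carrier_diff_op_ring[OF emb_ji] by auto
    then show ?thesis using m Q by (simp add: M_comp)
  qed
  show "sig (mult_op (j (i a)) \<odot>\<^bsub>M\<^esub> m) = mult_op (j (i a)) \<odot>\<^bsub>M\<^esub> sig m"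
    using sig_smult[OF mult_op_DL m, of "j (i a)"] pow_inverse[of 1] p_pos
    by (simp add: twist_def field_embeddingD[OF emb_\<sigma>] \<sigma>_j)
next
  show "carrier M \<noteq> {\<zero>\<^bsub>M\<^esub>}" by (rule M_nonzero)
  show "W = {\<zero>\<^bsub>M\<^esub>} \<or> W = carrier M" if "submodule W DL M" "sig ` W \<subseteq> W" for W
    by (rule irreducible_pullback[OF that])
  show "\<exists>a. \<forall>m\<in>carrier M. f m = mult_op (j (i a)) \<odot>\<^bsub>M\<^esub> m"
    if "add_hom M M f" "\<And>Q m. Q \<in> carrier DL \<Longrightarrow> m \<in> carrier M \<Longrightarrow> f (Q \<odot>\<^bsub>M\<^esub> m) = Q \<odot>\<^bsub>M\<^esub> f m"
      "\<And>m. m \<in> carrier M \<Longrightarrow> f (sig m) = sig (f m)" for f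
    by (rule schur_pullback[OF that])
  show "\<exists>B. finite B \<and> B \<subseteq> carrier M \<and> (\<forall>W. submodule W DL M \<longrightarrow> B \<subseteq> W \<longrightarrow> W = carrier M)"
    by (rule fin_gen_pullback)
qed

end

section \<open>The Galois group of prime order\<close>

text \<open>In a group of prime order every element but the identity is a generator. The
  automorphisms are packed into the group \<open>G\<close> to have orders of elements at hand;
  powers in \<open>G\<close> are iterates.\<close>

lemma galois_group_generator:
  fixes j :: "'a::field \<Rightarrow> 'b::field"
  assumes p: "Factorial_Ring.prime p" "card (galois_group j) = p"
  shows "\<exists>\<sigma>\<in>galois_group j. (\<forall>y. (\<sigma> ^^ p) y = y) \<and> galois_group j = {\<sigma> ^^ s | s. True} \<and>
    (\<forall>s. 0 < s \<longrightarrow> s < p \<longrightarrow> (\<exists>y. (\<sigma> ^^ s) y \<noteq> y))"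
proof -
  define G :: "('b \<Rightarrow> 'b) monoid" where "G = \<lparr>carrier = galois_group j, monoid.mult = (\<circ>), one = id\<rparr>"
  have emb: "field_embedding \<tau> \<and> bij \<tau> \<and> (\<forall>x. \<tau> (j x) = j x)" if "\<tau> \<in> galois_group j" for \<tau>
    using that by (auto simp: galois_group_def ring_iso_def field_embedding_def ring_of_type_algebra_def)
  have mem: "\<tau> \<in> galois_group j" if "field_embedding \<tau>" "bij \<tau>" "\<And>x. \<tau> (j x) = j x" for \<tau>
    using that by (auto simp: galois_group_def ring_iso_def field_embedding_def ring_of_type_algebra_def)
  have comp: "\<tau> \<circ> \<rho> \<in> galois_group j" if "\<tau> \<in> galois_group j" "\<rho> \<in> galois_group j" for \<tau> \<rho>
    using emb[OF that(1)] emb[OF that(2)]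
    by (intro mem) (auto simp: field_embedding_def ring_hom_def ring_of_type_algebra_def intro: bij_comp)
  have id: "id \<in> galois_group j"
    by (intro mem) (auto simp: field_embedding_def ring_hom_def ring_of_type_algebra_def)
  have inv: "\<exists>\<rho>\<in>galois_group j. \<rho> \<circ> \<tau> = id" if \<tau>: "\<tau> \<in> galois_group j" for \<tau>
  proof
    define \<rho> where "\<rho> = inv_into UNIV \<tau>"
    have inj: "inj \<tau>" and surj: "surj \<tau>" using emb[OF \<tau>] by (auto simp: bij_def)
    have \<tau>\<rho>: "\<tau> (\<rho> y) = y" and \<rho>\<tau>: "\<rho> (\<tau> y) = y" for y
      using inj surj by (auto simp: \<rho>_def surj_f_inv_f)
    have eqI: "x = y" if "\<tau> x = \<tau> y" for x y using inj that by (simp add: inj_eq)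
    have e: "field_embedding \<tau>" using emb[OF \<tau>] by blast
    show "\<rho> \<in> galois_group j"
    proof (rule mem)
      show "field_embedding \<rho>"
      proof -
        have "\<rho> (x + y) = \<rho> x + \<rho> y" "\<rho> (x * y) = \<rho> x * \<rho> y" "\<rho> 1 = 1" for x y
          by (rule eqI, simp add: field_embeddingD[OF e] \<tau>\<rho>)+
        then show ?thesis
          by (simp add: field_embedding_def ring_hom_def ring_of_type_algebra_def)
      qed
      show "bij \<rho>" using \<tau>\<rho> \<rho>\<tau> by (intro o_bij[of \<tau>]) (simp_all add: fun_eq_iff)
      show "\<rho> (j x) = j x" for x by (rule eqI) (use emb[OF \<tau>] in \<open>simp add: \<tau>\<rho>\<close>)
    qed
    show "\<rho> \<circ> \<tau> = id" using \<rho>\<tau> by (simp add: fun_eq_iff)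
  qed
  have G: "group G"
    by (rule groupI) (use comp id inv in \<open>auto simp: G_def\<close>)
  interpret G: group G by (rule G)
  have ord: "Coset.order G = p" using p(2) by (simp add: Coset.order_def G_def)
  have p1: "1 < p" by (rule prime_gt_1_nat[OF p(1)])
  have "\<exists>\<sigma>\<in>galois_group j. \<sigma> \<noteq> id"
  proof (rule ccontr)
    assume "\<not> ?thesis"
    then have "galois_group j \<subseteq> {id}" by blast
    then have "card (galois_group j) \<le> 1" using card_mono[of "{id}" "galois_group j"] by simp
    then show False using p1 p(2) by simp
  qed
  then obtain \<sigma> where \<sigma>: "\<sigma> \<in> galois_group j" "\<sigma> \<noteq> id" by blast
  have \<sigma>G: "\<sigma> \<in> carrier G" using \<sigma> by (simp add: G_def)
  have pow: "\<sigma> [^]\<^bsub>G\<^esub> (n :: nat) = \<sigma> ^^ n" for n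
    by (induction n) (auto simp: G_def nat_pow_def funpow_swap1 fun_eq_iff)
  have fin: "finite (carrier G)" using p1 p(2) by (simp add: G_def card_ge_0_finite)
  have "G.ord \<sigma> dvd p" using G.ord_dvd_group_order[OF \<sigma>G] ord by simp
  moreover have "G.ord \<sigma> \<noteq> 1" using G.ord_eq_1[OF \<sigma>G] \<sigma>(2) by (simp add: G_def)
  ultimately have ordp: "G.ord \<sigma> = p" using p(1) by (auto simp: prime_nat_iff)
  show ?thesis
  proof (intro bexI[OF _ \<sigma>(1)] conjI allI impI)
    show "(\<sigma> ^^ p) y = y" for y
      using G.pow_ord_eq_1[OF \<sigma>G] unfolding ordp pow by (simp add: G_def)
    show "\<exists>y. (\<sigma> ^^ s) y \<noteq> y" if "0 < s" "s < p" for s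
    proof (rule ccontr)
      assume "\<not> ?thesis"
      then have "\<sigma> [^]\<^bsub>G\<^esub> s = \<one>\<^bsub>G\<^esub>" unfolding pow by (auto simp: G_def)
      then have "p dvd s" using G.pow_eq_id[OF \<sigma>G, of s] ordp by simp
      then show False using that by (auto dest: dvd_imp_le)
    qed
    have sub: "{\<sigma> ^^ s | s. True} \<subseteq> galois_group j"
      using G.nat_pow_closed[OF \<sigma>G] unfolding pow by (auto simp: G_def)
    have "card (galois_group j) \<le> card {\<sigma> ^^ s | s. True}"
    proof -
      have "inj_on (\<lambda>s. \<sigma> [^]\<^bsub>G\<^esub> s) {0..G.ord \<sigma> - 1}" by (rule G.ord_inj[OF \<sigma>G])
      then have "card ((\<lambda>s. \<sigma> ^^ s) ` {0..p - 1}) = p" unfolding pow ordp using p1 by (simp add: card_image)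
      moreover have "(\<lambda>s. \<sigma> ^^ s) ` {0..p - 1} \<subseteq> {\<sigma> ^^ s | s. True}" by auto
      moreover have "finite {\<sigma> ^^ s | s. True}" using sub fin by (auto simp: G_def intro: finite_subset)
      ultimately show ?thesis using p(2) card_mono by metis
    qed
    then show "galois_group j = {\<sigma> ^^ s | s. True}"
      using sub fin card_seteq[of "galois_group j" "{\<sigma> ^^ s | s. True}"] by (simp add: G_def)
  qed
qed

theorem corollary4p12:
  fixes i :: "'k::{alg_closed_field, field_char_0} \<Rightarrow> 'K::field_char_0"
    and j :: "'K \<Rightarrow> 'L::field_char_0"
    and N :: "('K \<Rightarrow> 'K, 'n) module"
    and p :: nat
  assumes "field_embedding i" and "field_embedding j"
    and "fin_gen_field_ext i" and "fin_gen_field_ext (j \<circ> i)"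
    and "finite_galois_ext j"
    and "Factorial_Ring.prime p" and "card (galois_group j) = p"
    and "simple_module (diff_op_ring i) N"
    and "fin_dim_diff_module N"
  shows "simple_module (diff_op_ring (j \<circ> i)) (pullback i j N) \<or>
    (\<exists>V. internal_direct_sum (diff_op_ring (j \<circ> i)) (pullback i j N) {1..p} V \<and>
      (\<forall>s\<in>{1..p}. simple_module (diff_op_ring (j \<circ> i)) ((pullback i j N)\<lparr>carrier := V s\<rparr>)) \<and>
      (\<forall>s\<in>{1..p}. \<forall>t\<in>{1..p}. s \<noteq> t \<longrightarrow>
        \<not> module_isomorphic (diff_op_ring (j \<circ> i))
            ((pullback i j N)\<lparr>carrier := V s\<rparr>) ((pullback i j N)\<lparr>carrier := V t\<rparr>)))"
proof -
  obtain \<sigma> where \<sigma>: "\<sigma> \<in> galois_group j" "\<forall>y. (\<sigma> ^^ p) y = y" "galois_group j = {\<sigma> ^^ s | s. True}"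
    "\<forall>s. 0 < s \<longrightarrow> s < p \<longrightarrow> (\<exists>y. (\<sigma> ^^ s) y \<noteq> y)"
    using galois_group_generator[OF assms(6,7)] by (elim bexE conjE)
  have "simple_galois_module i j \<sigma> p N"
  proof (intro simple_galois_module.intro galois_module.intro cyclic_galois.intro
      galois_module_axioms.intro simple_galois_module_axioms.intro)
    show "field_embedding \<sigma>" "\<sigma> (j c) = j c" for c
      using \<sigma>(1) by (auto simp: galois_group_def ring_iso_def field_embedding_def)
    show "0 < p" using assms(6) by (rule prime_gt_0_nat)
    show "(\<sigma> ^^ p) y = y" for y using \<sigma>(2) by blast
    show "\<exists>y. (\<sigma> ^^ s) y \<noteq> y" if "0 < s" "s < p" for s using \<sigma>(4) that by blast
    show "y \<in> range j" if "\<sigma> y = y" for y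
    proof -
      have "(\<sigma> ^^ s) y = y" for s by (induction s) (auto simp: that)
      then have "\<forall>\<tau>\<in>galois_group j. \<tau> y = y" using \<sigma>(3) by auto
      then show ?thesis using assms(5) by (auto simp: finite_galois_ext_def)
    qed
    show "left_module (diff_op_ring i) N" using assms(8) by (simp add: simple_module_def)
  qed (fact assms)+
  then show ?thesis
    by (rule cyclic_descent.simple_or_split[OF simple_galois_module.descent])
qed

end
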